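(* Let $(\mathcal C,\circ,I,\bullet,J)$ be a duoidal category with a reversion. Let $H,K$ be Hopf monoids in it and let $\psi:H\circ K\to K\circ H$ be a morphism in $\mathcal C$ such that $$\psi(m_H\circ K)=(K\circ m_H)(\psi\circ H)(H\circ\psi),\quad \psi(u_H\circ K)(l^\circ_K)^{-1}=(K\circ u_H)(r^\circ_K)^{-1},$$ $$\psi(H\circ m_K)=(m_K\circ H)(K\circ\psi)(\psi\circ K),\quad \psi(H\circ u_K)(r^\circ_H)^{-1}=(u_K\circ H)(l^\circ_H)^{-1},$$ and $\psi$ is a morphism of comonoids in $(\mathcal C,\bullet,J)$. Then $K\circ_\psi H$ is a Hopf monoid with antipode $\Sigma_{K\circ_\psi H}=\psi^{-}\phi^\circ_{K,H}(\Sigma_K\circ\Sigma_H)$ (where $\psi^-$ is the image of $\psi$ under the functor $(-)^-$). Assume further that there is a morphism of comonoids $\varepsilon^\circ_K:K\to I$ and set $$\chi:=(K\circ\varepsilon_H)\psi:H\circ K\to K\circ J,\qquad \triangleleft:=l^\circ_H(\varepsilon^\circ_K\circ H)\psi:H\circ K\to H.$$ Then $\psi=\left((u_H\varepsilon^\circ_K)^r\right)^{-1}(\chi\bullet\triangleleft)\Delta_{H\circ K}$, so $\psi$ is completely determined by the morphisms $\chi,\triangleleft$. If $\varepsilon^\circ_K$ is moreover a morphism of bimonoids, the following identities hold: $$\chi(m_H\circ K)=(K\circ m_J)(\chi\circ J)(H\circ\chi),\qquad \chi(u_H\circ K)(l^\circ_K)^{-1}=(K\circ u_J)(r^\circ_K)^{-1},$$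 $$\chi(H\circ m_K)=(m_K\circ J)(K\circ\chi)(\psi\circ K),\qquad \chi(H\circ u_K)(r^\circ_H)^{-1}=(u_K\circ\varepsilon_H)(l^\circ_H)^{-1},$$ $$\triangleleft(m_H\circ K)=m_H(\triangleleft\circ H)(H\circ\psi),\qquad \triangleleft(u_H\circ K)(l^\circ_K)^{-1}=u_H\varepsilon^\circ_K,$$ $$\triangleleft(H\circ m_K)=\triangleleft(\triangleleft\circ K),\qquad \triangleleft(H\circ u_K)(r^\circ_H)^{-1}=\mathrm{Id}_H.$$ In particular $(H,\triangleleft)$ is a right $K$-module.
   Context: Conventions: composition is juxtaposition (right to left), an object also denotes its identity morphism, associativity constraints are suppressed. Duoidal category $(\mathcal C,\circ,I,\bullet,J)$: a category with monoidal structures $(\mathcal C,\circ,I)$, $(\mathcal C,\bullet,J)$ (left/right unit constraints $l^\circ,r^\circ$, resp. $l^\bullet,r^\bullet$), a natural transformation $\zeta_{A,B,C,D}:(A\bullet B)\circ(C\bullet D)\to(A\circ C)\bullet(B\circ D)$ and morphisms $\Delta_I:I\to I\bullet I$, $m_J:J\circ J\to J$, $\varepsilon_I=u_J:I\to J$ such that $(J,m_J,u_J)$ is a monoid in $(\mathcal C,\circ,I)$, $(I,\Delta_I,\varepsilon_I)$ is a comonoid in $(\mathcal C,\bullet,J)$, and $\zeta_{A,B,C\circ E,D\circ F}((A\bullet B)\circ\zeta_{C,D,E,F})=\zeta_{A\circ C,B\circ D,E,F}(\zeta_{A,B,C,D}\circ(E\bullet F))$, $((A\circ D)\bullet\zeta_{B,C,E,F})\zeta_{A,B\bullet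 C,D,E\bullet F}=(\zeta_{A,B,D,E}\bullet(C\circ F))\zeta_{A\bullet B,C,D\bullet E,F}$, $(l^\circ_A\bullet l^\circ_B)\zeta_{I,I,A,B}(\Delta_I\circ(A\bullet B))=l^\circ_{A\bullet B}$, $(r^\circ_A\bullet r^\circ_B)\zeta_{A,B,I,I}((A\bullet B)\circ\Delta_I)=r^\circ_{A\bullet B}$, $l^\bullet_{A\circ B}(m_J\bullet(A\circ B))\zeta_{J,A,J,B}=l^\bullet_A\circ l^\bullet_B$, $r^\bullet_{A\circ B}((A\circ B)\bullet m_J)\zeta_{A,J,B,J}=r^\bullet_A\circ r^\bullet_B$. Bimonoid: $(H,m_H,u_H,\Delta_H,\varepsilon_H)$ with $(H,m_H,u_H)$ a monoid in $(\mathcal C,\circ,I)$, $(H,\Delta_H,\varepsilon_H)$ a comonoid in $(\mathcal C,\bullet,J)$ and $\Delta_Hm_H=(m_H\bullet m_H)\zeta_{H,H,H,H}(\Delta_H\circ\Delta_H)$, $\varepsilon_Hm_H=m_J(\varepsilon_H\circ\varepsilon_H)$, $\Delta_Hu_H=(u_H\bullet u_H)\Delta_I$, $\varepsilon_Hu_H=\varepsilon_I$; morphisms are morphisms of monoids and comonoids. $I$ is a bimonoid with the canonical monoid structure. Comonoids in $(\mathcal C,\bullet,J)$ are stable under $\circ$ via $\Delta_{C\circ D}=\zeta_{C,C,D,D}(\Delta_C\circ\Delta_D)$, $\varepsilon_{C\circ D}=m_J(\varepsilon_C\circ\varepsilon_D)$. Reversion: a functor $(-)^-:\mathcal C\to\mathcal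 C$ with lax monoidal structures $(\phi^\circ_{X,Y}:X^-\circ Y^-\to(Y\circ X)^-,\ \phi^\circ_0:I\to I^-)$ from $(\mathcal C,\circ^{\mathrm{rev}})$ to $(\mathcal C,\circ)$ and $(\phi^\bullet_{X,Y}:X^-\bullet Y^-\to(Y\bullet X)^-,\ \phi^\bullet_0:J\to J^-)$ from $(\mathcal C,\bullet^{\mathrm{rev}})$ to $(\mathcal C,\bullet)$ ($\mathrm{rev}$ = reversed tensor product), forming a double lax monoidal functor $(\mathcal C,\circ^{\mathrm{rev}},\bullet^{\mathrm{rev}})\to(\mathcal C,\circ,\bullet)$, i.e. $\phi^\bullet_{C\circ A,D\circ B}(\phi^\circ_{A,C}\bullet\phi^\circ_{B,D})\zeta_{A^-,B^-,C^-,D^-}=(\zeta_{D,C,B,A})^-\phi^\circ_{B\bullet A,D\bullet C}(\phi^\bullet_{A,B}\circ\phi^\bullet_{C,D})$, $\phi^\bullet_{I,I}(\phi^\circ_0\bullet\phi^\circ_0)\Delta_I=(\Delta_I)^-\phi^\circ_0$, $(m_J)^-\phi^\circ_{J,J}(\phi^\bullet_0\circ\phi^\bullet_0)=\phi^\bullet_0m_J$, $\phi^\bullet_0\varepsilon_I=(\varepsilon_I)^-\phi^\circ_0$; together with natural transformations $\gamma_{X,Y,Z,T}:((X\bullet Y^-)\circ Z)\bullet T\to X\circ(Z\bullet(Y\circ T))$, $\delta_{X,Y,Z,T}:X\bullet(Y\circ(Z^-\bullet T))\to((X\circ Z)\bullet Y)\circ T$, $\widetilde\gamma_{X,Y,Z,T}:X^-\bullet((Y\bullet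 Z)\circ T)\to Z\circ((X\circ Y)^-\bullet T)$, $\widetilde\delta_{X,Y,Z,T}:(X\circ(Y\bullet Z))\bullet T^-\to(X\bullet(Z\circ T)^-)\circ Y$. Put $\psi_{X,Y}=\gamma_{J,X,I,Y}(((l^\bullet_{X^-})^{-1}\circ I)\bullet Y)((r^\circ_{X^-})^{-1}\bullet Y):X^-\bullet Y\to J\circ(I\bullet(X\circ Y))$, $\varphi_{X,Y}=\delta_{X,I,Y,J}(X\bullet(I\circ(r^\bullet_{Y^-})^{-1}))(X\bullet(l^\circ_{Y^-})^{-1}):X\bullet Y^-\to((X\circ Y)\bullet I)\circ J$, $\widetilde\psi_{X,Y}=l^\circ_{(X\circ Y)^-}(I\circ r^\bullet_{(X\circ Y)^-})\widetilde\gamma_{X,Y,I,J}:X^-\bullet((Y\bullet I)\circ J)\to(X\circ Y)^-$, $\widetilde\varphi_{X,Y}=r^\circ_{(X\circ Y)^-}(l^\bullet_{(X\circ Y)^-}\circ I)\widetilde\delta_{J,I,X,Y}:(J\circ(I\bullet X))\bullet Y^-\to(X\circ Y)^-$. Axioms, for all objects ($\Delta_J:J\to J\bullet J$ is the inverse unit constraint): (R1) $\gamma_{X,Y,Z\circ U,T\circ V}\zeta_{(X\bullet Y^-)\circ Z,T,U,V}=(X\circ\zeta_{Z,Y\circ T,U,V})(\gamma_{X,Y,Z,T}\circ(U\bullet V))$. (R2) $((X\circ T)\bullet\gamma_{Y,Z,U,V})(\zeta_{X,Y\bullet Z^-,T,U}\bullet V)=\zeta_{X,Y,T,U\bullet(Z\circ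 V)}\gamma_{X\bullet Y,Z,T\bullet U,V}$. (R3) $\delta_{X\circ Z,Y\circ T,U,V}\zeta_{X,Y,Z,T\circ(U^-\bullet V)}=(\zeta_{X,Y,Z\circ U,T}\circ V)((X\bullet Y)\circ\delta_{Z,T,U,V})$. (R4) $(\delta_{X,Y,T,U}\bullet(Z\circ V))(X\bullet\zeta_{Y,Z,T^-\bullet U,V})=\zeta_{(X\circ T)\bullet Y,Z,U,V}\delta_{X,Y\bullet Z,T,U\bullet V}$. (R5) $\delta_{X,Y,T,U\bullet(Z\circ V)}(X\bullet\gamma_{Y,Z,T^-\bullet U,V})=\gamma_{(X\circ T)\bullet Y,Z,U,V}(\delta_{X,Y\bullet Z^-,T,U}\bullet V)$. (R6) $l^\circ_{I\bullet I}(I\circ(I\bullet l^\circ_I))\gamma_{I,I,I,I}(((I\bullet\phi^\circ_0)\Delta_I\circ I)\bullet I)=l^\circ_I\bullet I$. (R7) $r^\circ_{I\bullet I}((r^\circ_I\bullet I)\circ I)\delta_{I,I,I,I}(I\bullet(I\circ(\phi^\circ_0\bullet I)\Delta_I))=I\bullet r^\circ_I$. (R8) $\gamma_{X\circ Z,Y,J\circ J,U}((\delta_{X,Y^-,Z,J}\circ J)\bullet U)(((X\bullet(Y^-\circ(r^\bullet_{Z^-})^{-1}))\circ J)\bullet U)=(X\circ Z\circ\zeta_{J,Y,J,U})(X\circ Z\circ(l^\bullet_Y)^{-1}\circ(l^\bullet_U)^{-1})(X\circ l^\bullet_{Z\circ Y\circ U})\gamma_{X,Z\circ Y,J,U}(((X\bullet\phi^\circ_{Y,Z})\circ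 J)\bullet U)$. (R9) $\delta_{X,J\circ J,Z,Y\circ U}(X\bullet(J\circ\gamma_{J,Y,Z^-,U}))(X\bullet(J\circ(((l^\bullet_{Y^-})^{-1}\circ Z^-)\bullet U)))=(\zeta_{X,J,Z,J}\circ Y\circ U)((r^\bullet_X)^{-1}\circ(r^\bullet_Z)^{-1}\circ Y\circ U)(r^\bullet_{X\circ Z\circ Y}\circ U)\delta_{X,J,Z\circ Y,U}(X\bullet(J\circ(\phi^\circ_{Y,Z}\bullet U)))$. (R10) $\widetilde\varphi_{X\circ Y,Z}(\psi_{X,Y}\bullet Z^-)=\widetilde\psi_{X,Y\circ Z}(X^-\bullet\varphi_{Y,Z})$. (R11) $(r^\circ_X)^-l^\circ_{(X\circ I)^-}(I\circ r^\bullet_{(X\circ I)^-})\widetilde\gamma_{X,I,I,J}(X^-\bullet(\Delta_I\circ J))=r^\bullet_{X^-}(X^-\bullet l^\circ_J)$. (R12) $(l^\circ_X)^-r^\circ_{(I\circ X)^-}(l^\bullet_{(I\circ X)^-}\circ I)\widetilde\delta_{J,I,I,X}((J\circ\Delta_I)\bullet X^-)=l^\bullet_{X^-}(r^\circ_J\bullet X^-)$. (R13) $\gamma_{X,Y,T\bullet(Z\circ U),V}(\gamma_{X\bullet Y^-,Z,T,U}\bullet V)=(X\circ(T\bullet\zeta_{Z,Y,U,V}))\gamma_{X,Z\bullet Y,T,U\bullet V}(((X\bullet\phi^\bullet_{Y,Z})\circ T)\bullet U\bullet V)$. (R14) $\delta_{X,(Y\circ T)\bullet Z,U,V}(X\bullet\delta_{Y,Z,T,U^-\bullet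 V})=((\zeta_{X,Y,U,T}\bullet Z)\circ V)\delta_{X\bullet Y,Z,U\bullet T,V}(X\bullet Y\bullet(Z\circ(\phi^\bullet_{T,U}\bullet V)))$. (R15) $(X\circ\gamma_{Z,T,U,Y\circ V})\gamma_{X,Y,(Z\bullet T^-)\circ U,V}=\gamma_{X\circ Z,T\circ Y,U,V}((((X\circ Z)\bullet\phi^\circ_{Y,T})\circ U)\bullet V)((\zeta_{X,Y^-,Z,T^-}\circ U)\bullet V)$. (R16) $(\delta_{X\circ U,Y,Z,T}\circ V)\delta_{X,Y\circ(Z^-\bullet T),U,V}=\delta_{X,Y,U\circ Z,T\circ V}(X\bullet(Y\circ(\phi^\circ_{Z,U}\bullet(T\circ V))))(X\bullet(Y\circ\zeta_{Z^-,T,U^-,V}))$. (R17) $r^\circ_J(J\circ r^\bullet_I)(J\circ(I\bullet m_J))\gamma_{J,J,I,J}(((J\bullet\phi^\bullet_0)\Delta_J\circ I)\bullet J)=r^\bullet_J(r^\circ_J\bullet J)$. (R18) $l^\circ_J(l^\bullet_I\circ J)((m_J\bullet I)\circ J)\delta_{J,I,J,J}(J\bullet(I\circ(\phi^\bullet_0\bullet J)\Delta_J))=l^\bullet_J(J\bullet l^\circ_J)$. Hopf monoid: a bimonoid $H$ with an antipode, i.e. a morphism $\Sigma_H:H\to H^-$ in $\mathcal C$ such that $((m_H\bullet I)\circ J)\varphi_{H,H}(H\bullet\Sigma_H)\Delta_H=((u_H\bullet I)\circ J)(\Delta_I\circ J)(l^\circ_J)^{-1}\varepsilon_H$ and $(J\circ(I\bullet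 m_H))\psi_{H,H}(\Sigma_H\bullet H)\Delta_H=(J\circ(I\bullet u_H))(J\circ\Delta_I)(r^\circ_J)^{-1}\varepsilon_H$ (here $\psi_{H,H},\varphi_{H,H}$ are components of the natural transformations above, not to be confused with the morphism $\psi$ of the claim). $K\circ_\psi H$ is $K\circ H$ with $m=(m_K\circ m_H)(K\circ\psi\circ H)$, $u=(u_K\circ u_H)(m_I)^{-1}$ with $m_I=l^\circ_I$, $\Delta=\zeta_{K,K,H,H}(\Delta_K\circ\Delta_H)$, $\varepsilon=m_J(\varepsilon_K\circ\varepsilon_H)$. For a morphism of comonoids $g:C\to H$ in $(\mathcal C,\bullet,J)$ with $H$ a bimonoid, $g^r:=((C\circ\varepsilon_H)\bullet m_H(g\circ H))\Delta_{C\circ H}:C\circ H\to(C\circ J)\bullet H$; it is invertible when $H$ is a Hopf monoid. *)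

theory Defs
  imports Main
begin

text \<open>
  Categories are given in the single-sorted form: there are only arrows, and an object is
  identified with its identity arrow. This matches the convention that an object also denotes its
  identity morphism: for an object \<open>X\<close> and an arrow \<open>f\<close>, the tensor product \<open>X \<otimes> f\<close> is literally
  the tensor product of the arrows \<open>X\<close> and \<open>f\<close>. Operations are only meaningful on \<open>arrows\<close> (and
  composition only on composable pairs); families of components such as \<open>assoc\<close>
  only at objects.
\<close>

record 'a category =
  arrows :: "'a set"  (\<open>Arr\<index>\<close>)
  source :: "'a \<Rightarrow> 'a"  (\<open>src\<index>\<close>)
  target :: "'a \<Rightarrow> 'a"  (\<open>tgt\<index>\<close>)
  compose :: "'a \<Rightarrow> 'a \<Rightarrow> 'a"  (infixr \<open>\<cdot>\<index>\<close> 55)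

context
  fixes C :: "('a, 'b) category_scheme" (structure)
begin

definition objects :: "'a set"
  where "objects = {X \<in> Arr. src X = X}"

definition hom :: "'a \<Rightarrow> 'a \<Rightarrow> 'a set"
  where "hom X Y = {f \<in> Arr. src f = X \<and> tgt f = Y}"

definition inverse_arrows :: "'a \<Rightarrow> 'a \<Rightarrow> bool"
  where "inverse_arrows f g \<longleftrightarrow> f \<in> Arr \<and> g \<in> hom (tgt f) (src f) \<and> g \<cdot> f = src f \<and> f \<cdot> g = tgt f"

definition iso :: "'a \<Rightarrow> bool"
  where "iso f \<longleftrightarrow> (\<exists>g. inverse_arrows f g)"

definition inverse_arrow :: "'a \<Rightarrow> 'a"
  where "inverse_arrow f = (THE g. inverse_arrows f g)"

end

notation objects (\<open>Ob\<index>\<close>)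
notation hom (\<open>Hom\<index>\<close>)
notation inverse_arrow (\<open>inv\<index> _\<close> [81] 80)

locale category =
  fixes C :: "('a, 'b) category_scheme" (structure)
  assumes src_in: "f \<in> Arr \<Longrightarrow> src f \<in> Arr"
    and tgt_in: "f \<in> Arr \<Longrightarrow> tgt f \<in> Arr"
    and src_src: "f \<in> Arr \<Longrightarrow> src (src f) = src f"
    and tgt_src: "f \<in> Arr \<Longrightarrow> tgt (src f) = src f"
    and src_tgt: "f \<in> Arr \<Longrightarrow> src (tgt f) = tgt f"
    and tgt_tgt: "f \<in> Arr \<Longrightarrow> tgt (tgt f) = tgt f"
    and comp_in: "\<lbrakk>f \<in> Hom X Y; g \<in> Hom Y Z\<rbrakk> \<Longrightarrow> g \<cdot> f \<in> Hom X Z"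
    and comp_assoc: "\<lbrakk>f \<in> Hom X Y; g \<in> Hom Y Z; h \<in> Hom Z W\<rbrakk> \<Longrightarrow> (h \<cdot> g) \<cdot> f = h \<cdot> (g \<cdot> f)"
    and comp_src: "f \<in> Arr \<Longrightarrow> f \<cdot> src f = f"
    and comp_tgt: "f \<in> Arr \<Longrightarrow> tgt f \<cdot> f = f"

locale endofunctor = category C
  for C :: "('a, 'b) category_scheme" (structure) +
  fixes F :: "'a \<Rightarrow> 'a"
  assumes functor_in: "f \<in> Hom X Y \<Longrightarrow> F f \<in> Hom (F X) (F Y)"
    and functor_comp: "\<lbrakk>f \<in> Hom X Y; g \<in> Hom Y Z\<rbrakk> \<Longrightarrow> F (g \<cdot> f) = F g \<cdot> F f"

record 'a tensor_structure =
  tensor :: "'a \<Rightarrow> 'a \<Rightarrow> 'a"  (infix \<open>\<otimes>\<index>\<close> 70)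
  tunit :: 'a  (\<open>\<one>\<index>\<close>)
  assoc :: "'a \<Rightarrow> 'a \<Rightarrow> 'a \<Rightarrow> 'a"  (\<open>\<aa>\<index>\<close>)
  lunitor :: "'a \<Rightarrow> 'a"  (\<open>\<ll>\<index>\<close>)
  runitor :: "'a \<Rightarrow> 'a"  (\<open>\<rr>\<index>\<close>)

locale monoidal_category = category C
  for C :: "('a, 'b) category_scheme" (structure)
    and M :: "'a tensor_structure" (structure) +
  assumes tensor_in:
    "\<lbrakk>f \<in> Hom X Y; f' \<in> Hom X' Y'\<rbrakk> \<Longrightarrow> f \<otimes>\<^bsub>M\<^esub> f' \<in> Hom (X \<otimes>\<^bsub>M\<^esub> X') (Y \<otimes>\<^bsub>M\<^esub> Y')"
    and tensor_comp:
    "\<lbrakk>f \<in> Hom X Y; g \<in> Hom Y Z; f' \<in> Hom X' Y'; g' \<in> Hom Y' Z'\<rbrakk>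
      \<Longrightarrow> (g \<cdot> f) \<otimes>\<^bsub>M\<^esub> (g' \<cdot> f') = (g \<otimes>\<^bsub>M\<^esub> g') \<cdot> (f \<otimes>\<^bsub>M\<^esub> f')"
    and tunit_ob: "\<one>\<^bsub>M\<^esub> \<in> Ob"
    and assoc_in: "\<lbrakk>X \<in> Ob; Y \<in> Ob; Z \<in> Ob\<rbrakk>
      \<Longrightarrow> \<aa>\<^bsub>M\<^esub> X Y Z \<in> Hom ((X \<otimes>\<^bsub>M\<^esub> Y) \<otimes>\<^bsub>M\<^esub> Z) (X \<otimes>\<^bsub>M\<^esub> (Y \<otimes>\<^bsub>M\<^esub> Z))"
    and assoc_iso: "\<lbrakk>X \<in> Ob; Y \<in> Ob; Z \<in> Ob\<rbrakk> \<Longrightarrow> iso C (\<aa>\<^bsub>M\<^esub> X Y Z)"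
    and assoc_nat: "\<lbrakk>f \<in> Hom X X'; g \<in> Hom Y Y'; h \<in> Hom Z Z'\<rbrakk>
      \<Longrightarrow> \<aa>\<^bsub>M\<^esub> X' Y' Z' \<cdot> ((f \<otimes>\<^bsub>M\<^esub> g) \<otimes>\<^bsub>M\<^esub> h) = (f \<otimes>\<^bsub>M\<^esub> (g \<otimes>\<^bsub>M\<^esub> h)) \<cdot> \<aa>\<^bsub>M\<^esub> X Y Z"
    and lunitor_in: "X \<in> Ob \<Longrightarrow> \<ll>\<^bsub>M\<^esub> X \<in> Hom (\<one>\<^bsub>M\<^esub> \<otimes>\<^bsub>M\<^esub> X) X"
    and lunitor_iso: "X \<in> Ob \<Longrightarrow> iso C (\<ll>\<^bsub>M\<^esub> X)"
    and lunitor_nat: "f \<in> Hom X Y \<Longrightarrow> \<ll>\<^bsub>M\<^esub> Y \<cdot> (\<one>\<^bsub>M\<^esub> \<otimes>\<^bsub>M\<^esub> f) = f \<cdot> \<ll>\<^bsub>M\<^esub> X"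
    and runitor_in: "X \<in> Ob \<Longrightarrow> \<rr>\<^bsub>M\<^esub> X \<in> Hom (X \<otimes>\<^bsub>M\<^esub> \<one>\<^bsub>M\<^esub>) X"
    and runitor_iso: "X \<in> Ob \<Longrightarrow> iso C (\<rr>\<^bsub>M\<^esub> X)"
    and runitor_nat: "f \<in> Hom X Y \<Longrightarrow> \<rr>\<^bsub>M\<^esub> Y \<cdot> (f \<otimes>\<^bsub>M\<^esub> \<one>\<^bsub>M\<^esub>) = f \<cdot> \<rr>\<^bsub>M\<^esub> X"
    and pentagon: "\<lbrakk>X \<in> Ob; Y \<in> Ob; Z \<in> Ob; W \<in> Ob\<rbrakk>
      \<Longrightarrow> (X \<otimes>\<^bsub>M\<^esub> \<aa>\<^bsub>M\<^esub> Y Z W) \<cdot> \<aa>\<^bsub>M\<^esub> X (Y \<otimes>\<^bsub>M\<^esub> Z) W \<cdot> (\<aa>\<^bsub>M\<^esub> X Y Z \<otimes>\<^bsub>M\<^esub> W)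
        = \<aa>\<^bsub>M\<^esub> X Y (Z \<otimes>\<^bsub>M\<^esub> W) \<cdot> \<aa>\<^bsub>M\<^esub> (X \<otimes>\<^bsub>M\<^esub> Y) Z W"
    and triangle: "\<lbrakk>X \<in> Ob; Y \<in> Ob\<rbrakk>
      \<Longrightarrow> (X \<otimes>\<^bsub>M\<^esub> \<ll>\<^bsub>M\<^esub> Y) \<cdot> \<aa>\<^bsub>M\<^esub> X \<one>\<^bsub>M\<^esub> Y = \<rr>\<^bsub>M\<^esub> X \<otimes>\<^bsub>M\<^esub> Y"

definition rev_tensor :: "('a, 'b) category_scheme \<Rightarrow> 'a tensor_structure \<Rightarrow> 'a tensor_structure"
  where "rev_tensor C M =
    \<lparr>tensor = (\<lambda>f g. g \<otimes>\<^bsub>M\<^esub> f), tunit = \<one>\<^bsub>M\<^esub>,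
     assoc = (\<lambda>X Y Z. inv\<^bsub>C\<^esub> (\<aa>\<^bsub>M\<^esub> Z Y X)), lunitor = \<rr>\<^bsub>M\<^esub>, runitor = \<ll>\<^bsub>M\<^esub>\<rparr>"

locale lax_monoidal_endofunctor = endofunctor C F
  for C :: "('a, 'b) category_scheme" (structure)
    and M M' :: "'a tensor_structure"
    and F :: "'a \<Rightarrow> 'a" +
  fixes \<phi> :: "'a \<Rightarrow> 'a \<Rightarrow> 'a" and \<phi>0 :: 'a
  assumes lax_in: "\<lbrakk>X \<in> Ob; Y \<in> Ob\<rbrakk> \<Longrightarrow> \<phi> X Y \<in> Hom (F X \<otimes>\<^bsub>M'\<^esub> F Y) (F (X \<otimes>\<^bsub>M\<^esub> Y))"
    and lax_nat: "\<lbrakk>f \<in> Hom X X'; g \<in> Hom Y Y'\<rbrakk>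
      \<Longrightarrow> \<phi> X' Y' \<cdot> (F f \<otimes>\<^bsub>M'\<^esub> F g) = F (f \<otimes>\<^bsub>M\<^esub> g) \<cdot> \<phi> X Y"
    and lax_unit_in: "\<phi>0 \<in> Hom \<one>\<^bsub>M'\<^esub> (F \<one>\<^bsub>M\<^esub>)"
    and lax_assoc: "\<lbrakk>X \<in> Ob; Y \<in> Ob; Z \<in> Ob\<rbrakk>
      \<Longrightarrow> F (\<aa>\<^bsub>M\<^esub> X Y Z) \<cdot> \<phi> (X \<otimes>\<^bsub>M\<^esub> Y) Z \<cdot> (\<phi> X Y \<otimes>\<^bsub>M'\<^esub> F Z)
        = \<phi> X (Y \<otimes>\<^bsub>M\<^esub> Z) \<cdot> (F X \<otimes>\<^bsub>M'\<^esub> \<phi> Y Z) \<cdot> \<aa>\<^bsub>M'\<^esub> (F X) (F Y) (F Z)"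
    and lax_lunit: "X \<in> Ob \<Longrightarrow> F (\<ll>\<^bsub>M\<^esub> X) \<cdot> \<phi> \<one>\<^bsub>M\<^esub> X \<cdot> (\<phi>0 \<otimes>\<^bsub>M'\<^esub> F X) = \<ll>\<^bsub>M'\<^esub> (F X)"
    and lax_runit: "X \<in> Ob \<Longrightarrow> F (\<rr>\<^bsub>M\<^esub> X) \<cdot> \<phi> X \<one>\<^bsub>M\<^esub> \<cdot> (F X \<otimes>\<^bsub>M'\<^esub> \<phi>0) = \<rr>\<^bsub>M'\<^esub> (F X)"

text \<open>
  Monoids \<open>(X, m, u)\<close> and comonoids \<open>(X, d, e)\<close> in a monoidal category are represented as triples.
\<close>

context
  fixes C :: "('a, 'b) category_scheme" (structure)
    and M :: "'a tensor_structure"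
begin

definition monoid_object :: "'a \<times> 'a \<times> 'a \<Rightarrow> bool"
  where "monoid_object = (\<lambda>(X, m, u).
    X \<in> Ob \<and> m \<in> Hom (X \<otimes>\<^bsub>M\<^esub> X) X \<and> u \<in> Hom \<one>\<^bsub>M\<^esub> X \<and>
    m \<cdot> (m \<otimes>\<^bsub>M\<^esub> X) = m \<cdot> (X \<otimes>\<^bsub>M\<^esub> m) \<cdot> \<aa>\<^bsub>M\<^esub> X X X \<and>
    m \<cdot> (u \<otimes>\<^bsub>M\<^esub> X) = \<ll>\<^bsub>M\<^esub> X \<and> m \<cdot> (X \<otimes>\<^bsub>M\<^esub> u) = \<rr>\<^bsub>M\<^esub> X)"

definition comonoid_object :: "'a \<times> 'a \<times> 'a \<Rightarrow> bool"
  where "comonoid_object = (\<lambda>(X, d, e).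
    X \<in> Ob \<and> d \<in> Hom X (X \<otimes>\<^bsub>M\<^esub> X) \<and> e \<in> Hom X \<one>\<^bsub>M\<^esub> \<and>
    \<aa>\<^bsub>M\<^esub> X X X \<cdot> (d \<otimes>\<^bsub>M\<^esub> X) \<cdot> d = (X \<otimes>\<^bsub>M\<^esub> d) \<cdot> d \<and>
    \<ll>\<^bsub>M\<^esub> X \<cdot> (e \<otimes>\<^bsub>M\<^esub> X) \<cdot> d = X \<and> \<rr>\<^bsub>M\<^esub> X \<cdot> (X \<otimes>\<^bsub>M\<^esub> e) \<cdot> d = X)"

definition monoid_morphism :: "'a \<times> 'a \<times> 'a \<Rightarrow> 'a \<times> 'a \<times> 'a \<Rightarrow> 'a \<Rightarrow> bool"
  where "monoid_morphism = (\<lambda>(X, m, u) (X', m', u') f.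
    f \<in> Hom X X' \<and> f \<cdot> m = m' \<cdot> (f \<otimes>\<^bsub>M\<^esub> f) \<and> f \<cdot> u = u')"

definition comonoid_morphism :: "'a \<times> 'a \<times> 'a \<Rightarrow> 'a \<times> 'a \<times> 'a \<Rightarrow> 'a \<Rightarrow> bool"
  where "comonoid_morphism = (\<lambda>(X, d, e) (X', d', e') f.
    f \<in> Hom X X' \<and> d' \<cdot> f = (f \<otimes>\<^bsub>M\<^esub> f) \<cdot> d \<and> e' \<cdot> f = e)"

definition right_module :: "'a \<times> 'a \<times> 'a \<Rightarrow> 'a \<Rightarrow> 'a \<Rightarrow> bool"
  where "right_module = (\<lambda>(A, m, u) X act.
    X \<in> Ob \<and> act \<in> Hom (X \<otimes>\<^bsub>M\<^esub> A) X \<and>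
    act \<cdot> (act \<otimes>\<^bsub>M\<^esub> A) = act \<cdot> (X \<otimes>\<^bsub>M\<^esub> m) \<cdot> \<aa>\<^bsub>M\<^esub> X A A \<and>
    act \<cdot> (X \<otimes>\<^bsub>M\<^esub> u) = \<rr>\<^bsub>M\<^esub> X)"

end

text \<open>
  The first tensor product \<open>\<circ>\<close> of a duoidal category, with unit \<open>I\<close>, is written \<open>\<odot>\<close> here, with
  unit \<open>\<I>\<close>; the second one, with unit \<open>J\<close>, is written \<open>\<bullet>\<close>, with unit \<open>\<J>\<close>. Neither tensor
  product is assumed to be strict: the associativity constraints, which are customarily suppressed,
  are inserted explicitly wherever the two sides of an equation are bracketed differently.
  The morphism \<open>\<epsilon>\<^sub>I = u\<^sub>J\<close> is a single field.
\<close>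

record 'a duoidal = "'a category" +
  circ :: "'a tensor_structure"
  bul :: "'a tensor_structure"
  interchange :: "'a \<Rightarrow> 'a \<Rightarrow> 'a \<Rightarrow> 'a \<Rightarrow> 'a"  (\<open>\<zeta>\<index>\<close>)
  comult_I :: 'a  (\<open>\<Delta>\<^sub>I\<index>\<close>)
  mult_J :: 'a  (\<open>\<mm>\<^sub>J\<index>\<close>)
  counit_I :: 'a  (\<open>\<epsilon>\<^sub>I\<index>\<close>)

abbreviation circ_tensor :: "('a, 'b) duoidal_scheme \<Rightarrow> 'a \<Rightarrow> 'a \<Rightarrow> 'a" (infix \<open>\<odot>\<index>\<close> 70)
  where "f \<odot>\<^bsub>D\<^esub> g \<equiv> f \<otimes>\<^bsub>circ D\<^esub> g"
abbreviation circ_unit :: "('a, 'b) duoidal_scheme \<Rightarrow> 'a" (\<open>\<I>\<index>\<close>)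
  where "\<I>\<^bsub>D\<^esub> \<equiv> \<one>\<^bsub>circ D\<^esub>"
abbreviation circ_assoc :: "('a, 'b) duoidal_scheme \<Rightarrow> 'a \<Rightarrow> 'a \<Rightarrow> 'a \<Rightarrow> 'a" (\<open>\<aa>\<^sub>\<odot>\<index>\<close>)
  where "\<aa>\<^sub>\<odot>\<^bsub>D\<^esub> \<equiv> \<aa>\<^bsub>circ D\<^esub>"
abbreviation circ_lunitor :: "('a, 'b) duoidal_scheme \<Rightarrow> 'a \<Rightarrow> 'a" (\<open>\<ll>\<^sub>\<odot>\<index>\<close>)
  where "\<ll>\<^sub>\<odot>\<^bsub>D\<^esub> \<equiv> \<ll>\<^bsub>circ D\<^esub>"
abbreviation circ_runitor :: "('a, 'b) duoidal_scheme \<Rightarrow> 'a \<Rightarrow> 'a" (\<open>\<rr>\<^sub>\<odot>\<index>\<close>)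
  where "\<rr>\<^sub>\<odot>\<^bsub>D\<^esub> \<equiv> \<rr>\<^bsub>circ D\<^esub>"

abbreviation bul_tensor :: "('a, 'b) duoidal_scheme \<Rightarrow> 'a \<Rightarrow> 'a \<Rightarrow> 'a" (infix \<open>\<bullet>\<index>\<close> 70)
  where "f \<bullet>\<^bsub>D\<^esub> g \<equiv> f \<otimes>\<^bsub>bul D\<^esub> g"
abbreviation bul_unit :: "('a, 'b) duoidal_scheme \<Rightarrow> 'a" (\<open>\<J>\<index>\<close>)
  where "\<J>\<^bsub>D\<^esub> \<equiv> \<one>\<^bsub>bul D\<^esub>"
abbreviation bul_assoc :: "('a, 'b) duoidal_scheme \<Rightarrow> 'a \<Rightarrow> 'a \<Rightarrow> 'a \<Rightarrow> 'a" (\<open>\<aa>\<^sub>\<bullet>\<index>\<close>)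
  where "\<aa>\<^sub>\<bullet>\<^bsub>D\<^esub> \<equiv> \<aa>\<^bsub>bul D\<^esub>"
abbreviation bul_lunitor :: "('a, 'b) duoidal_scheme \<Rightarrow> 'a \<Rightarrow> 'a" (\<open>\<ll>\<^sub>\<bullet>\<index>\<close>)
  where "\<ll>\<^sub>\<bullet>\<^bsub>D\<^esub> \<equiv> \<ll>\<^bsub>bul D\<^esub>"
abbreviation bul_runitor :: "('a, 'b) duoidal_scheme \<Rightarrow> 'a \<Rightarrow> 'a" (\<open>\<rr>\<^sub>\<bullet>\<index>\<close>)
  where "\<rr>\<^sub>\<bullet>\<^bsub>D\<^esub> \<equiv> \<rr>\<^bsub>bul D\<^esub>"

locale duoidal_category =
  circ: monoidal_category D "circ D" + bul: monoidal_category D "bul D"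
  for D :: "('a, 'b) duoidal_scheme" (structure) +
  assumes zeta_in: "\<lbrakk>X \<in> Ob; Y \<in> Ob; Z \<in> Ob; T \<in> Ob\<rbrakk>
      \<Longrightarrow> \<zeta> X Y Z T \<in> Hom ((X \<bullet> Y) \<odot> (Z \<bullet> T)) ((X \<odot> Z) \<bullet> (Y \<odot> T))"
    and zeta_nat: "\<lbrakk>f \<in> Hom X X'; g \<in> Hom Y Y'; h \<in> Hom Z Z'; k \<in> Hom T T'\<rbrakk>
      \<Longrightarrow> \<zeta> X' Y' Z' T' \<cdot> ((f \<bullet> g) \<odot> (h \<bullet> k)) = ((f \<odot> h) \<bullet> (g \<odot> k)) \<cdot> \<zeta> X Y Z T"
    and monoid_J: "monoid_object D (circ D) (\<J>, \<mm>\<^sub>J, \<epsilon>\<^sub>I)"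
    and comonoid_I: "comonoid_object D (bul D) (\<I>, \<Delta>\<^sub>I, \<epsilon>\<^sub>I)"
    and zeta_circ_assoc:
    "\<lbrakk>X \<in> Ob; Y \<in> Ob; Z \<in> Ob; T \<in> Ob; U \<in> Ob; V \<in> Ob\<rbrakk>
      \<Longrightarrow> \<zeta> X Y (Z \<odot> U) (T \<odot> V) \<cdot> ((X \<bullet> Y) \<odot> \<zeta> Z T U V) \<cdot> \<aa>\<^sub>\<odot> (X \<bullet> Y) (Z \<bullet> T) (U \<bullet> V)
        = (\<aa>\<^sub>\<odot> X Z U \<bullet> \<aa>\<^sub>\<odot> Y T V) \<cdot> \<zeta> (X \<odot> Z) (Y \<odot> T) U V \<cdot> (\<zeta> X Y Z T \<odot> (U \<bullet> V))"
    and zeta_bul_assoc: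
    "\<lbrakk>A \<in> Ob; B \<in> Ob; E \<in> Ob; X \<in> Ob; Y \<in> Ob; Z \<in> Ob\<rbrakk>
      \<Longrightarrow> ((A \<odot> X) \<bullet> \<zeta> B E Y Z) \<cdot> \<zeta> A (B \<bullet> E) X (Y \<bullet> Z) \<cdot> (\<aa>\<^sub>\<bullet> A B E \<odot> \<aa>\<^sub>\<bullet> X Y Z)
        = \<aa>\<^sub>\<bullet> (A \<odot> X) (B \<odot> Y) (E \<odot> Z) \<cdot> (\<zeta> A B X Y \<bullet> (E \<odot> Z)) \<cdot> \<zeta> (A \<bullet> B) E (X \<bullet> Y) Z"
    and zeta_circ_lunit: "\<lbrakk>X \<in> Ob; Y \<in> Ob\<rbrakk>
      \<Longrightarrow> (\<ll>\<^sub>\<odot> X \<bullet> \<ll>\<^sub>\<odot> Y) \<cdot> \<zeta> \<I> \<I> X Y \<cdot> (\<Delta>\<^sub>I \<odot> (X \<bullet> Y)) = \<ll>\<^sub>\<odot> (X \<bullet> Y)"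
    and zeta_circ_runit: "\<lbrakk>X \<in> Ob; Y \<in> Ob\<rbrakk>
      \<Longrightarrow> (\<rr>\<^sub>\<odot> X \<bullet> \<rr>\<^sub>\<odot> Y) \<cdot> \<zeta> X Y \<I> \<I> \<cdot> ((X \<bullet> Y) \<odot> \<Delta>\<^sub>I) = \<rr>\<^sub>\<odot> (X \<bullet> Y)"
    and zeta_bul_lunit: "\<lbrakk>X \<in> Ob; Y \<in> Ob\<rbrakk>
      \<Longrightarrow> \<ll>\<^sub>\<bullet> (X \<odot> Y) \<cdot> (\<mm>\<^sub>J \<bullet> (X \<odot> Y)) \<cdot> \<zeta> \<J> X \<J> Y = \<ll>\<^sub>\<bullet> X \<odot> \<ll>\<^sub>\<bullet> Y"
    and zeta_bul_runit: "\<lbrakk>X \<in> Ob; Y \<in> Ob\<rbrakk>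
      \<Longrightarrow> \<rr>\<^sub>\<bullet> (X \<odot> Y) \<cdot> ((X \<odot> Y) \<bullet> \<mm>\<^sub>J) \<cdot> \<zeta> X \<J> Y \<J> = \<rr>\<^sub>\<bullet> X \<odot> \<rr>\<^sub>\<bullet> Y"

text \<open>
  The reversion functor \<open>(-)\<^sup>-\<close>, its two lax monoidal structures, and the transformations
  \<open>\<gamma>, \<delta>, \<gamma>\<^sup>~, \<delta>\<^sup>~\<close>, where the superscript tilde stands for an accent over the letter.
\<close>

record 'a rev_duoidal = "'a duoidal" +
  reversion :: "'a \<Rightarrow> 'a"  (\<open>_\<^sup>-\<index>\<close> [1000] 999)
  rev_circ :: "'a \<Rightarrow> 'a \<Rightarrow> 'a"  (\<open>\<phi>\<^sub>\<odot>\<index>\<close>)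
  rev_circ0 :: 'a  (\<open>\<phi>\<^sub>0\<^sub>\<odot>\<index>\<close>)
  rev_bul :: "'a \<Rightarrow> 'a \<Rightarrow> 'a"  (\<open>\<phi>\<^sub>\<bullet>\<index>\<close>)
  rev_bul0 :: 'a  (\<open>\<phi>\<^sub>0\<^sub>\<bullet>\<index>\<close>)
  gamma :: "'a \<Rightarrow> 'a \<Rightarrow> 'a \<Rightarrow> 'a \<Rightarrow> 'a"  (\<open>\<gamma>\<index>\<close>)
  delta :: "'a \<Rightarrow> 'a \<Rightarrow> 'a \<Rightarrow> 'a \<Rightarrow> 'a"  (\<open>\<delta>\<index>\<close>)
  gamma_tilde :: "'a \<Rightarrow> 'a \<Rightarrow> 'a \<Rightarrow> 'a \<Rightarrow> 'a"  (\<open>\<gamma>\<^sup>~\<index>\<close>)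
  delta_tilde :: "'a \<Rightarrow> 'a \<Rightarrow> 'a \<Rightarrow> 'a \<Rightarrow> 'a"  (\<open>\<delta>\<^sup>~\<index>\<close>)

text \<open>
  The derived transformations, usually denoted by lower case \<open>\<psi>, \<phi>\<close> (with and without tilde), are
  written in upper case to distinguish them from distributive laws \<open>\<psi>\<close> and from the lax monoidal
  structures \<open>\<phi>\<close>.
\<close>

context
  fixes D :: "('a, 'b) rev_duoidal_scheme" (structure)
begin

definition rev_psi :: "'a \<Rightarrow> 'a \<Rightarrow> 'a"
  where "rev_psi X Y = \<gamma> \<J> X \<I> Y \<cdot> ((inv \<ll>\<^sub>\<bullet> (X\<^sup>-) \<odot> \<I>) \<bullet> Y) \<cdot> (inv \<rr>\<^sub>\<odot> (X\<^sup>-) \<bullet> Y)"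

definition rev_phi :: "'a \<Rightarrow> 'a \<Rightarrow> 'a"
  where "rev_phi X Y = \<delta> X \<I> Y \<J> \<cdot> (X \<bullet> (\<I> \<odot> inv \<rr>\<^sub>\<bullet> (Y\<^sup>-))) \<cdot> (X \<bullet> inv \<ll>\<^sub>\<odot> (Y\<^sup>-))"

definition rev_psi_tilde :: "'a \<Rightarrow> 'a \<Rightarrow> 'a"
  where "rev_psi_tilde X Y = \<ll>\<^sub>\<odot> ((X \<odot> Y)\<^sup>-) \<cdot> (\<I> \<odot> \<rr>\<^sub>\<bullet> ((X \<odot> Y)\<^sup>-)) \<cdot> \<gamma>\<^sup>~ X Y \<I> \<J>"

definition rev_phi_tilde :: "'a \<Rightarrow> 'a \<Rightarrow> 'a"
  where "rev_phi_tilde X Y = \<rr>\<^sub>\<odot> ((X \<odot> Y)\<^sup>-) \<cdot> (\<ll>\<^sub>\<bullet> ((X \<odot> Y)\<^sup>-) \<odot> \<I>) \<cdot> \<delta>\<^sup>~ \<J> \<I> X Y"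

end

notation rev_psi (\<open>\<Psi>\<index>\<close>)
notation rev_phi (\<open>\<Phi>\<index>\<close>)
notation rev_psi_tilde (\<open>\<Psi>\<^sup>~\<index>\<close>)
notation rev_phi_tilde (\<open>\<Phi>\<^sup>~\<index>\<close>)

text \<open>
  The comultiplication of \<open>\<J>\<close> with respect to \<open>\<bullet>\<close> is the inverse unit constraint \<open>inv \<ll>\<^sub>\<bullet> \<J>\<close>.
\<close>

locale duoidal_category_with_reversion = duoidal_category D
  for D :: "('a, 'b) rev_duoidal_scheme" (structure) +
  assumes rev_circ_lax:
    "lax_monoidal_endofunctor D (rev_tensor D (circ D)) (circ D) (reversion D) \<phi>\<^sub>\<odot> \<phi>\<^sub>0\<^sub>\<odot>"
    and rev_bul_lax:
    "lax_monoidal_endofunctor D (rev_tensor D (bul D)) (bul D) (reversion D) \<phi>\<^sub>\<bullet> \<phi>\<^sub>0\<^sub>\<bullet>"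
    and rev_zeta: "\<lbrakk>X \<in> Ob; Y \<in> Ob; Z \<in> Ob; T \<in> Ob\<rbrakk>
      \<Longrightarrow> \<phi>\<^sub>\<bullet> (Z \<odot> X) (T \<odot> Y) \<cdot> (\<phi>\<^sub>\<odot> X Z \<bullet> \<phi>\<^sub>\<odot> Y T) \<cdot> \<zeta> (X\<^sup>-) (Y\<^sup>-) (Z\<^sup>-) (T\<^sup>-)
        = (\<zeta> T Z Y X)\<^sup>- \<cdot> \<phi>\<^sub>\<odot> (Y \<bullet> X) (T \<bullet> Z) \<cdot> (\<phi>\<^sub>\<bullet> X Y \<odot> \<phi>\<^sub>\<bullet> Z T)"
    and rev_comult_I: "\<phi>\<^sub>\<bullet> \<I> \<I> \<cdot> (\<phi>\<^sub>0\<^sub>\<odot> \<bullet> \<phi>\<^sub>0\<^sub>\<odot>) \<cdot> \<Delta>\<^sub>I = \<Delta>\<^sub>I\<^sup>- \<cdot> \<phi>\<^sub>0\<^sub>\<odot>"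
    and rev_mult_J: "\<mm>\<^sub>J\<^sup>- \<cdot> \<phi>\<^sub>\<odot> \<J> \<J> \<cdot> (\<phi>\<^sub>0\<^sub>\<bullet> \<odot> \<phi>\<^sub>0\<^sub>\<bullet>) = \<phi>\<^sub>0\<^sub>\<bullet> \<cdot> \<mm>\<^sub>J"
    and rev_counit_I: "\<phi>\<^sub>0\<^sub>\<bullet> \<cdot> \<epsilon>\<^sub>I = \<epsilon>\<^sub>I\<^sup>- \<cdot> \<phi>\<^sub>0\<^sub>\<odot>"
    and gamma_in: "\<lbrakk>X \<in> Ob; Y \<in> Ob; Z \<in> Ob; T \<in> Ob\<rbrakk>
      \<Longrightarrow> \<gamma> X Y Z T \<in> Hom (((X \<bullet> Y\<^sup>-) \<odot> Z) \<bullet> T) (X \<odot> (Z \<bullet> (Y \<odot> T)))"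
    and gamma_nat: "\<lbrakk>f \<in> Hom X X'; g \<in> Hom Y Y'; h \<in> Hom Z Z'; k \<in> Hom T T'\<rbrakk>
      \<Longrightarrow> \<gamma> X' Y' Z' T' \<cdot> (((f \<bullet> g\<^sup>-) \<odot> h) \<bullet> k) = (f \<odot> (h \<bullet> (g \<odot> k))) \<cdot> \<gamma> X Y Z T"
    and delta_in: "\<lbrakk>X \<in> Ob; Y \<in> Ob; Z \<in> Ob; T \<in> Ob\<rbrakk>
      \<Longrightarrow> \<delta> X Y Z T \<in> Hom (X \<bullet> (Y \<odot> (Z\<^sup>- \<bullet> T))) (((X \<odot> Z) \<bullet> Y) \<odot> T)"
    and delta_nat: "\<lbrakk>f \<in> Hom X X'; g \<in> Hom Y Y'; h \<in> Hom Z Z'; k \<in> Hom T T'\<rbrakk>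
      \<Longrightarrow> \<delta> X' Y' Z' T' \<cdot> (f \<bullet> (g \<odot> (h\<^sup>- \<bullet> k))) = (((f \<odot> h) \<bullet> g) \<odot> k) \<cdot> \<delta> X Y Z T"
    and gamma_tilde_in: "\<lbrakk>X \<in> Ob; Y \<in> Ob; Z \<in> Ob; T \<in> Ob\<rbrakk>
      \<Longrightarrow> \<gamma>\<^sup>~ X Y Z T \<in> Hom (X\<^sup>- \<bullet> ((Y \<bullet> Z) \<odot> T)) (Z \<odot> ((X \<odot> Y)\<^sup>- \<bullet> T))"
    and gamma_tilde_nat: "\<lbrakk>f \<in> Hom X X'; g \<in> Hom Y Y'; h \<in> Hom Z Z'; k \<in> Hom T T'\<rbrakk>
      \<Longrightarrow> \<gamma>\<^sup>~ X' Y' Z' T' \<cdot> (f\<^sup>- \<bullet> ((g \<bullet> h) \<odot> k)) = (h \<odot> ((f \<odot> g)\<^sup>- \<bullet> k)) \<cdot> \<gamma>\<^sup>~ X Y Z T"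
    and delta_tilde_in: "\<lbrakk>X \<in> Ob; Y \<in> Ob; Z \<in> Ob; T \<in> Ob\<rbrakk>
      \<Longrightarrow> \<delta>\<^sup>~ X Y Z T \<in> Hom ((X \<odot> (Y \<bullet> Z)) \<bullet> T\<^sup>-) ((X \<bullet> (Z \<odot> T)\<^sup>-) \<odot> Y)"
    and delta_tilde_nat: "\<lbrakk>f \<in> Hom X X'; g \<in> Hom Y Y'; h \<in> Hom Z Z'; k \<in> Hom T T'\<rbrakk>
      \<Longrightarrow> \<delta>\<^sup>~ X' Y' Z' T' \<cdot> ((f \<odot> (g \<bullet> h)) \<bullet> k\<^sup>-) = ((f \<bullet> (h \<odot> k)\<^sup>-) \<odot> g) \<cdot> \<delta>\<^sup>~ X Y Z T"
    and R1: "\<lbrakk>X \<in> Ob; Y \<in> Ob; Z \<in> Ob; T \<in> Ob; U \<in> Ob; V \<in> Ob\<rbrakk>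
      \<Longrightarrow> \<gamma> X Y (Z \<odot> U) (T \<odot> V) \<cdot> (\<aa>\<^sub>\<odot> (X \<bullet> Y\<^sup>-) Z U \<bullet> (T \<odot> V)) \<cdot> \<zeta> ((X \<bullet> Y\<^sup>-) \<odot> Z) T U V
        = (X \<odot> ((Z \<odot> U) \<bullet> \<aa>\<^sub>\<odot> Y T V)) \<cdot> (X \<odot> \<zeta> Z (Y \<odot> T) U V)
          \<cdot> \<aa>\<^sub>\<odot> X (Z \<bullet> (Y \<odot> T)) (U \<bullet> V) \<cdot> (\<gamma> X Y Z T \<odot> (U \<bullet> V))"
    and R2: "\<lbrakk>X \<in> Ob; Y \<in> Ob; Z \<in> Ob; T \<in> Ob; U \<in> Ob; V \<in> Ob\<rbrakk>
      \<Longrightarrow> ((X \<odot> T) \<bullet> \<gamma> Y Z U V) \<cdot> \<aa>\<^sub>\<bullet> (X \<odot> T) ((Y \<bullet> Z\<^sup>-) \<odot> U) V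
          \<cdot> (\<zeta> X (Y \<bullet> Z\<^sup>-) T U \<bullet> V) \<cdot> ((\<aa>\<^sub>\<bullet> X Y (Z\<^sup>-) \<odot> (T \<bullet> U)) \<bullet> V)
        = \<zeta> X Y T (U \<bullet> (Z \<odot> V)) \<cdot> ((X \<bullet> Y) \<odot> \<aa>\<^sub>\<bullet> T U (Z \<odot> V)) \<cdot> \<gamma> (X \<bullet> Y) Z (T \<bullet> U) V"
    and R3: "\<lbrakk>X \<in> Ob; Y \<in> Ob; Z \<in> Ob; T \<in> Ob; U \<in> Ob; V \<in> Ob\<rbrakk>
      \<Longrightarrow> ((\<aa>\<^sub>\<odot> X Z U \<bullet> (Y \<odot> T)) \<odot> V) \<cdot> \<delta> (X \<odot> Z) (Y \<odot> T) U V
          \<cdot> ((X \<odot> Z) \<bullet> inv \<aa>\<^sub>\<odot> Y T (U\<^sup>- \<bullet> V)) \<cdot> \<zeta> X Y Z (T \<odot> (U\<^sup>- \<bullet> V))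
        = (\<zeta> X Y (Z \<odot> U) T \<odot> V) \<cdot> inv \<aa>\<^sub>\<odot> (X \<bullet> Y) ((Z \<odot> U) \<bullet> T) V \<cdot> ((X \<bullet> Y) \<odot> \<delta> Z T U V)"
    and R4: "\<lbrakk>X \<in> Ob; Y \<in> Ob; Z \<in> Ob; T \<in> Ob; U \<in> Ob; V \<in> Ob\<rbrakk>
      \<Longrightarrow> (\<delta> X Y T U \<bullet> (Z \<odot> V)) \<cdot> inv \<aa>\<^sub>\<bullet> X (Y \<odot> (T\<^sup>- \<bullet> U)) (Z \<odot> V)
          \<cdot> (X \<bullet> \<zeta> Y Z (T\<^sup>- \<bullet> U) V) \<cdot> (X \<bullet> ((Y \<bullet> Z) \<odot> inv \<aa>\<^sub>\<bullet> (T\<^sup>-) U V))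
        = \<zeta> ((X \<odot> T) \<bullet> Y) Z U V \<cdot> (inv \<aa>\<^sub>\<bullet> (X \<odot> T) Y Z \<odot> (U \<bullet> V)) \<cdot> \<delta> X (Y \<bullet> Z) T (U \<bullet> V)"
    and R5: "\<lbrakk>X \<in> Ob; Y \<in> Ob; Z \<in> Ob; T \<in> Ob; U \<in> Ob; V \<in> Ob\<rbrakk>
      \<Longrightarrow> \<delta> X Y T (U \<bullet> (Z \<odot> V)) \<cdot> (X \<bullet> (Y \<odot> \<aa>\<^sub>\<bullet> (T\<^sup>-) U (Z \<odot> V)))
          \<cdot> (X \<bullet> \<gamma> Y Z (T\<^sup>- \<bullet> U) V) \<cdot> \<aa>\<^sub>\<bullet> X ((Y \<bullet> Z\<^sup>-) \<odot> (T\<^sup>- \<bullet> U)) V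
        = \<gamma> ((X \<odot> T) \<bullet> Y) Z U V \<cdot> ((inv \<aa>\<^sub>\<bullet> (X \<odot> T) Y (Z\<^sup>-) \<odot> U) \<bullet> V)
          \<cdot> (\<delta> X (Y \<bullet> Z\<^sup>-) T U \<bullet> V)"
    and R6: "\<ll>\<^sub>\<odot> (\<I> \<bullet> \<I>) \<cdot> (\<I> \<odot> (\<I> \<bullet> \<ll>\<^sub>\<odot> \<I>)) \<cdot> \<gamma> \<I> \<I> \<I> \<I> \<cdot> ((((\<I> \<bullet> \<phi>\<^sub>0\<^sub>\<odot>) \<cdot> \<Delta>\<^sub>I) \<odot> \<I>) \<bullet> \<I>)
        = \<ll>\<^sub>\<odot> \<I> \<bullet> \<I>"
    and R7: "\<rr>\<^sub>\<odot> (\<I> \<bullet> \<I>) \<cdot> ((\<rr>\<^sub>\<odot> \<I> \<bullet> \<I>) \<odot> \<I>) \<cdot> \<delta> \<I> \<I> \<I> \<I> \<cdot> (\<I> \<bullet> (\<I> \<odot> ((\<phi>\<^sub>0\<^sub>\<odot> \<bullet> \<I>) \<cdot> \<Delta>\<^sub>I)))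
        = \<I> \<bullet> \<rr>\<^sub>\<odot> \<I>"
    and R8: "\<lbrakk>X \<in> Ob; Y \<in> Ob; Z \<in> Ob; U \<in> Ob\<rbrakk>
      \<Longrightarrow> \<gamma> (X \<odot> Z) Y (\<J> \<odot> \<J>) U \<cdot> (\<aa>\<^sub>\<odot> ((X \<odot> Z) \<bullet> Y\<^sup>-) \<J> \<J> \<bullet> U)
          \<cdot> ((\<delta> X (Y\<^sup>-) Z \<J> \<odot> \<J>) \<bullet> U) \<cdot> (((X \<bullet> (Y\<^sup>- \<odot> inv \<rr>\<^sub>\<bullet> (Z\<^sup>-))) \<odot> \<J>) \<bullet> U)
        = ((X \<odot> Z) \<odot> \<zeta> \<J> Y \<J> U) \<cdot> ((X \<odot> Z) \<odot> (inv \<ll>\<^sub>\<bullet> Y \<odot> inv \<ll>\<^sub>\<bullet> U))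
          \<cdot> inv \<aa>\<^sub>\<odot> X Z (Y \<odot> U) \<cdot> (X \<odot> \<aa>\<^sub>\<odot> Z Y U)
          \<cdot> (X \<odot> \<ll>\<^sub>\<bullet> ((Z \<odot> Y) \<odot> U)) \<cdot> \<gamma> X (Z \<odot> Y) \<J> U \<cdot> (((X \<bullet> \<phi>\<^sub>\<odot> Y Z) \<odot> \<J>) \<bullet> U)"
    and R9: "\<lbrakk>X \<in> Ob; Y \<in> Ob; Z \<in> Ob; U \<in> Ob\<rbrakk>
      \<Longrightarrow> \<delta> X (\<J> \<odot> \<J>) Z (Y \<odot> U) \<cdot> (X \<bullet> inv \<aa>\<^sub>\<odot> \<J> \<J> (Z\<^sup>- \<bullet> (Y \<odot> U)))
          \<cdot> (X \<bullet> (\<J> \<odot> \<gamma> \<J> Y (Z\<^sup>-) U)) \<cdot> (X \<bullet> (\<J> \<odot> ((inv \<ll>\<^sub>\<bullet> (Y\<^sup>-) \<odot> Z\<^sup>-) \<bullet> U)))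
        = (\<zeta> X \<J> Z \<J> \<odot> (Y \<odot> U)) \<cdot> ((inv \<rr>\<^sub>\<bullet> X \<odot> inv \<rr>\<^sub>\<bullet> Z) \<odot> (Y \<odot> U))
          \<cdot> \<aa>\<^sub>\<odot> (X \<odot> Z) Y U \<cdot> (inv \<aa>\<^sub>\<odot> X Z Y \<odot> U)
          \<cdot> (\<rr>\<^sub>\<bullet> (X \<odot> (Z \<odot> Y)) \<odot> U) \<cdot> \<delta> X \<J> (Z \<odot> Y) U \<cdot> (X \<bullet> (\<J> \<odot> (\<phi>\<^sub>\<odot> Y Z \<bullet> U)))"
    and R10: "\<lbrakk>X \<in> Ob; Y \<in> Ob; Z \<in> Ob\<rbrakk>
      \<Longrightarrow> (\<aa>\<^sub>\<odot> X Y Z)\<^sup>- \<cdot> \<Phi>\<^sup>~ (X \<odot> Y) Z \<cdot> (\<Psi> X Y \<bullet> Z\<^sup>-)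
        = \<Psi>\<^sup>~ X (Y \<odot> Z) \<cdot> (X\<^sup>- \<bullet> \<Phi> Y Z) \<cdot> \<aa>\<^sub>\<bullet> (X\<^sup>-) Y (Z\<^sup>-)"
    and R11: "X \<in> Ob
      \<Longrightarrow> (\<rr>\<^sub>\<odot> X)\<^sup>- \<cdot> \<ll>\<^sub>\<odot> ((X \<odot> \<I>)\<^sup>-) \<cdot> (\<I> \<odot> \<rr>\<^sub>\<bullet> ((X \<odot> \<I>)\<^sup>-)) \<cdot> \<gamma>\<^sup>~ X \<I> \<I> \<J> \<cdot> (X\<^sup>- \<bullet> (\<Delta>\<^sub>I \<odot> \<J>))
        = \<rr>\<^sub>\<bullet> (X\<^sup>-) \<cdot> (X\<^sup>- \<bullet> \<ll>\<^sub>\<odot> \<J>)"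
    and R12: "X \<in> Ob
      \<Longrightarrow> (\<ll>\<^sub>\<odot> X)\<^sup>- \<cdot> \<rr>\<^sub>\<odot> ((\<I> \<odot> X)\<^sup>-) \<cdot> (\<ll>\<^sub>\<bullet> ((\<I> \<odot> X)\<^sup>-) \<odot> \<I>) \<cdot> \<delta>\<^sup>~ \<J> \<I> \<I> X \<cdot> ((\<J> \<odot> \<Delta>\<^sub>I) \<bullet> X\<^sup>-)
        = \<ll>\<^sub>\<bullet> (X\<^sup>-) \<cdot> (\<rr>\<^sub>\<odot> \<J> \<bullet> X\<^sup>-)"
    and R13: "\<lbrakk>X \<in> Ob; Y \<in> Ob; Z \<in> Ob; T \<in> Ob; U \<in> Ob; V \<in> Ob\<rbrakk>
      \<Longrightarrow> (X \<odot> \<aa>\<^sub>\<bullet> T (Z \<odot> U) (Y \<odot> V)) \<cdot> \<gamma> X Y (T \<bullet> (Z \<odot> U)) V \<cdot> (\<gamma> (X \<bullet> Y\<^sup>-) Z T U \<bullet> V)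
        = (X \<odot> (T \<bullet> \<zeta> Z Y U V)) \<cdot> \<gamma> X (Z \<bullet> Y) T (U \<bullet> V) \<cdot> (((X \<bullet> \<phi>\<^sub>\<bullet> Y Z) \<odot> T) \<bullet> (U \<bullet> V))
          \<cdot> ((\<aa>\<^sub>\<bullet> X (Y\<^sup>-) (Z\<^sup>-) \<odot> T) \<bullet> (U \<bullet> V)) \<cdot> \<aa>\<^sub>\<bullet> (((X \<bullet> Y\<^sup>-) \<bullet> Z\<^sup>-) \<odot> T) U V"
    and R14: "\<lbrakk>X \<in> Ob; Y \<in> Ob; Z \<in> Ob; T \<in> Ob; U \<in> Ob; V \<in> Ob\<rbrakk>
      \<Longrightarrow> (inv \<aa>\<^sub>\<bullet> (X \<odot> U) (Y \<odot> T) Z \<odot> V) \<cdot> \<delta> X ((Y \<odot> T) \<bullet> Z) U V \<cdot> (X \<bullet> \<delta> Y Z T (U\<^sup>- \<bullet> V))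
        = ((\<zeta> X Y U T \<bullet> Z) \<odot> V) \<cdot> \<delta> (X \<bullet> Y) Z (U \<bullet> T) V \<cdot> ((X \<bullet> Y) \<bullet> (Z \<odot> (\<phi>\<^sub>\<bullet> T U \<bullet> V)))
          \<cdot> ((X \<bullet> Y) \<bullet> (Z \<odot> inv \<aa>\<^sub>\<bullet> (T\<^sup>-) (U\<^sup>-) V)) \<cdot> inv \<aa>\<^sub>\<bullet> X Y (Z \<odot> (T\<^sup>- \<bullet> (U\<^sup>- \<bullet> V)))"
    and R15: "\<lbrakk>X \<in> Ob; Y \<in> Ob; Z \<in> Ob; T \<in> Ob; U \<in> Ob; V \<in> Ob\<rbrakk>
      \<Longrightarrow> (X \<odot> \<gamma> Z T U (Y \<odot> V)) \<cdot> \<gamma> X Y ((Z \<bullet> T\<^sup>-) \<odot> U) V \<cdot> (\<aa>\<^sub>\<odot> (X \<bullet> Y\<^sup>-) (Z \<bullet> T\<^sup>-) U \<bullet> V)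
        = \<aa>\<^sub>\<odot> X Z (U \<bullet> (T \<odot> (Y \<odot> V))) \<cdot> ((X \<odot> Z) \<odot> (U \<bullet> \<aa>\<^sub>\<odot> T Y V)) \<cdot> \<gamma> (X \<odot> Z) (T \<odot> Y) U V
          \<cdot> ((((X \<odot> Z) \<bullet> \<phi>\<^sub>\<odot> Y T) \<odot> U) \<bullet> V) \<cdot> ((\<zeta> X (Y\<^sup>-) Z (T\<^sup>-) \<odot> U) \<bullet> V)"
    and R16: "\<lbrakk>X \<in> Ob; Y \<in> Ob; Z \<in> Ob; T \<in> Ob; U \<in> Ob; V \<in> Ob\<rbrakk>
      \<Longrightarrow> \<aa>\<^sub>\<odot> ((X \<odot> (U \<odot> Z)) \<bullet> Y) T V \<cdot> (((\<aa>\<^sub>\<odot> X U Z \<bullet> Y) \<odot> T) \<odot> V)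
          \<cdot> (\<delta> (X \<odot> U) Y Z T \<odot> V) \<cdot> \<delta> X (Y \<odot> (Z\<^sup>- \<bullet> T)) U V
        = \<delta> X Y (U \<odot> Z) (T \<odot> V) \<cdot> (X \<bullet> (Y \<odot> (\<phi>\<^sub>\<odot> Z U \<bullet> (T \<odot> V))))
          \<cdot> (X \<bullet> (Y \<odot> \<zeta> (Z\<^sup>-) T (U\<^sup>-) V)) \<cdot> (X \<bullet> \<aa>\<^sub>\<odot> Y (Z\<^sup>- \<bullet> T) (U\<^sup>- \<bullet> V))"
    and R17: "\<rr>\<^sub>\<odot> \<J> \<cdot> (\<J> \<odot> \<rr>\<^sub>\<bullet> \<I>) \<cdot> (\<J> \<odot> (\<I> \<bullet> \<mm>\<^sub>J)) \<cdot> \<gamma> \<J> \<J> \<I> \<J>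
          \<cdot> ((((\<J> \<bullet> \<phi>\<^sub>0\<^sub>\<bullet>) \<cdot> inv \<ll>\<^sub>\<bullet> \<J>) \<odot> \<I>) \<bullet> \<J>)
        = \<rr>\<^sub>\<bullet> \<J> \<cdot> (\<rr>\<^sub>\<odot> \<J> \<bullet> \<J>)"
    and R18: "\<ll>\<^sub>\<odot> \<J> \<cdot> (\<ll>\<^sub>\<bullet> \<I> \<odot> \<J>) \<cdot> ((\<mm>\<^sub>J \<bullet> \<I>) \<odot> \<J>) \<cdot> \<delta> \<J> \<I> \<J> \<J>
          \<cdot> (\<J> \<bullet> (\<I> \<odot> ((\<phi>\<^sub>0\<^sub>\<bullet> \<bullet> \<J>) \<cdot> inv \<ll>\<^sub>\<bullet> \<J>)))
        = \<ll>\<^sub>\<bullet> \<J> \<cdot> (\<J> \<bullet> \<ll>\<^sub>\<odot> \<J>)"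

text \<open>
  A bimonoid is a tuple \<open>(H, m, u, d, e)\<close> of an object, multiplication, unit, comultiplication and
  counit.
\<close>

type_synonym 'a bimonoid_tuple = "'a \<times> 'a \<times> 'a \<times> 'a \<times> 'a"

context
  fixes D :: "('a, 'b) duoidal_scheme" (structure)
begin

definition circ_comonoid :: "'a \<times> 'a \<times> 'a \<Rightarrow> 'a \<times> 'a \<times> 'a \<Rightarrow> 'a \<times> 'a \<times> 'a"
  where "circ_comonoid = (\<lambda>(X, d, e) (Y, d', e').
    (X \<odot> Y, \<zeta> X X Y Y \<cdot> (d \<odot> d'), \<mm>\<^sub>J \<cdot> (e \<odot> e')))"

definition bimonoid :: "'a bimonoid_tuple \<Rightarrow> bool"
  where "bimonoid = (\<lambda>(H, m, u, d, e).
    monoid_object D (circ D) (H, m, u) \<and> comonoid_object D (bul D) (H, d, e) \<and>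
    d \<cdot> m = (m \<bullet> m) \<cdot> \<zeta> H H H H \<cdot> (d \<odot> d) \<and> e \<cdot> m = \<mm>\<^sub>J \<cdot> (e \<odot> e) \<and>
    d \<cdot> u = (u \<bullet> u) \<cdot> \<Delta>\<^sub>I \<and> e \<cdot> u = \<epsilon>\<^sub>I)"

definition bimonoid_morphism :: "'a bimonoid_tuple \<Rightarrow> 'a bimonoid_tuple \<Rightarrow> 'a \<Rightarrow> bool"
  where "bimonoid_morphism = (\<lambda>(H, m, u, d, e) (H', m', u', d', e') f.
    monoid_morphism D (circ D) (H, m, u) (H', m', u') f \<and>
    comonoid_morphism D (bul D) (H, d, e) (H', d', e') f)"

definition unit_bimonoid :: "'a bimonoid_tuple"
  where "unit_bimonoid = (\<I>, \<ll>\<^sub>\<odot> \<I>, \<I>, \<Delta>\<^sub>I, \<epsilon>\<^sub>I)"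

definition distributive_law :: "'a \<times> 'a \<times> 'a \<Rightarrow> 'a \<times> 'a \<times> 'a \<Rightarrow> 'a \<Rightarrow> bool"
  where "distributive_law = (\<lambda>(H, m, u) (K, m', u') \<psi>.
    \<psi> \<in> Hom (H \<odot> K) (K \<odot> H) \<and>
    \<psi> \<cdot> (m \<odot> K)
      = (K \<odot> m) \<cdot> \<aa>\<^sub>\<odot> K H H \<cdot> (\<psi> \<odot> H) \<cdot> inv \<aa>\<^sub>\<odot> H K H \<cdot> (H \<odot> \<psi>) \<cdot> \<aa>\<^sub>\<odot> H H K \<and>
    \<psi> \<cdot> (u \<odot> K) \<cdot> inv \<ll>\<^sub>\<odot> K = (K \<odot> u) \<cdot> inv \<rr>\<^sub>\<odot> K \<and>
    \<psi> \<cdot> (H \<odot> m')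
      = (m' \<odot> H) \<cdot> inv \<aa>\<^sub>\<odot> K K H \<cdot> (K \<odot> \<psi>) \<cdot> \<aa>\<^sub>\<odot> K H K \<cdot> (\<psi> \<odot> K) \<cdot> inv \<aa>\<^sub>\<odot> H K K \<and>
    \<psi> \<cdot> (H \<odot> u') \<cdot> inv \<rr>\<^sub>\<odot> H = (u' \<odot> H) \<cdot> inv \<ll>\<^sub>\<odot> H)"

text \<open>
  The data of the bimonoid \<open>K \<circ>\<^sub>\<psi> H\<close>: the monoid structure is twisted by \<open>\<psi>\<close>, the comonoid structure is that
  of the tensor product.
\<close>

definition wreath_bimonoid :: "'a bimonoid_tuple \<Rightarrow> 'a \<Rightarrow> 'a bimonoid_tuple \<Rightarrow> 'a bimonoid_tuple"
  where "wreath_bimonoid = (\<lambda>(K, m', u', d', e') \<psi> (H, m, u, d, e).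
    (K \<odot> H,
     (m' \<odot> m) \<cdot> inv \<aa>\<^sub>\<odot> K K (H \<odot> H) \<cdot> (K \<odot> \<aa>\<^sub>\<odot> K H H) \<cdot> (K \<odot> (\<psi> \<odot> H))
       \<cdot> (K \<odot> inv \<aa>\<^sub>\<odot> H K H) \<cdot> \<aa>\<^sub>\<odot> K H (K \<odot> H),
     (u' \<odot> u) \<cdot> inv \<ll>\<^sub>\<odot> \<I>,
     \<zeta> K K H H \<cdot> (d' \<odot> d),
     \<mm>\<^sub>J \<cdot> (e' \<odot> e)))"

text \<open>
  The morphism \<open>g\<^sup>r : X \<circ> H \<rightarrow> (X \<circ> J) \<bullet> H\<close> for a comonoid morphism \<open>g\<close> from
  \<open>(X, d', e')\<close> to the underlying comonoid of \<open>H\<close>.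
\<close>

definition right_translation :: "'a \<times> 'a \<times> 'a \<Rightarrow> 'a bimonoid_tuple \<Rightarrow> 'a \<Rightarrow> 'a"
  where "right_translation = (\<lambda>(X, d', e') (H, m, u, d, e) g.
    ((X \<odot> e) \<bullet> (m \<cdot> (g \<odot> H))) \<cdot> (\<zeta> X X H H \<cdot> (d' \<odot> d)))"

end

context
  fixes D :: "('a, 'b) rev_duoidal_scheme" (structure)
begin

definition antipode :: "'a bimonoid_tuple \<Rightarrow> 'a \<Rightarrow> bool"
  where "antipode = (\<lambda>(H, m, u, d, e) S.
    S \<in> Hom H (H\<^sup>-) \<and>
    ((m \<bullet> \<I>) \<odot> \<J>) \<cdot> \<Phi> H H \<cdot> (H \<bullet> S) \<cdot> d
      = ((u \<bullet> \<I>) \<odot> \<J>) \<cdot> (\<Delta>\<^sub>I \<odot> \<J>) \<cdot> inv \<ll>\<^sub>\<odot> \<J> \<cdot> e \<and>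
    (\<J> \<odot> (\<I> \<bullet> m)) \<cdot> \<Psi> H H \<cdot> (S \<bullet> H) \<cdot> d
      = (\<J> \<odot> (\<I> \<bullet> u)) \<cdot> (\<J> \<odot> \<Delta>\<^sub>I) \<cdot> inv \<rr>\<^sub>\<odot> \<J> \<cdot> e)"

definition hopf_monoid :: "'a bimonoid_tuple \<Rightarrow> 'a \<Rightarrow> bool"
  where "hopf_monoid H S \<longleftrightarrow> bimonoid D H \<and> antipode H S"

end

end

theory Submission
  imports Defs
begin

text \<open>
  The two antipode equations of \<open>K \<circ>\<^sub>\<psi> H\<close> are interchanged by reversing both tensor products, which swaps
  \<open>\<gamma>\<close> with \<open>\<delta>\<close>, so only the one for \<open>\<delta>\<close> is computed. Informally it reads
  \<open>k\<^sub>1 h\<^sub>1 S(h\<^sub>2) S(k\<^sub>2) = \<epsilon>(k) \<epsilon>(h)\<close>: the compatibility of \<open>\<delta>\<close> with \<open>\<phi>\<^sub>\<odot>\<close> splits the component of \<open>\<delta>\<close> at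
  \<open>H \<circ> K\<close> into one at \<open>H\<close> followed by one at \<open>K\<close>, the distributive law turns the product of
  \<open>K \<circ> H\<close> into products of neighbouring factors, and the antipode equation of \<open>H\<close> can be used inside
  since \<open>\<delta>\<close> is compatible with \<open>\<zeta>\<close>.

  For \<open>g = u\<^sub>H \<epsilon>\<^sup>\<circ>\<^sub>K\<close> the product of \<open>H\<close> disappears from \<open>g\<^sup>r\<close>, and an inverse can be written down with
  \<open>\<gamma>\<close> and \<open>\<phi>\<^sub>0\<^sub>\<odot>\<close> (the antipode of \<open>I\<close>) in place of the antipode of \<open>H\<close>. That it is an inverse on one side
  uses (R2); on the other side (R5) reduces the component \<open>\<gamma>\<^bsub>X,I,I,I\<^esub>\<close> to \<open>\<gamma>\<^bsub>J,I,I,I\<^esub>\<close>. As \<open>\<psi>\<close> is a morphism of comonoids,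
  \<open>g\<^sup>r \<psi> = (\<chi> \<bullet> \<triangleleft>) \<Delta>\<close>.
\<close>

section \<open>Categories and monoidal categories\<close>

text \<open>Neither tensor product is strict, and this shapes the text more than the algebra does.
  The simplifier works towards a normal form: composites are bracketed to the right and adjacent
  tensor products of arrows are fused into one. An axiom whose left side has been fused or split no
  longer matches. Hence naturality laws come in several shapes, and many steps merely regroup a
  composite so that one axiom can be substituted.

  The associators of the twisted product are kept under control by four one-sided actions on
  \<open>K \<star> H\<close>. Most identities between them need a single pentagon, and the antipode
  computation uses the actions rather than the product written out.

  That computation lives in a locale holding only data for which both reversed tensor products give
  another instance. In the second instance \<open>H\<close> and \<open>K\<close> change places, and
  so do left and right actions.

  For the formula recovering \<open>\<psi>\<close>, the augmentation turns \<open>K\<close> into a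
  comodule over the comonoid \<open>\<I>\<close>. Invertibility of the translation becomes a
  statement about such comodules, with the two comodule laws taking the place of calculations in
  \<open>H\<close>.\<close>

context category
begin

lemma hom_iff: "f \<in> Hom X Y \<longleftrightarrow> f \<in> Arr \<and> src f = X \<and> tgt f = Y"
  by (simp add: hom_def)

lemma ob_iff: "X \<in> Ob \<longleftrightarrow> X \<in> Arr \<and> src X = X"
  by (simp add: objects_def)

lemma ob_arr [simp]: "X \<in> Ob \<Longrightarrow> X \<in> Arr"
  and ob_src [simp]: "X \<in> Ob \<Longrightarrow> src X = X"
  and ob_tgt [simp]: "X \<in> Ob \<Longrightarrow> tgt X = X"
  using tgt_src[of X] by (auto simp: ob_iff)

lemma src_ob [simp]: "f \<in> Arr \<Longrightarrow> src f \<in> Ob"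
  and tgt_ob [simp]: "f \<in> Arr \<Longrightarrow> tgt f \<in> Ob"
  unfolding ob_iff by (simp_all only: src_in src_src tgt_in src_tgt)

lemma homD:
  assumes "f \<in> Hom X Y"
  shows "f \<in> Arr" "src f = X" "tgt f = Y" "X \<in> Ob" "Y \<in> Ob"
  using assms src_ob tgt_ob by (auto simp: hom_iff)

lemma comp_hom: "\<lbrakk>f \<in> Arr; g \<in> Arr; src g = tgt f\<rbrakk> \<Longrightarrow> g \<cdot> f \<in> Hom (src f) (tgt g)"
  by (rule comp_in[of f _ "tgt f"]) (auto simp: hom_iff)

lemma comp_arr [simp]: "\<lbrakk>f \<in> Arr; g \<in> Arr; src g = tgt f\<rbrakk> \<Longrightarrow> g \<cdot> f \<in> Arr"
  and src_comp [simp]: "\<lbrakk>f \<in> Arr; g \<in> Arr; src g = tgt f\<rbrakk> \<Longrightarrow> src (g \<cdot> f) = src f"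
  and tgt_comp [simp]: "\<lbrakk>f \<in> Arr; g \<in> Arr; src g = tgt f\<rbrakk> \<Longrightarrow> tgt (g \<cdot> f) = tgt g"
  using comp_hom[of f g] by (auto simp: hom_iff)

lemma compA [simp]: "\<lbrakk>f \<in> Arr; g \<in> Arr; h \<in> Arr; src g = tgt f; src h = tgt g\<rbrakk>
    \<Longrightarrow> (h \<cdot> g) \<cdot> f = h \<cdot> (g \<cdot> f)"
  by (rule comp_assoc[of f _ "tgt f" g "tgt g"]) (auto simp: hom_iff)

lemma id_comp [simp]: "\<lbrakk>Y \<in> Ob; f \<in> Arr; tgt f = Y\<rbrakk> \<Longrightarrow> Y \<cdot> f = f"
  and comp_id [simp]: "\<lbrakk>X \<in> Ob; f \<in> Arr; src f = X\<rbrakk> \<Longrightarrow> f \<cdot> X = f"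
  using comp_src comp_tgt by auto

lemma id_comp_ext [simp]: "\<lbrakk>Y \<in> Ob; f \<in> Arr; tgt f = Y; g \<in> Arr; src f = tgt g\<rbrakk> \<Longrightarrow> Y \<cdot> (f \<cdot> g) = f \<cdot> g"
  by simp

text \<open>Composites are kept bracketed to the right, so an equation for
  \<open>a \<cdot> b\<close> must also be usable when a further factor \<open>r\<close> follows.
  Axioms are put into this form with \<open>OF\<close> throughout.\<close>

lemma comp_ext:
  "\<lbrakk>a \<cdot> b = c; a \<in> Arr; b \<in> Arr; src a = tgt b; r \<in> Arr; tgt r = src b\<rbrakk> \<Longrightarrow> a \<cdot> (b \<cdot> r) = c \<cdot> r"
  by (metis compA)

text \<open>Uniqueness of inverses is what makes the description in \<open>inverse_arrow\<close>
  denote an inverse.\<close>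

lemma inverse_arrows_inv: "iso C f \<Longrightarrow> inverse_arrows C f (inv f)"
proof -
  assume "iso C f"
  then obtain g where g: "inverse_arrows C f g" unfolding iso_def by (rule exE)
  show ?thesis
    unfolding inverse_arrow_def
  proof (rule theI[of _ g])
    show "inverse_arrows C f g" by fact
    fix h assume h: "inverse_arrows C f h"
    have "h = h \<cdot> (f \<cdot> g)"
      using g h comp_id[of "tgt f" h] by (simp add: inverse_arrows_def hom_iff)
    also have "\<dots> = (h \<cdot> f) \<cdot> g"
      using g h by (intro compA[symmetric]) (auto simp: inverse_arrows_def hom_iff)
    also have "\<dots> = g"
      using g h by (simp add: inverse_arrows_def hom_iff)
    finally show "h = g" .
  qed
qed

lemma iso_arr: "iso C f \<Longrightarrow> f \<in> Arr"
  by (drule inverse_arrows_inv) (simp only: inverse_arrows_def)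

lemma inv_arr [simp]: "iso C f \<Longrightarrow> inv f \<in> Arr"
  and src_inv [simp]: "iso C f \<Longrightarrow> src (inv f) = tgt f"
  and tgt_inv [simp]: "iso C f \<Longrightarrow> tgt (inv f) = src f"
  and inv_comp [simp]: "iso C f \<Longrightarrow> inv f \<cdot> f = src f"
  and comp_inv [simp]: "iso C f \<Longrightarrow> f \<cdot> inv f = tgt f"
  by (drule inverse_arrows_inv, simp only: inverse_arrows_def hom_iff)+

lemma inv_comp_ext [simp]: "\<lbrakk>iso C f; h \<in> Arr; tgt h = src f\<rbrakk> \<Longrightarrow> inv f \<cdot> (f \<cdot> h) = h"
  by (simp add: comp_ext[OF inv_comp] iso_arr)

lemma comp_inv_ext [simp]: "\<lbrakk>iso C f; h \<in> Arr; tgt h = tgt f\<rbrakk> \<Longrightarrow> f \<cdot> (inv f \<cdot> h) = h"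
  by (simp add: comp_ext[OF comp_inv] iso_arr)

lemma isoI:
  assumes "f \<in> Hom X Y" "g \<in> Hom Y X" "g \<cdot> f = X" "f \<cdot> g = Y"
  shows "iso C f"
proof -
  have "inverse_arrows C f g"
    unfolding inverse_arrows_def using assms homD[OF assms(1)] by metis
  then show ?thesis
    unfolding iso_def by (rule exI)
qed

lemma inv_eqI:
  assumes f: "f \<in> Hom X Y" and g: "g \<in> Hom Y X" and gf: "g \<cdot> f = X" and fg: "f \<cdot> g = Y"
  shows "inv f = g"
proof -
  note i = isoI[OF f g gf fg]
  note h = homD[OF f] homD[OF g]
  have "inv f = inv f \<cdot> (f \<cdot> g)"
    unfolding fg by (rule comp_id[symmetric]) (use h i in auto)
  also have "inv f \<cdot> (f \<cdot> g) = g"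
    by (rule inv_comp_ext) (use h i in auto)
  finally show ?thesis .
qed

lemma iso_inv [simp]: "iso C f \<Longrightarrow> iso C (inv f)"
  by (rule isoI[of _ "tgt f" "src f" f]) (simp_all add: hom_iff iso_arr)

lemma inv_inv [simp]: "iso C f \<Longrightarrow> inv (inv f) = f"
  by (rule inv_eqI[of _ "tgt f" "src f" f]) (simp_all add: hom_iff iso_arr)

lemma iso_cancel_left:
  assumes "iso C f" "f \<cdot> g = f \<cdot> h" "g \<in> Arr" "h \<in> Arr" "tgt g = src f" "tgt h = src f"
  shows "g = h"
proof -
  have "g = inv f \<cdot> (f \<cdot> g)"
    using assms(1,3,5) by simp
  also have "\<dots> = h"
    unfolding assms(2) using assms(1,4,6) by simp
  finally show ?thesis .
qed

lemma iso_cancel_right: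
  assumes "g \<cdot> f = h \<cdot> f" "iso C f" "g \<in> Arr" "h \<in> Arr" "src g = tgt f" "src h = tgt f"
  shows "g = h"
proof -
  have "g = (g \<cdot> f) \<cdot> inv f"
    using assms(2,3,5) iso_arr[of f] by simp
  also have "\<dots> = h"
    unfolding assms(1) using assms(2,4,6) iso_arr[of f] by simp
  finally show ?thesis .
qed

lemma iso_comp [simp]: "\<lbrakk>iso C f; iso C g; src g = tgt f\<rbrakk> \<Longrightarrow> iso C (g \<cdot> f)"
  by (rule isoI[of _ "src f" "tgt g" "inv f \<cdot> inv g"]) (auto simp: hom_iff iso_arr)

lemma inv_comp_arrows [simp]: "\<lbrakk>iso C f; iso C g; src g = tgt f\<rbrakk> \<Longrightarrow> inv (g \<cdot> f) = inv f \<cdot> inv g"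
  by (rule inv_eqI[of _ "src f" "tgt g" "inv f \<cdot> inv g"]) (auto simp: hom_iff iso_arr)

lemma iso_ob [simp]: "X \<in> Ob \<Longrightarrow> iso C X"
  by (rule isoI[of _ X X X]) (auto simp: hom_iff)

lemma inv_ob [simp]: "X \<in> Ob \<Longrightarrow> inv X = X"
  by (rule inv_eqI[of _ X X]) (auto simp: hom_iff)

end

section \<open>Monoidal categories: coherence of units and rearranged pentagons\<close>

context monoidal_category
begin

abbreviation tensor_M (infix "\<star>" 70) where "tensor_M \<equiv> tensor M"
abbreviation "\<alpha> \<equiv> assoc M"
abbreviation "\<l> \<equiv> lunitor M"
abbreviation "\<r> \<equiv> runitor M"
abbreviation "\<e> \<equiv> tunit M"

lemma tensor_hom: "\<lbrakk>f \<in> Arr; g \<in> Arr\<rbrakk> \<Longrightarrow> f \<star> g \<in> Hom (src f \<star> src g) (tgt f \<star> tgt g)"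
  by (rule tensor_in) (auto simp: hom_iff)

lemma tensor_arr [simp]: "\<lbrakk>f \<in> Arr; g \<in> Arr\<rbrakk> \<Longrightarrow> f \<star> g \<in> Arr"
  and src_tensor [simp]: "\<lbrakk>f \<in> Arr; g \<in> Arr\<rbrakk> \<Longrightarrow> src (f \<star> g) = src f \<star> src g"
  and tgt_tensor [simp]: "\<lbrakk>f \<in> Arr; g \<in> Arr\<rbrakk> \<Longrightarrow> tgt (f \<star> g) = tgt f \<star> tgt g"
  using tensor_hom[of f g] by (auto simp: hom_iff)

lemma tensor_ob [simp]: "\<lbrakk>X \<in> Ob; Y \<in> Ob\<rbrakk> \<Longrightarrow> X \<star> Y \<in> Ob"
  by (metis ob_arr ob_src src_ob src_tensor tensor_arr)

lemma comp_tensor [simp]: "\<lbrakk>f \<in> Arr; g \<in> Arr; f' \<in> Arr; g' \<in> Arr; src g = tgt f; src g' = tgt f'\<rbrakk>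
    \<Longrightarrow> (g \<star> g') \<cdot> (f \<star> f') = (g \<cdot> f) \<star> (g' \<cdot> f')"
  by (rule tensor_comp[symmetric]) (auto simp: hom_iff)

lemma comp_tensor_ext [simp]:
  "\<lbrakk>f \<in> Arr; g \<in> Arr; f' \<in> Arr; g' \<in> Arr; src g = tgt f; src g' = tgt f'; h \<in> Arr; tgt h = src f \<star> src f'\<rbrakk>
    \<Longrightarrow> (g \<star> g') \<cdot> ((f \<star> f') \<cdot> h) = ((g \<cdot> f) \<star> (g' \<cdot> f')) \<cdot> h"
  by (rule comp_ext) auto

lemma unt_ob [simp]: "\<e> \<in> Ob"
  by (rule tunit_ob)

lemma asc_iso [simp]: "\<lbrakk>X \<in> Ob; Y \<in> Ob; Z \<in> Ob\<rbrakk> \<Longrightarrow> iso C (\<alpha> X Y Z)"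
  by (rule assoc_iso)
lemma asc_arr [simp]: "\<lbrakk>X \<in> Ob; Y \<in> Ob; Z \<in> Ob\<rbrakk> \<Longrightarrow> \<alpha> X Y Z \<in> Arr"
  and src_asc [simp]: "\<lbrakk>X \<in> Ob; Y \<in> Ob; Z \<in> Ob\<rbrakk> \<Longrightarrow> src (\<alpha> X Y Z) = (X \<star> Y) \<star> Z"
  and tgt_asc [simp]: "\<lbrakk>X \<in> Ob; Y \<in> Ob; Z \<in> Ob\<rbrakk> \<Longrightarrow> tgt (\<alpha> X Y Z) = X \<star> (Y \<star> Z)"
  using assoc_in[of X Y Z] by (auto simp: hom_iff)
lemma lun_iso [simp]: "X \<in> Ob \<Longrightarrow> iso C (\<l> X)"
  by (rule lunitor_iso)
lemma lun_arr [simp]: "X \<in> Ob \<Longrightarrow> \<l> X \<in> Arr"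
  and src_lun [simp]: "X \<in> Ob \<Longrightarrow> src (\<l> X) = \<e> \<star> X"
  and tgt_lun [simp]: "X \<in> Ob \<Longrightarrow> tgt (\<l> X) = X"
  using lunitor_in[of X] by (auto simp: hom_iff)
lemma run_iso [simp]: "X \<in> Ob \<Longrightarrow> iso C (\<r> X)"
  by (rule runitor_iso)
lemma run_arr [simp]: "X \<in> Ob \<Longrightarrow> \<r> X \<in> Arr"
  and src_run [simp]: "X \<in> Ob \<Longrightarrow> src (\<r> X) = X \<star> \<e>"
  and tgt_run [simp]: "X \<in> Ob \<Longrightarrow> tgt (\<r> X) = X"
  using runitor_in[of X] by (auto simp: hom_iff)

lemma iso_tensor [simp]: "\<lbrakk>iso C f; iso C g\<rbrakk> \<Longrightarrow> iso C (f \<star> g)"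
  by (rule isoI[of _ "src f \<star> src g" "tgt f \<star> tgt g" "inv f \<star> inv g"]) (auto simp: hom_iff iso_arr)
lemma asc_nat: "\<lbrakk>f \<in> Arr; g \<in> Arr; h \<in> Arr; tgt f = X; tgt g = Y; tgt h = Z\<rbrakk>
    \<Longrightarrow> \<alpha> X Y Z \<cdot> ((f \<star> g) \<star> h) = (f \<star> (g \<star> h)) \<cdot> \<alpha> (src f) (src g) (src h)"
  by (rule assoc_nat) (auto simp: hom_iff)
lemma lun_nat: "\<lbrakk>f \<in> Arr; tgt f = Y\<rbrakk> \<Longrightarrow> \<l> Y \<cdot> (\<e> \<star> f) = f \<cdot> \<l> (src f)"
  by (rule lunitor_nat) (auto simp: hom_iff)
lemma run_nat: "\<lbrakk>f \<in> Arr; tgt f = Y\<rbrakk> \<Longrightarrow> \<r> Y \<cdot> (f \<star> \<e>) = f \<cdot> \<r> (src f)"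
  by (rule runitor_nat) (auto simp: hom_iff)

text \<open>Inverts two opposite sides of a commuting square. It yields naturality of the inverse
  constraints, and later the associativity axioms of \<open>\<zeta>\<close> with inverse
  associators.\<close>

lemma iso_square:
  assumes "f \<cdot> g = h \<cdot> k" "iso C f" "iso C k" "g \<in> Arr" "h \<in> Arr" "src f = tgt g" "src g = src k" "src h = tgt k"
    "tgt f = tgt h"
  shows "inv f \<cdot> h = g \<cdot> inv k"
proof -
  have "inv f \<cdot> h = inv f \<cdot> (h \<cdot> k) \<cdot> inv k"
    using assms iso_arr[of k] by simp
  also have "\<dots> = g \<cdot> inv k"
    using assms iso_arr[of f] by (simp flip: assms(1))
  finally show ?thesis .
qed

lemma inv_asc_nat: "\<lbrakk>f \<in> Arr; g \<in> Arr; h \<in> Arr; tgt f = X; tgt g = Y; tgt h = Z\<rbrakk>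
    \<Longrightarrow> inv \<alpha> X Y Z \<cdot> (f \<star> (g \<star> h)) = ((f \<star> g) \<star> h) \<cdot> inv \<alpha> (src f) (src g) (src h)"
  by (rule iso_square[OF asc_nat]) auto
lemma inv_lun_nat: "\<lbrakk>f \<in> Arr; tgt f = Y\<rbrakk> \<Longrightarrow> inv \<l> Y \<cdot> f = (\<e> \<star> f) \<cdot> inv \<l> (src f)"
  by (rule iso_square[OF lun_nat]) auto
lemma inv_run_nat: "\<lbrakk>f \<in> Arr; tgt f = Y\<rbrakk> \<Longrightarrow> inv \<r> Y \<cdot> f = (f \<star> \<e>) \<cdot> inv \<r> (src f)"
  by (rule iso_square[OF run_nat]) auto

lemma inv_tensor [simp]: "\<lbrakk>iso C f; iso C g\<rbrakk> \<Longrightarrow> inv (f \<star> g) = inv f \<star> inv g"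
  by (rule inv_eqI[of _ "src f \<star> src g" "tgt f \<star> tgt g"]) (auto simp: hom_iff iso_arr)

text \<open>Tensoring with the unit is naturally isomorphic to the identity, hence faithful.
  Equations can therefore be checked after tensoring with \<open>\<e>\<close>, where the triangle
  axiom becomes available.\<close>

lemma unt_faithful_left:
  assumes "\<e> \<star> f = \<e> \<star> g" "f \<in> Arr" "g \<in> Arr" "src f = src g" "tgt f = tgt g"
  shows "f = g"
  by (rule iso_cancel_right[of _ "\<l> (src f)"]) (use assms lun_nat[of f] lun_nat[of g] in auto)

lemma unt_faithful_right:
  assumes "f \<star> \<e> = g \<star> \<e>" "f \<in> Arr" "g \<in> Arr" "src f = src g" "tgt f = tgt g"
  shows "f = g"
  by (rule iso_cancel_right[of _ "\<r> (src f)"]) (use assms run_nat[of f] run_nat[of g] in auto)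

text \<open>The triangle axiom has its unit in the middle; the law for a unit on the left is derived
  from it. After tensoring with \<open>\<e>\<close>, the pentagon for \<open>\<e>\<close>,
  \<open>\<e>\<close>, \<open>X\<close>, \<open>Y\<close> brings a unit into the middle, and the
  extra factor on the right is invertible.\<close>

lemma lun_tensor:
  assumes [simp]: "X \<in> Ob" "Y \<in> Ob"
  shows "\<l> (X \<star> Y) \<cdot> \<alpha> \<e> X Y = \<l> X \<star> Y"
proof (rule unt_faithful_left)
  have "(\<e> \<star> (\<l> (X \<star> Y) \<cdot> \<alpha> \<e> X Y)) \<cdot> (\<alpha> \<e> (\<e> \<star> X) Y \<cdot> (\<alpha> \<e> \<e> X \<star> Y))
      = (\<e> \<star> \<l> (X \<star> Y)) \<cdot> ((\<e> \<star> \<alpha> \<e> X Y) \<cdot> \<alpha> \<e> (\<e> \<star> X) Y \<cdot> (\<alpha> \<e> \<e> X \<star> Y))"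
    by simp
  also have "\<dots> = (\<e> \<star> \<l> (X \<star> Y)) \<cdot> (\<alpha> \<e> \<e> (X \<star> Y) \<cdot> \<alpha> (\<e> \<star> \<e>) X Y)"
    by (subst pentagon) simp_all
  also have "\<dots> = (\<r> \<e> \<star> (X \<star> Y)) \<cdot> \<alpha> (\<e> \<star> \<e>) X Y"
    by (simp add: comp_ext[OF triangle])
  also have "\<dots> = \<alpha> \<e> X Y \<cdot> ((\<r> \<e> \<star> X) \<star> Y)"
    by (simp add: asc_nat)
  also have "\<dots> = \<alpha> \<e> X Y \<cdot> ((\<e> \<star> \<l> X) \<star> Y) \<cdot> (\<alpha> \<e> \<e> X \<star> Y)"
    by (simp add: triangle)
  also have "\<dots> = (\<alpha> \<e> X Y \<cdot> ((\<e> \<star> \<l> X) \<star> Y)) \<cdot> (\<alpha> \<e> \<e> X \<star> Y)"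
    by (simp del: comp_tensor)
  also have "\<dots> = (\<e> \<star> (\<l> X \<star> Y)) \<cdot> (\<alpha> \<e> (\<e> \<star> X) Y \<cdot> (\<alpha> \<e> \<e> X \<star> Y))"
    by (subst asc_nat) simp_all
  finally show "\<e> \<star> (\<l> (X \<star> Y) \<cdot> \<alpha> \<e> X Y) = \<e> \<star> (\<l> X \<star> Y)"
    by (rule iso_cancel_right) (auto intro: iso_comp)
qed auto

lemma lun_tensor_inv:
  "\<lbrakk>X \<in> Ob; Y \<in> Ob\<rbrakk> \<Longrightarrow> (\<l> X \<star> Y) \<cdot> inv \<alpha> \<e> X Y = \<l> (X \<star> Y)"
  by (simp flip: lun_tensor)

lemma inv_lun_tensor:
  "\<lbrakk>X \<in> Ob; Y \<in> Ob\<rbrakk> \<Longrightarrow> inv \<alpha> \<e> X Y \<cdot> inv \<l> (X \<star> Y) = inv \<l> X \<star> Y"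
  using arg_cong[OF lun_tensor, of X Y "inverse_arrow C"] by simp

lemma pentagon_inv:
  "\<lbrakk>X \<in> Ob; Y \<in> Ob; Z \<in> Ob; W \<in> Ob\<rbrakk>
    \<Longrightarrow> (inv \<alpha> X Y Z \<star> W) \<cdot> inv \<alpha> X (Y \<star> Z) W \<cdot> (X \<star> inv \<alpha> Y Z W)
      = inv \<alpha> (X \<star> Y) Z W \<cdot> inv \<alpha> X Y (Z \<star> W)"
  using arg_cong[OF pentagon, of X Y Z W "inverse_arrow C"] by (simp add: iso_comp)

text \<open>Reversal inverts the associators, so the new pentagon is \<open>pentagon_inv\<close>.
  Right-handed laws such as \<open>run_tensor\<close> then follow from left-handed ones, and the
  reversed duoidal category is built from this.\<close>

lemma monoidal_category_rev_tensor: "monoidal_category C (rev_tensor C M)"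
proof
  fix X Y Z W
  assume [simp]: "X \<in> Ob" "Y \<in> Ob" "Z \<in> Ob" "W \<in> Ob"
  show "(X \<otimes>\<^bsub>rev_tensor C M\<^esub> assoc (rev_tensor C M) Y Z W) \<cdot> assoc (rev_tensor C M) X (Y \<otimes>\<^bsub>rev_tensor C M\<^esub> Z) W \<cdot> (assoc (rev_tensor C M) X Y Z \<otimes>\<^bsub>rev_tensor C M\<^esub> W)
        = assoc (rev_tensor C M) X Y (Z \<otimes>\<^bsub>rev_tensor C M\<^esub> W) \<cdot> assoc (rev_tensor C M) (X \<otimes>\<^bsub>rev_tensor C M\<^esub> Y) Z W"
    by (simp add: rev_tensor_def pentagon_inv)
next
  fix X Y
  assume [simp]: "X \<in> Ob" "Y \<in> Ob"
  show "(X \<otimes>\<^bsub>rev_tensor C M\<^esub> lunitor (rev_tensor C M) Y) \<cdot> assoc (rev_tensor C M) X (tunit (rev_tensor C M)) Y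
      = runitor (rev_tensor C M) X \<otimes>\<^bsub>rev_tensor C M\<^esub> Y"
    by (simp add: rev_tensor_def flip: triangle)
qed (auto simp: rev_tensor_def hom_iff inv_asc_nat lun_nat run_nat)

lemma run_tensor:
  assumes [simp]: "X \<in> Ob" "Y \<in> Ob"
  shows "(X \<star> \<r> Y) \<cdot> \<alpha> X Y \<e> = \<r> (X \<star> Y)"
proof -
  interpret rev: monoidal_category C "rev_tensor C M"
    by (rule monoidal_category_rev_tensor)
  have "\<r> (X \<star> Y) \<cdot> inv \<alpha> X Y \<e> = X \<star> \<r> Y"
    using rev.lun_tensor[of Y X] by (simp add: rev_tensor_def)
  then have "(X \<star> \<r> Y) \<cdot> \<alpha> X Y \<e> = (\<r> (X \<star> Y) \<cdot> inv \<alpha> X Y \<e>) \<cdot> \<alpha> X Y \<e>"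
    by simp
  then show ?thesis
    by simp
qed

lemma inv_run_tensor:
  "\<lbrakk>X \<in> Ob; Y \<in> Ob\<rbrakk> \<Longrightarrow> inv \<alpha> X Y \<e> \<cdot> (X \<star> inv \<r> Y) = inv \<r> (X \<star> Y)"
  using arg_cong[OF run_tensor, of X Y "inverse_arrow C"] by simp

lemma triangle_inv:
  "\<lbrakk>X \<in> Ob; Y \<in> Ob\<rbrakk> \<Longrightarrow> inv \<alpha> X \<e> Y \<cdot> (X \<star> inv \<l> Y) = inv \<r> X \<star> Y"
  using arg_cong[OF triangle, of X Y "inverse_arrow C"] by simp

text \<open>Naturality of the left unit constraint at \<open>\<l> \<e>\<close> identifies
  \<open>\<e> \<star> \<l> \<e>\<close> with \<open>\<l> (\<e> \<star> \<e>)\<close>. Then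
  \<open>lun_tensor\<close> and the triangle agree after tensoring with \<open>\<e>\<close>.\<close>

lemma lun_unt: "\<l> \<e> = \<r> \<e>"
proof (rule unt_faithful_right)
  have "\<l> \<e> \<cdot> (\<e> \<star> \<l> \<e>) = \<l> \<e> \<cdot> \<l> (\<e> \<star> \<e>)"
    by (simp add: lun_nat)
  then have *: "\<e> \<star> \<l> \<e> = \<l> (\<e> \<star> \<e>)"
    by (rule iso_cancel_left[rotated]) auto
  show "\<l> \<e> \<star> \<e> = \<r> \<e> \<star> \<e>"
    by (simp flip: lun_tensor triangle *)
qed auto

text \<open>The normal form fuses a factor \<open>r\<close> with \<open>f \<star> g\<close> inside
  one tensor slot and so hides the left side of \<open>asc_nat\<close>. This variant pulls
  \<open>f \<star> g\<close> out and leaves \<open>r\<close> behind.\<close>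

lemma asc_nat_comp:
  assumes "f \<in> Arr" "g \<in> Arr" "h \<in> Arr" "r \<in> Arr" "tgt r = src f \<star> src g" "tgt f = X" "tgt g = Y" "tgt h = Z"
  shows "\<alpha> X Y Z \<cdot> (((f \<star> g) \<cdot> r) \<star> h) = (f \<star> (g \<star> h)) \<cdot> \<alpha> (src f) (src g) (src h) \<cdot> (r \<star> src h)"
proof -
  have "\<alpha> X Y Z \<cdot> (((f \<star> g) \<cdot> r) \<star> h) = (\<alpha> X Y Z \<cdot> ((f \<star> g) \<star> h)) \<cdot> (r \<star> src h)"
    using assms by auto
  also have "\<dots> = ((f \<star> (g \<star> h)) \<cdot> \<alpha> (src f) (src g) (src h)) \<cdot> (r \<star> src h)"
    using assms by (simp only: asc_nat)
  finally show ?thesis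
    using assms by auto
qed

lemma inv_asc_nat_comp:
  assumes "f \<in> Arr" "g \<in> Arr" "h \<in> Arr" "r \<in> Arr" "tgt r = src g \<star> src h" "tgt f = X" "tgt g = Y" "tgt h = Z"
  shows "inv \<alpha> X Y Z \<cdot> (f \<star> ((g \<star> h) \<cdot> r)) = ((f \<star> g) \<star> h) \<cdot> inv \<alpha> (src f) (src g) (src h) \<cdot> (src f \<star> r)"
proof -
  have "inv \<alpha> X Y Z \<cdot> (f \<star> ((g \<star> h) \<cdot> r)) = (inv \<alpha> X Y Z \<cdot> (f \<star> (g \<star> h))) \<cdot> (src f \<star> r)"
    using assms by auto
  also have "\<dots> = (((f \<star> g) \<star> h) \<cdot> inv \<alpha> (src f) (src g) (src h)) \<cdot> (src f \<star> r)"
    using assms by (simp only: inv_asc_nat)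
  finally show ?thesis
    using assms by auto
qed

lemmas nats = asc_nat inv_asc_nat asc_nat_comp inv_asc_nat_comp
  comp_ext[OF asc_nat] comp_ext[OF inv_asc_nat] comp_ext[OF asc_nat_comp] comp_ext[OF inv_asc_nat_comp]

text \<open>This and the next four lemmas are the pentagon with some edges inverted, in the shapes
  in which words of associators arise for the twisted product.\<close>

lemma pentagon_right_inv:
  assumes [simp]: "X \<in> Ob" "Y \<in> Ob" "Z \<in> Ob" "W \<in> Ob"
  shows "\<alpha> (X \<star> Y) Z W \<cdot> (inv \<alpha> X Y Z \<star> W) \<cdot> inv \<alpha> X (Y \<star> Z) W = inv \<alpha> X Y (Z \<star> W) \<cdot> (X \<star> \<alpha> Y Z W)"
proof -
  have "(inv \<alpha> X Y Z \<star> W) \<cdot> inv \<alpha> X (Y \<star> Z) W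
      = ((inv \<alpha> X Y Z \<star> W) \<cdot> inv \<alpha> X (Y \<star> Z) W \<cdot> (X \<star> inv \<alpha> Y Z W)) \<cdot> (X \<star> \<alpha> Y Z W)"
    by simp
  also have "\<dots> = (inv \<alpha> (X \<star> Y) Z W \<cdot> inv \<alpha> X Y (Z \<star> W)) \<cdot> (X \<star> \<alpha> Y Z W)"
    by (simp only: pentagon_inv assms)
  finally show ?thesis by simp
qed

lemma pentagon_left_inv:
  assumes [simp]: "X \<in> Ob" "Y \<in> Ob" "Z \<in> Ob" "W \<in> Ob"
  shows "(X \<star> inv \<alpha> Y Z W) \<cdot> \<alpha> X Y (Z \<star> W) \<cdot> \<alpha> (X \<star> Y) Z W = \<alpha> X (Y \<star> Z) W \<cdot> (\<alpha> X Y Z \<star> W)"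
  using arg_cong[OF pentagon[OF assms], of "\<lambda>f. (X \<star> inv \<alpha> Y Z W) \<cdot> f"] by simp

lemma pentagon_outer:
  assumes [simp]: "X \<in> Ob" "Y \<in> Ob" "Z \<in> Ob" "W \<in> Ob"
  shows "inv \<alpha> (X \<star> Y) Z W \<cdot> inv \<alpha> X Y (Z \<star> W) \<cdot> (X \<star> \<alpha> Y Z W) = (inv \<alpha> X Y Z \<star> W) \<cdot> inv \<alpha> X (Y \<star> Z) W"
  using arg_cong[OF pentagon_right_inv[OF assms], of "\<lambda>f. inv \<alpha> (X \<star> Y) Z W \<cdot> f"] by simp

lemma pentagon_split_left:
  assumes [simp]: "X \<in> Ob" "Y \<in> Ob" "Z \<in> Ob" "W \<in> Ob"
  shows "\<alpha> (X \<star> Y) Z W \<cdot> (inv \<alpha> X Y Z \<star> W) = inv \<alpha> X Y (Z \<star> W) \<cdot> (X \<star> \<alpha> Y Z W) \<cdot> \<alpha> X (Y \<star> Z) W"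
  using arg_cong[OF pentagon_right_inv[OF assms], of "\<lambda>f. f \<cdot> \<alpha> X (Y \<star> Z) W"] by simp

lemma pentagon_split_right:
  assumes [simp]: "X \<in> Ob" "Y \<in> Ob" "Z \<in> Ob" "W \<in> Ob"
  shows "(\<alpha> X Y Z \<star> W) \<cdot> inv \<alpha> (X \<star> Y) Z W = inv \<alpha> X (Y \<star> Z) W \<cdot> (X \<star> inv \<alpha> Y Z W) \<cdot> \<alpha> X Y (Z \<star> W)"
  using arg_cong[OF pentagon_left_inv[OF assms], of "\<lambda>f. inv \<alpha> X (Y \<star> Z) W \<cdot> f \<cdot> inv \<alpha> (X \<star> Y) Z W"] by simp

end

section \<open>Distributive laws\<close>

text \<open>The multiplicative side of the theorem, placed in a single monoidal category and used
  below for \<open>\<odot>\<close>.\<close>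

locale distributive_monoids = monoidal_category C M
  for C :: "('a, 'b) category_scheme" (structure) and M :: "'a tensor_structure" (structure) +
  fixes H mH uH K mK uK \<psi> :: 'a
  assumes monoid_H: "monoid_object C M (H, mH, uH)"
    and monoid_K: "monoid_object C M (K, mK, uK)"
    and psi_in: "\<psi> \<in> Hom (H \<star> K) (K \<star> H)"
    and psi_mH: "\<psi> \<cdot> (mH \<star> K)
      = (K \<star> mH) \<cdot> \<alpha> K H H \<cdot> (\<psi> \<star> H) \<cdot> inv \<alpha> H K H \<cdot> (H \<star> \<psi>) \<cdot> \<alpha> H H K"
    and psi_uH: "\<psi> \<cdot> (uH \<star> K) \<cdot> inv \<l> K = (K \<star> uH) \<cdot> inv \<r> K"
    and psi_mK: "\<psi> \<cdot> (H \<star> mK)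
      = (mK \<star> H) \<cdot> inv \<alpha> K K H \<cdot> (K \<star> \<psi>) \<cdot> \<alpha> K H K \<cdot> (\<psi> \<star> K) \<cdot> inv \<alpha> H K K"
    and psi_uK: "\<psi> \<cdot> (H \<star> uK) \<cdot> inv \<r> H = (uK \<star> H) \<cdot> inv \<l> H"
begin

lemma typing [simp]:
  "H \<in> Ob" "K \<in> Ob"
  "mH \<in> Arr" "src mH = H \<star> H" "tgt mH = H" "uH \<in> Arr" "src uH = \<e>" "tgt uH = H"
  "mK \<in> Arr" "src mK = K \<star> K" "tgt mK = K" "uK \<in> Arr" "src uK = \<e>" "tgt uK = K"
  "\<psi> \<in> Arr" "src \<psi> = H \<star> K" "tgt \<psi> = K \<star> H"
  using monoid_H monoid_K psi_in by (auto simp: monoid_object_def hom_iff)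

lemma monoid_laws:
  "mH \<cdot> (mH \<star> H) = mH \<cdot> (H \<star> mH) \<cdot> \<alpha> H H H"
  "mH \<cdot> (uH \<star> H) = \<l> H" "mH \<cdot> (H \<star> uH) = \<r> H"
  "mK \<cdot> (mK \<star> K) = mK \<cdot> (K \<star> mK) \<cdot> \<alpha> K K K"
  "mK \<cdot> (uK \<star> K) = \<l> K" "mK \<cdot> (K \<star> uK) = \<r> K"
  using monoid_H monoid_K by (auto simp: monoid_object_def)

text \<open>
  On \<open>A = K \<star> H\<close>, the morphisms \<open>k\<close> and \<open>s\<close> are the left actions of \<open>K\<close> and \<open>H\<close>, while \<open>q\<close> and \<open>n\<close> are the right
  actions of \<open>K\<close> and \<open>H\<close>. The product \<open>m\<close> of \<open>A\<close> is a composite of the left actions, and also of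
  the right actions; its associativity says that left and right actions commute.
\<close>

definition k where "k = (mK \<star> H) \<cdot> inv \<alpha> K K H"
definition n where "n = (K \<star> mH) \<cdot> \<alpha> K H H"
definition s where "s = n \<cdot> (\<psi> \<star> H) \<cdot> inv \<alpha> H K H"
definition q where "q = k \<cdot> (K \<star> \<psi>) \<cdot> \<alpha> K H K"
definition m where "m = k \<cdot> (K \<star> s) \<cdot> \<alpha> K H (K \<star> H)"

lemma k_typing [simp]: "k \<in> Arr" "src k = K \<star> (K \<star> H)" "tgt k = K \<star> H"
  and n_typing [simp]: "n \<in> Arr" "src n = (K \<star> H) \<star> H" "tgt n = K \<star> H"
  by (simp_all add: k_def n_def)
lemma s_typing [simp]: "s \<in> Arr" "src s = H \<star> (K \<star> H)" "tgt s = K \<star> H"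
  and q_typing [simp]: "q \<in> Arr" "src q = (K \<star> H) \<star> K" "tgt q = K \<star> H"
  by (simp_all add: s_def q_def)
lemma m_typing [simp]: "m \<in> Arr" "src m = (K \<star> H) \<star> (K \<star> H)" "tgt m = K \<star> H"
  by (simp_all add: m_def)

text \<open>The multiplicativity laws read as linearity: \<open>\<psi>\<close> carries left
  multiplication by \<open>H\<close> to \<open>s\<close> and, by \<open>q_psi\<close>, right
  multiplication by \<open>K\<close> to \<open>q\<close>.\<close>

lemma s_psi: "s \<cdot> (H \<star> \<psi>) \<cdot> \<alpha> H H K = \<psi> \<cdot> (mH \<star> K)"
  by (simp add: s_def n_def psi_mH)

lemma q_psi: "q \<cdot> (\<psi> \<star> K) \<cdot> inv \<alpha> H K K = \<psi> \<cdot> (H \<star> mK)"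
  by (simp add: q_def k_def psi_mK)

text \<open>This is the multiplication occurring in \<open>wreath_bimonoid\<close>, and the
  factorization from which compatibility with the comonoid structure is read off.\<close>

lemma m_expand: "m = (mK \<star> mH) \<cdot> inv \<alpha> K K (H \<star> H) \<cdot> (K \<star> \<alpha> K H H) \<cdot> (K \<star> (\<psi> \<star> H)) \<cdot> (K \<star> inv \<alpha> H K H) \<cdot> \<alpha> K H (K \<star> H)"
  by (simp add: m_def k_def s_def n_def nats)

text \<open>Both composites apply \<open>\<psi>\<close> to the two inner factors and then multiply
  the two pairs. They differ in bracketing only, for which two pentagons account.\<close>

lemma m_alt: "m = n \<cdot> (q \<star> H) \<cdot> inv \<alpha> (K \<star> H) K H"
proof -
  have "n \<cdot> (q \<star> H) \<cdot> inv \<alpha> (K \<star> H) K H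
      = (mK \<star> mH) \<cdot> (\<alpha> (K \<star> K) H H \<cdot> (inv \<alpha> K K H \<star> H)) \<cdot> ((K \<star> \<psi>) \<star> H) \<cdot> ((\<alpha> K H K \<star> H) \<cdot> inv \<alpha> (K \<star> H) K H)"
    by (simp add: n_def q_def k_def nats)
  also have "\<dots> = m"
    unfolding pentagon_split_left[OF typing(2,2,1,1)] pentagon_split_right[OF typing(2,1,2,1)]
    by (simp add: m_expand nats)
  finally show ?thesis by (rule sym)
qed

text \<open>Multiplying on the right by the image of (h, k) under \<psi> amounts to letting h and
  then k act on the right. This is how \<psi> disappears from the antipode equation. The mirror
  image is \<open>m_psi_left\<close>.\<close>

lemma m_psi_right: "m \<cdot> ((K \<star> H) \<star> \<psi>) \<cdot> \<alpha> (K \<star> H) H K = q \<cdot> (n \<star> K)"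
proof -
  have "m \<cdot> ((K \<star> H) \<star> \<psi>) \<cdot> \<alpha> (K \<star> H) H K = k \<cdot> (K \<star> (s \<cdot> (H \<star> \<psi>))) \<cdot> \<alpha> K H (H \<star> K) \<cdot> \<alpha> (K \<star> H) H K"
    by (simp add: m_def nats)
  also have "\<dots> = k \<cdot> (K \<star> (s \<cdot> (H \<star> \<psi>) \<cdot> \<alpha> H H K)) \<cdot> (K \<star> inv \<alpha> H H K) \<cdot> \<alpha> K H (H \<star> K) \<cdot> \<alpha> (K \<star> H) H K"
    by simp
  also have "\<dots> = k \<cdot> (K \<star> (\<psi> \<cdot> (mH \<star> K))) \<cdot> \<alpha> K (H \<star> H) K \<cdot> (\<alpha> K H H \<star> K)"
    by (simp only: s_psi pentagon_left_inv typing)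
  also have "\<dots> = q \<cdot> (n \<star> K)"
    by (simp add: q_def n_def nats)
  finally show ?thesis .
qed

lemma m_psi_left: "m \<cdot> (\<psi> \<star> (K \<star> H)) \<cdot> inv \<alpha> H K (K \<star> H) = s \<cdot> (H \<star> k)"
proof -
  have "m \<cdot> (\<psi> \<star> (K \<star> H)) \<cdot> inv \<alpha> H K (K \<star> H)
      = n \<cdot> ((q \<cdot> (\<psi> \<star> K) \<cdot> inv \<alpha> H K K) \<star> H) \<cdot> ((\<alpha> H K K \<star> H) \<cdot> inv \<alpha> (H \<star> K) K H) \<cdot> inv \<alpha> H K (K \<star> H)"
    by (simp add: m_alt nats)
  also have "\<dots> = n \<cdot> ((\<psi> \<cdot> (H \<star> mK)) \<star> H) \<cdot> inv \<alpha> H (K \<star> K) H \<cdot> (H \<star> inv \<alpha> K K H)"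
    unfolding q_psi pentagon_split_right[OF typing(1,2,2,1)] by simp
  also have "\<dots> = s \<cdot> (H \<star> k)"
    by (simp add: s_def k_def nats)
  finally show ?thesis .
qed

lemma n_assoc: "n \<cdot> (n \<star> H) = n \<cdot> ((K \<star> H) \<star> mH) \<cdot> \<alpha> (K \<star> H) H H"
proof -
  have "n \<cdot> (n \<star> H) = (K \<star> (mH \<cdot> (H \<star> mH))) \<cdot> ((K \<star> \<alpha> H H H) \<cdot> \<alpha> K (H \<star> H) H \<cdot> (\<alpha> K H H \<star> H))"
    by (simp add: n_def nats monoid_laws)
  also have "\<dots> = n \<cdot> ((K \<star> H) \<star> mH) \<cdot> \<alpha> (K \<star> H) H H"
    unfolding pentagon[OF typing(2,1,1,1)] by (simp add: n_def nats)
  finally show ?thesis .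
qed

lemma k_assoc: "k \<cdot> (mK \<star> (K \<star> H)) = k \<cdot> (K \<star> k) \<cdot> \<alpha> K K (K \<star> H)"
proof -
  have "k \<cdot> (mK \<star> (K \<star> H)) = ((mK \<cdot> (K \<star> mK)) \<star> H) \<cdot> ((\<alpha> K K K \<star> H) \<cdot> inv \<alpha> (K \<star> K) K H)"
    by (simp add: k_def nats monoid_laws)
  also have "\<dots> = k \<cdot> (K \<star> k) \<cdot> \<alpha> K K (K \<star> H)"
    unfolding pentagon_split_right[OF typing(2,2,2,1)] by (simp add: k_def nats)
  finally show ?thesis .
qed

lemma s_n: "s \<cdot> (H \<star> n) = n \<cdot> (s \<star> H) \<cdot> inv \<alpha> H (K \<star> H) H"
proof -
  have "n \<cdot> (s \<star> H) \<cdot> inv \<alpha> H (K \<star> H) H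
      = (n \<cdot> (n \<star> H)) \<cdot> (((\<psi> \<star> H) \<cdot> inv \<alpha> H K H) \<star> H) \<cdot> inv \<alpha> H (K \<star> H) H"
    by (simp add: s_def)
  also have "\<dots> = n \<cdot> (\<psi> \<star> mH) \<cdot> (\<alpha> (H \<star> K) H H \<cdot> (inv \<alpha> H K H \<star> H) \<cdot> inv \<alpha> H (K \<star> H) H)"
    unfolding n_assoc by (simp add: nats)
  also have "\<dots> = s \<cdot> (H \<star> n)"
    unfolding pentagon_right_inv[OF typing(1,2,1,1)] by (simp add: s_def n_def nats)
  finally show ?thesis by (rule sym)
qed

text \<open>On elements h, k, h', k' both sides are the product of the images of (h, k) and (h', k')
  under \<psi>: \<open>m_psi_left\<close> joins h to k, and \<open>m_psi_right\<close> takes k' out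
  again.\<close>

lemma s_q: "s \<cdot> (H \<star> q) = q \<cdot> (s \<star> K) \<cdot> inv \<alpha> H (K \<star> H) K"
proof -
  have "s \<cdot> (H \<star> q) = (s \<cdot> (H \<star> k)) \<cdot> (H \<star> ((K \<star> \<psi>) \<cdot> \<alpha> K H K))"
    by (simp add: q_def)
  also have "\<dots> = (m \<cdot> ((K \<star> H) \<star> \<psi>) \<cdot> \<alpha> (K \<star> H) H K) \<cdot> inv \<alpha> (K \<star> H) H K \<cdot> (\<psi> \<star> (H \<star> K))
      \<cdot> inv \<alpha> H K (H \<star> K) \<cdot> (H \<star> \<alpha> K H K)"
    by (simp add: nats flip: m_psi_left)
  also have "\<dots> = q \<cdot> (n \<star> K) \<cdot> ((\<psi> \<star> H) \<star> K)
      \<cdot> (inv \<alpha> (H \<star> K) H K \<cdot> inv \<alpha> H K (H \<star> K) \<cdot> (H \<star> \<alpha> K H K))"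
    unfolding m_psi_right by (simp add: nats)
  also have "\<dots> = q \<cdot> (s \<star> K) \<cdot> inv \<alpha> H (K \<star> H) K"
    unfolding pentagon_outer[OF typing(1,2,1,2)] by (simp add: s_def)
  finally show ?thesis .
qed

text \<open>By \<open>m_alt\<close>, right multiplication is \<open>q\<close> followed by
  \<open>n\<close>, and \<open>s\<close> commutes with each of them.\<close>

lemma s_m: "s \<cdot> (H \<star> m) = m \<cdot> (s \<star> (K \<star> H)) \<cdot> inv \<alpha> H (K \<star> H) (K \<star> H)"
proof -
  have "s \<cdot> (H \<star> m) = (s \<cdot> (H \<star> n)) \<cdot> (H \<star> ((q \<star> H) \<cdot> inv \<alpha> (K \<star> H) K H))"
    by (simp add: m_alt)
  also have "\<dots> = n \<cdot> ((s \<cdot> (H \<star> q)) \<star> H) \<cdot> inv \<alpha> H ((K \<star> H) \<star> K) H \<cdot> (H \<star> inv \<alpha> (K \<star> H) K H)"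
    unfolding s_n by (simp add: nats)
  also have "\<dots> = n \<cdot> ((q \<cdot> (s \<star> K)) \<star> H)
      \<cdot> ((inv \<alpha> H (K \<star> H) K \<star> H) \<cdot> inv \<alpha> H ((K \<star> H) \<star> K) H \<cdot> (H \<star> inv \<alpha> (K \<star> H) K H))"
    unfolding s_q by simp
  also have "\<dots> = m \<cdot> (s \<star> (K \<star> H)) \<cdot> inv \<alpha> H (K \<star> H) (K \<star> H)"
    by (subst pentagon_inv) (simp_all add: m_alt nats)
  finally show ?thesis .
qed

lemma k_m: "k \<cdot> (K \<star> m) = m \<cdot> (k \<star> (K \<star> H)) \<cdot> inv \<alpha> K (K \<star> H) (K \<star> H)"
proof -
  have "m \<cdot> (k \<star> (K \<star> H)) \<cdot> inv \<alpha> K (K \<star> H) (K \<star> H)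
      = k \<cdot> (mK \<star> s) \<cdot> (\<alpha> (K \<star> K) H (K \<star> H) \<cdot> (inv \<alpha> K K H \<star> (K \<star> H))) \<cdot> inv \<alpha> K (K \<star> H) (K \<star> H)"
    by (simp add: m_def k_def nats)
  also have "\<dots> = (k \<cdot> (mK \<star> (K \<star> H))) \<cdot> ((K \<star> K) \<star> s) \<cdot> inv \<alpha> K K (H \<star> (K \<star> H)) \<cdot> (K \<star> \<alpha> K H (K \<star> H))"
    by (subst pentagon_split_left) simp_all
  also have "\<dots> = k \<cdot> (K \<star> m)"
    unfolding k_assoc by (simp add: m_def nats)
  finally show ?thesis by (rule sym)
qed

text \<open>By definition left multiplication is \<open>s\<close> followed by \<open>k\<close>, and
  both commute with right multiplication by \<open>s_m\<close> and \<open>k_m\<close>.\<close>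

lemma m_assoc: "m \<cdot> (m \<star> (K \<star> H)) = m \<cdot> ((K \<star> H) \<star> m) \<cdot> \<alpha> (K \<star> H) (K \<star> H) (K \<star> H)"
proof -
  have "m \<cdot> ((K \<star> H) \<star> m) \<cdot> \<alpha> (K \<star> H) (K \<star> H) (K \<star> H)
      = k \<cdot> (K \<star> (s \<cdot> (H \<star> m))) \<cdot> \<alpha> K H ((K \<star> H) \<star> (K \<star> H)) \<cdot> \<alpha> (K \<star> H) (K \<star> H) (K \<star> H)"
    by (simp add: m_def[of] nats)
  also have "\<dots> = (k \<cdot> (K \<star> m)) \<cdot> (K \<star> (s \<star> (K \<star> H)))
      \<cdot> ((K \<star> inv \<alpha> H (K \<star> H) (K \<star> H)) \<cdot> \<alpha> K H ((K \<star> H) \<star> (K \<star> H)) \<cdot> \<alpha> (K \<star> H) (K \<star> H) (K \<star> H))"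
    unfolding s_m by simp
  also have "\<dots> = m \<cdot> (m \<star> (K \<star> H))"
    unfolding k_m by (subst pentagon_left_inv) (simp_all add: m_def nats)
  finally show ?thesis by (rule sym)
qed

text \<open>The unit of \<open>K\<close> embeds \<open>H\<close> into \<open>K \<star> H\<close>,
  and the unit law of \<open>\<psi>\<close> makes \<open>s\<close> restrict to the product of
  \<open>H\<close>. Together with its counterpart \<open>q_uH\<close> this lets the antipode
  computation pass from the twisted product back to the product of one factor.\<close>

lemma s_uK: "s \<cdot> (H \<star> ((uK \<star> H) \<cdot> inv \<l> H)) = (uK \<star> H) \<cdot> inv \<l> H \<cdot> mH"
proof -
  have "s \<cdot> (H \<star> ((uK \<star> H) \<cdot> inv \<l> H)) = n \<cdot> ((\<psi> \<cdot> (H \<star> uK)) \<star> H) \<cdot> (inv \<alpha> H \<e> H \<cdot> (H \<star> inv \<l> H))"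
    by (simp add: s_def nats)
  also have "\<dots> = n \<cdot> ((\<psi> \<cdot> (H \<star> uK) \<cdot> inv \<r> H) \<star> H)"
    by (subst triangle_inv) simp_all
  also have "\<dots> = (uK \<star> mH) \<cdot> (\<alpha> \<e> H H \<cdot> (inv \<l> H \<star> H))"
    unfolding psi_uK by (simp add: n_def nats)
  also have "\<alpha> \<e> H H \<cdot> (inv \<l> H \<star> H) = inv \<l> (H \<star> H)"
    by (simp flip: inv_lun_tensor)
  also have "(uK \<star> mH) \<cdot> inv \<l> (H \<star> H) = (uK \<star> H) \<cdot> inv \<l> H \<cdot> mH"
    by (simp add: inv_lun_nat)
  finally show ?thesis .
qed

lemma q_uH: "q \<cdot> (((K \<star> uH) \<cdot> inv \<r> K) \<star> K) = (K \<star> uH) \<cdot> inv \<r> K \<cdot> mK"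
proof -
  have "q \<cdot> (((K \<star> uH) \<cdot> inv \<r> K) \<star> K) = k \<cdot> (K \<star> (\<psi> \<cdot> (uH \<star> K))) \<cdot> (\<alpha> K \<e> K \<cdot> (inv \<r> K \<star> K))"
    by (simp add: q_def nats)
  also have "\<alpha> K \<e> K \<cdot> (inv \<r> K \<star> K) = K \<star> inv \<l> K"
    by (simp flip: triangle_inv)
  also have "k \<cdot> (K \<star> (\<psi> \<cdot> (uH \<star> K))) \<cdot> (K \<star> inv \<l> K) = k \<cdot> (K \<star> (\<psi> \<cdot> (uH \<star> K) \<cdot> inv \<l> K))"
    by simp
  also have "\<dots> = (mK \<star> uH) \<cdot> (inv \<alpha> K K \<e> \<cdot> (K \<star> inv \<r> K))"
    unfolding psi_uH by (simp add: k_def nats)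
  also have "inv \<alpha> K K \<e> \<cdot> (K \<star> inv \<r> K) = inv \<r> (K \<star> K)"
    by (simp add: inv_run_tensor)
  also have "(mK \<star> uH) \<cdot> inv \<r> (K \<star> K) = (K \<star> uH) \<cdot> inv \<r> K \<cdot> mK"
    by (simp add: inv_run_nat)
  finally show ?thesis .
qed

section \<open>The unit of the twisted product\<close>

definition u where "u = (uK \<star> uH) \<cdot> inv \<l> \<e>"

lemma u_typing [simp]: "u \<in> Arr" "src u = \<e>" "tgt u = K \<star> H"
  by (simp_all add: u_def)

lemma s_uH: "s \<cdot> (uH \<star> (K \<star> H)) = \<l> (K \<star> H)"
proof -
  have "s \<cdot> (uH \<star> (K \<star> H)) = n \<cdot> ((\<psi> \<cdot> (uH \<star> K)) \<star> H) \<cdot> inv \<alpha> \<e> K H"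
    by (simp add: s_def nats)
  also have "\<dots> = n \<cdot> ((\<psi> \<cdot> (uH \<star> K) \<cdot> inv \<l> K) \<star> H) \<cdot> ((\<l> K \<star> H) \<cdot> inv \<alpha> \<e> K H)"
    by simp
  also have "\<dots> = (K \<star> (mH \<cdot> (uH \<star> H))) \<cdot> (\<alpha> K \<e> H \<cdot> (inv \<r> K \<star> H)) \<cdot> \<l> (K \<star> H)"
    unfolding psi_uH lun_tensor_inv[OF typing(2,1)] by (simp add: n_def nats)
  also have "\<alpha> K \<e> H \<cdot> (inv \<r> K \<star> H) = K \<star> inv \<l> H"
    by (simp flip: triangle_inv)
  finally show ?thesis
    by (simp add: monoid_laws)
qed

lemma q_uK: "q \<cdot> ((K \<star> H) \<star> uK) = \<r> (K \<star> H)"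
proof -
  have "q \<cdot> ((K \<star> H) \<star> uK) = k \<cdot> (K \<star> (\<psi> \<cdot> (H \<star> uK))) \<cdot> \<alpha> K H \<e>"
    by (simp add: q_def nats)
  also have "\<dots> = k \<cdot> (K \<star> (\<psi> \<cdot> (H \<star> uK) \<cdot> inv \<r> H)) \<cdot> ((K \<star> \<r> H) \<cdot> \<alpha> K H \<e>)"
    by simp
  also have "\<dots> = ((mK \<cdot> (K \<star> uK)) \<star> H) \<cdot> (inv \<alpha> K \<e> H \<cdot> (K \<star> inv \<l> H)) \<cdot> \<r> (K \<star> H)"
    unfolding psi_uK run_tensor[OF typing(2,1)] by (simp add: k_def nats)
  also have "inv \<alpha> K \<e> H \<cdot> (K \<star> inv \<l> H) = inv \<r> K \<star> H"
    by (simp add: triangle_inv)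
  finally show ?thesis
    by (simp add: monoid_laws)
qed

lemma m_unit_left: "m \<cdot> (u \<star> (K \<star> H)) = \<l> (K \<star> H)"
proof -
  have "m \<cdot> (u \<star> (K \<star> H)) = k \<cdot> (uK \<star> (s \<cdot> (uH \<star> (K \<star> H)))) \<cdot> (\<alpha> \<e> \<e> (K \<star> H) \<cdot> (inv \<r> \<e> \<star> (K \<star> H)))"
    by (simp add: m_def u_def lun_unt nats)
  also have "\<alpha> \<e> \<e> (K \<star> H) \<cdot> (inv \<r> \<e> \<star> (K \<star> H)) = \<e> \<star> inv \<l> (K \<star> H)"
    by (simp flip: triangle_inv)
  also have "k \<cdot> (uK \<star> (s \<cdot> (uH \<star> (K \<star> H)))) \<cdot> (\<e> \<star> inv \<l> (K \<star> H)) = ((mK \<cdot> (uK \<star> K)) \<star> H) \<cdot> inv \<alpha> \<e> K H"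
    unfolding s_uH by (simp add: k_def nats)
  also have "\<dots> = \<l> (K \<star> H)"
    by (simp add: monoid_laws lun_tensor_inv)
  finally show ?thesis .
qed

lemma m_unit_right: "m \<cdot> ((K \<star> H) \<star> u) = \<r> (K \<star> H)"
proof -
  have "m \<cdot> ((K \<star> H) \<star> u) = n \<cdot> ((q \<cdot> ((K \<star> H) \<star> uK)) \<star> uH) \<cdot> (inv \<alpha> (K \<star> H) \<e> \<e> \<cdot> ((K \<star> H) \<star> inv \<l> \<e>))"
    by (simp add: m_alt u_def nats)
  also have "inv \<alpha> (K \<star> H) \<e> \<e> \<cdot> ((K \<star> H) \<star> inv \<l> \<e>) = inv \<r> (K \<star> H) \<star> \<e>"
    by (simp add: triangle_inv)
  also have "n \<cdot> ((q \<cdot> ((K \<star> H) \<star> uK)) \<star> uH) \<cdot> (inv \<r> (K \<star> H) \<star> \<e>) = (K \<star> (mH \<cdot> (H \<star> uH))) \<cdot> \<alpha> K H \<e>"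
    unfolding q_uK by (simp add: n_def nats)
  also have "\<dots> = \<r> (K \<star> H)"
    by (simp add: monoid_laws run_tensor)
  finally show ?thesis .
qed

lemma monoid_object_m: "monoid_object C M (K \<star> H, m, u)"
  by (simp add: monoid_object_def hom_iff m_assoc m_unit_left m_unit_right)

text \<open>The antipode computation produces the unit as \<open>uK\<close> followed by the
  embedding of \<open>K\<close>, and its mirror image as \<open>uH\<close> followed by the embedding
  of \<open>H\<close>.\<close>

lemma u_alt: "(K \<star> uH) \<cdot> inv \<r> K \<cdot> uK = u" "(uK \<star> H) \<cdot> inv \<l> H \<cdot> uH = u"
  by (simp_all add: u_def lun_unt inv_run_nat inv_lun_nat)

end

section \<open>Comonoids and bimonoids in a duoidal category\<close>

context duoidal_category
begin

lemma zeta_typing [simp]: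
  assumes "X \<in> Ob" "Y \<in> Ob" "Z \<in> Ob" "T \<in> Ob"
  shows "\<zeta> X Y Z T \<in> Arr" "src (\<zeta> X Y Z T) = (X \<bullet> Y) \<odot> (Z \<bullet> T)" "tgt (\<zeta> X Y Z T) = (X \<odot> Z) \<bullet> (Y \<odot> T)"
  using zeta_in[OF assms] by (simp_all add: circ.hom_iff)

lemma J_typing [simp]:
  "\<mm>\<^sub>J \<in> Arr" "src \<mm>\<^sub>J = \<J> \<odot> \<J>" "tgt \<mm>\<^sub>J = \<J>" "\<epsilon>\<^sub>I \<in> Arr" "src \<epsilon>\<^sub>I = \<I>" "tgt \<epsilon>\<^sub>I = \<J>"
  using monoid_J by (simp_all add: monoid_object_def circ.hom_iff)

lemma I_typing [simp]:
  "\<Delta>\<^sub>I \<in> Arr" "src \<Delta>\<^sub>I = \<I>" "tgt \<Delta>\<^sub>I = \<I> \<bullet> \<I>"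
  using comonoid_I by (simp_all add: comonoid_object_def circ.hom_iff)

lemma J_monoid_laws:
  "\<mm>\<^sub>J \<cdot> (\<mm>\<^sub>J \<odot> \<J>) = \<mm>\<^sub>J \<cdot> (\<J> \<odot> \<mm>\<^sub>J) \<cdot> \<aa>\<^sub>\<odot> \<J> \<J> \<J>" "\<mm>\<^sub>J \<cdot> (\<epsilon>\<^sub>I \<odot> \<J>) = \<ll>\<^sub>\<odot> \<J>" "\<mm>\<^sub>J \<cdot> (\<J> \<odot> \<epsilon>\<^sub>I) = \<rr>\<^sub>\<odot> \<J>"
  using monoid_J by (simp_all add: monoid_object_def)

lemma I_comonoid_laws:
  "\<aa>\<^sub>\<bullet> \<I> \<I> \<I> \<cdot> (\<Delta>\<^sub>I \<bullet> \<I>) \<cdot> \<Delta>\<^sub>I = (\<I> \<bullet> \<Delta>\<^sub>I) \<cdot> \<Delta>\<^sub>I" "\<ll>\<^sub>\<bullet> \<I> \<cdot> (\<epsilon>\<^sub>I \<bullet> \<I>) \<cdot> \<Delta>\<^sub>I = \<I>" "\<rr>\<^sub>\<bullet> \<I> \<cdot> (\<I> \<bullet> \<epsilon>\<^sub>I) \<cdot> \<Delta>\<^sub>I = \<I>"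
  using comonoid_I by (simp_all add: comonoid_object_def)

lemma zeta_natural:
  "\<lbrakk>f \<in> Arr; g \<in> Arr; h \<in> Arr; k \<in> Arr; tgt f = X; tgt g = Y; tgt h = Z; tgt k = T\<rbrakk>
    \<Longrightarrow> \<zeta> X Y Z T \<cdot> ((f \<bullet> g) \<odot> (h \<bullet> k)) = ((f \<odot> h) \<bullet> (g \<odot> k)) \<cdot> \<zeta> (src f) (src g) (src h) (src k)"
  by (rule zeta_nat) (auto simp: circ.hom_iff)

text \<open>As with \<open>asc_nat_comp\<close>: the normal form leaves residual factors inside the
  tensor slots, and these variants move \<open>\<zeta>\<close> past the part in which it is
  natural.\<close>

lemma zeta_natural_left:
  assumes "f \<in> Arr" "g \<in> Arr" "h \<in> Arr" "k \<in> Arr" "tgt f = X" "tgt g = Y" "tgt h = Z" "tgt k = T"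
    "r \<in> Arr" "tgt r = src f \<bullet> src g"
  shows "\<zeta> X Y Z T \<cdot> (((f \<bullet> g) \<cdot> r) \<odot> (h \<bullet> k))
    = ((f \<odot> h) \<bullet> (g \<odot> k)) \<cdot> \<zeta> (src f) (src g) (src h) (src k) \<cdot> (r \<odot> (src h \<bullet> src k))"
proof -
  have "\<zeta> X Y Z T \<cdot> (((f \<bullet> g) \<cdot> r) \<odot> (h \<bullet> k)) = (\<zeta> X Y Z T \<cdot> ((f \<bullet> g) \<odot> (h \<bullet> k))) \<cdot> (r \<odot> (src h \<bullet> src k))"
    using assms by auto
  also have "\<dots> = (((f \<odot> h) \<bullet> (g \<odot> k)) \<cdot> \<zeta> (src f) (src g) (src h) (src k)) \<cdot> (r \<odot> (src h \<bullet> src k))"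
    using assms by (simp only: zeta_natural)
  finally show ?thesis using assms by auto
qed

lemma zeta_natural_right:
  assumes "f \<in> Arr" "g \<in> Arr" "h \<in> Arr" "k \<in> Arr" "tgt f = X" "tgt g = Y" "tgt h = Z" "tgt k = T"
    "r \<in> Arr" "tgt r = src h \<bullet> src k"
  shows "\<zeta> X Y Z T \<cdot> ((f \<bullet> g) \<odot> ((h \<bullet> k) \<cdot> r))
    = ((f \<odot> h) \<bullet> (g \<odot> k)) \<cdot> \<zeta> (src f) (src g) (src h) (src k) \<cdot> ((src f \<bullet> src g) \<odot> r)"
proof -
  have "\<zeta> X Y Z T \<cdot> ((f \<bullet> g) \<odot> ((h \<bullet> k) \<cdot> r)) = (\<zeta> X Y Z T \<cdot> ((f \<bullet> g) \<odot> (h \<bullet> k))) \<cdot> ((src f \<bullet> src g) \<odot> r)"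
    using assms by auto
  also have "\<dots> = (((f \<odot> h) \<bullet> (g \<odot> k)) \<cdot> \<zeta> (src f) (src g) (src h) (src k)) \<cdot> ((src f \<bullet> src g) \<odot> r)"
    using assms by (simp only: zeta_natural)
  finally show ?thesis using assms by auto
qed

lemma zeta_natural_both:
  assumes "f \<in> Arr" "g \<in> Arr" "h \<in> Arr" "k \<in> Arr" "tgt f = X" "tgt g = Y" "tgt h = Z" "tgt k = T"
    "r \<in> Arr" "tgt r = src f \<bullet> src g" "r' \<in> Arr" "tgt r' = src h \<bullet> src k"
  shows "\<zeta> X Y Z T \<cdot> (((f \<bullet> g) \<cdot> r) \<odot> ((h \<bullet> k) \<cdot> r'))
    = ((f \<odot> h) \<bullet> (g \<odot> k)) \<cdot> \<zeta> (src f) (src g) (src h) (src k) \<cdot> (r \<odot> r')"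
proof -
  have "\<zeta> X Y Z T \<cdot> (((f \<bullet> g) \<cdot> r) \<odot> ((h \<bullet> k) \<cdot> r')) = (\<zeta> X Y Z T \<cdot> ((f \<bullet> g) \<odot> (h \<bullet> k))) \<cdot> (r \<odot> r')"
    using assms by auto
  also have "\<dots> = (((f \<odot> h) \<bullet> (g \<odot> k)) \<cdot> \<zeta> (src f) (src g) (src h) (src k)) \<cdot> (r \<odot> r')"
    using assms by (simp only: zeta_natural)
  finally show ?thesis using assms by auto
qed

lemmas zeta_nats = zeta_natural zeta_natural_left zeta_natural_right zeta_natural_both
  circ.comp_ext[OF zeta_natural] circ.comp_ext[OF zeta_natural_left] circ.comp_ext[OF zeta_natural_right]
  circ.comp_ext[OF zeta_natural_both]

section \<open>Comonoids for the second tensor product\<close>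

abbreviation comonoid where "comonoid \<equiv> comonoid_object D (bul D)"
abbreviation comor where "comor \<equiv> comonoid_morphism D (bul D)"

lemma comonoidD:
  assumes "comonoid (X, d, e)"
  shows "X \<in> Ob" "d \<in> Arr" "src d = X" "tgt d = X \<bullet> X" "e \<in> Arr" "src e = X" "tgt e = \<J>"
    "\<aa>\<^sub>\<bullet> X X X \<cdot> (d \<bullet> X) \<cdot> d = (X \<bullet> d) \<cdot> d" "\<ll>\<^sub>\<bullet> X \<cdot> (e \<bullet> X) \<cdot> d = X" "\<rr>\<^sub>\<bullet> X \<cdot> (X \<bullet> e) \<cdot> d = X"
  using assms by (simp_all add: comonoid_object_def circ.hom_iff)

text \<open>Coassociativity is \<open>zeta_bul_assoc\<close>, once the comultiplications have been
  collected on the right. The counit laws are \<open>zeta_bul_lunit\<close> and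
  \<open>zeta_bul_runit\<close>, in which \<open>\<mm>\<^sub>J\<close> already occurs.\<close>

lemma comonoid_circ_triple:
  assumes "comonoid (X, d, e)" "comonoid (Y, d', e')"
  shows "comonoid (circ_comonoid D (X, d, e) (Y, d', e'))"
proof -
  note X = comonoidD[OF assms(1)] and Y = comonoidD[OF assms(2)]
  note [simp] = X(1-7) Y(1-7)
  have "\<aa>\<^sub>\<bullet> (X \<odot> Y) (X \<odot> Y) (X \<odot> Y) \<cdot> ((\<zeta> X X Y Y \<cdot> (d \<odot> d')) \<bullet> (X \<odot> Y)) \<cdot> (\<zeta> X X Y Y \<cdot> (d \<odot> d'))
      = ((X \<odot> Y) \<bullet> (\<zeta> X X Y Y \<cdot> (d \<odot> d'))) \<cdot> (\<zeta> X X Y Y \<cdot> (d \<odot> d'))"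
  proof -
    have "\<aa>\<^sub>\<bullet> (X \<odot> Y) (X \<odot> Y) (X \<odot> Y) \<cdot> ((\<zeta> X X Y Y \<cdot> (d \<odot> d')) \<bullet> (X \<odot> Y)) \<cdot> (\<zeta> X X Y Y \<cdot> (d \<odot> d'))
      = (\<aa>\<^sub>\<bullet> (X \<odot> Y) (X \<odot> Y) (X \<odot> Y) \<cdot> (\<zeta> X X Y Y \<bullet> (X \<odot> Y)) \<cdot> \<zeta> (X \<bullet> X) X (Y \<bullet> Y) Y) \<cdot> (((d \<bullet> X) \<cdot> d) \<odot> ((d' \<bullet> Y) \<cdot> d'))"
      by (simp add: zeta_nats)
    also have "\<dots> = ((X \<odot> Y) \<bullet> \<zeta> X X Y Y) \<cdot> \<zeta> X (X \<bullet> X) Y (Y \<bullet> Y) \<cdot> ((\<aa>\<^sub>\<bullet> X X X \<cdot> (d \<bullet> X) \<cdot> d) \<odot> (\<aa>\<^sub>\<bullet> Y Y Y \<cdot> (d' \<bullet> Y) \<cdot> d'))"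
      by (subst zeta_bul_assoc[symmetric]) simp_all
    also have "\<dots> = ((X \<odot> Y) \<bullet> (\<zeta> X X Y Y \<cdot> (d \<odot> d'))) \<cdot> (\<zeta> X X Y Y \<cdot> (d \<odot> d'))"
      unfolding X(8) Y(8) by (simp add: zeta_nats)
    finally show ?thesis .
  qed
  moreover have "\<ll>\<^sub>\<bullet> (X \<odot> Y) \<cdot> ((\<mm>\<^sub>J \<cdot> (e \<odot> e')) \<bullet> (X \<odot> Y)) \<cdot> (\<zeta> X X Y Y \<cdot> (d \<odot> d')) = X \<odot> Y"
  proof -
    have "\<ll>\<^sub>\<bullet> (X \<odot> Y) \<cdot> ((\<mm>\<^sub>J \<cdot> (e \<odot> e')) \<bullet> (X \<odot> Y)) \<cdot> (\<zeta> X X Y Y \<cdot> (d \<odot> d'))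
        = (\<ll>\<^sub>\<bullet> (X \<odot> Y) \<cdot> (\<mm>\<^sub>J \<bullet> (X \<odot> Y)) \<cdot> \<zeta> \<J> X \<J> Y) \<cdot> (((e \<bullet> X) \<cdot> d) \<odot> ((e' \<bullet> Y) \<cdot> d'))"
      by (simp add: zeta_nats)
    also have "\<dots> = X \<odot> Y"
      by (subst zeta_bul_lunit) (simp_all add: X Y)
    finally show ?thesis .
  qed
  moreover have "\<rr>\<^sub>\<bullet> (X \<odot> Y) \<cdot> ((X \<odot> Y) \<bullet> (\<mm>\<^sub>J \<cdot> (e \<odot> e'))) \<cdot> (\<zeta> X X Y Y \<cdot> (d \<odot> d')) = X \<odot> Y"
  proof -
    have "\<rr>\<^sub>\<bullet> (X \<odot> Y) \<cdot> ((X \<odot> Y) \<bullet> (\<mm>\<^sub>J \<cdot> (e \<odot> e'))) \<cdot> (\<zeta> X X Y Y \<cdot> (d \<odot> d'))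
        = (\<rr>\<^sub>\<bullet> (X \<odot> Y) \<cdot> ((X \<odot> Y) \<bullet> \<mm>\<^sub>J) \<cdot> \<zeta> X \<J> Y \<J>) \<cdot> (((X \<bullet> e) \<cdot> d) \<odot> ((Y \<bullet> e') \<cdot> d'))"
      by (simp add: zeta_nats)
    also have "\<dots> = X \<odot> Y"
      by (subst zeta_bul_runit) (simp_all add: X Y)
    finally show ?thesis .
  qed
  ultimately show ?thesis
    by (simp add: circ_comonoid_def comonoid_object_def circ.hom_iff)
qed

lemma comorD:
  assumes "comor (X, d, e) (X', d', e') f"
  shows "f \<in> Arr" "src f = X" "tgt f = X'" "d' \<cdot> f = (f \<bullet> f) \<cdot> d" "e' \<cdot> f = e"
  using assms by (simp_all add: comonoid_morphism_def circ.hom_iff)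

lemma comorI:
  "\<lbrakk>f \<in> Arr; src f = X; tgt f = X'; d' \<cdot> f = (f \<bullet> f) \<cdot> d; e' \<cdot> f = e\<rbrakk> \<Longrightarrow> comor (X, d, e) (X', d', e') f"
  by (simp add: comonoid_morphism_def circ.hom_iff)

lemma comor_comp:
  assumes "comonoid P" "comonoid Q" "comonoid R" "comor P Q f" "comor Q R g"
  shows "comor P R (g \<cdot> f)"
proof -
  obtain X d e where P: "P = (X, d, e)" by (cases P)
  obtain Y d' e' where Q: "Q = (Y, d', e')" by (cases Q)
  obtain Z d'' e'' where R: "R = (Z, d'', e'')" by (cases R)
  note o = comonoidD[OF assms(1)[unfolded P]] comonoidD[OF assms(2)[unfolded Q]] comonoidD[OF assms(3)[unfolded R]]
  note f = comorD[OF assms(4)[unfolded P Q]] and g = comorD[OF assms(5)[unfolded Q R]]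
  note [simp] = o(1-7) o(11-17) o(21-27) f(1-3) g(1-3)
  have "d'' \<cdot> (g \<cdot> f) = (g \<bullet> g) \<cdot> (d' \<cdot> f)"
    by (simp add: circ.comp_ext[OF g(4)])
  then have "d'' \<cdot> (g \<cdot> f) = ((g \<cdot> f) \<bullet> (g \<cdot> f)) \<cdot> d"
    by (simp add: f(4))
  moreover have "e'' \<cdot> (g \<cdot> f) = e"
    by (simp add: circ.comp_ext[OF g(5)] f(5))
  ultimately show ?thesis
    unfolding P R by (intro comorI) simp_all
qed

lemma comor_id: "comonoid P \<Longrightarrow> comor P P (fst P)"
  by (cases P) (auto intro!: comorI simp: comonoidD)

lemma comor_circ:
  assumes "comonoid P" "comonoid P'" "comonoid Q" "comonoid Q'" "comor P P' f" "comor Q Q' g"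
  shows "comor (circ_comonoid D P Q) (circ_comonoid D P' Q') (f \<odot> g)"
proof -
  obtain X d e where P: "P = (X, d, e)" by (cases P)
  obtain X' d' e' where P': "P' = (X', d', e')" by (cases P')
  obtain Y c b where Q: "Q = (Y, c, b)" by (cases Q)
  obtain Y' c' b' where Q': "Q' = (Y', c', b')" by (cases Q')
  note o = comonoidD[OF assms(1)[unfolded P]] comonoidD[OF assms(2)[unfolded P']]
    comonoidD[OF assms(3)[unfolded Q]] comonoidD[OF assms(4)[unfolded Q']]
  note f = comorD[OF assms(5)[unfolded P P']] and g = comorD[OF assms(6)[unfolded Q Q']]
  note [simp] = o(1-7) o(11-17) o(21-27) o(31-37) f(1-3) g(1-3)
  show ?thesis
    unfolding P P' Q Q' circ_comonoid_def prod.case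
    by (rule comorI) (simp_all add: f(4,5) g(4,5) zeta_nats)
qed

text \<open>Comultiplications are compatible by \<open>zeta_circ_assoc\<close>, counits by
  associativity of \<open>\<mm>\<^sub>J\<close>. With \<open>comor_circ\<close> and
  \<open>comor_inverse\<close> this allows associators inside composites of comonoid
  morphisms.\<close>

lemma comor_assoc:
  assumes "comonoid P" "comonoid Q" "comonoid R"
  shows "comor (circ_comonoid D (circ_comonoid D P Q) R) (circ_comonoid D P (circ_comonoid D Q R))
    (\<aa>\<^sub>\<odot> (fst P) (fst Q) (fst R))"
proof -
  obtain X d e where P: "P = (X, d, e)" by (cases P)
  obtain Y d' e' where Q: "Q = (Y, d', e')" by (cases Q)
  obtain Z d'' e'' where R: "R = (Z, d'', e'')" by (cases R)
  note o = comonoidD[OF assms(1)[unfolded P]] comonoidD[OF assms(2)[unfolded Q]] comonoidD[OF assms(3)[unfolded R]]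
  note [simp] = o(1-7) o(11-17) o(21-27)
  have "(\<zeta> X X (Y \<odot> Z) (Y \<odot> Z) \<cdot> (d \<odot> (\<zeta> Y Y Z Z \<cdot> (d' \<odot> d'')))) \<cdot> \<aa>\<^sub>\<odot> X Y Z
      = (\<zeta> X X (Y \<odot> Z) (Y \<odot> Z) \<cdot> ((X \<bullet> X) \<odot> \<zeta> Y Y Z Z) \<cdot> \<aa>\<^sub>\<odot> (X \<bullet> X) (Y \<bullet> Y) (Z \<bullet> Z)) \<cdot> ((d \<odot> d') \<odot> d'')"
    by (simp add: circ.nats)
  also have "\<dots> = (\<aa>\<^sub>\<odot> X Y Z \<bullet> \<aa>\<^sub>\<odot> X Y Z) \<cdot> (\<zeta> (X \<odot> Y) (X \<odot> Y) Z Z \<cdot> ((\<zeta> X X Y Y \<cdot> (d \<odot> d')) \<odot> d''))"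
    by (subst zeta_circ_assoc) simp_all
  finally have 1: "(\<zeta> X X (Y \<odot> Z) (Y \<odot> Z) \<cdot> (d \<odot> (\<zeta> Y Y Z Z \<cdot> (d' \<odot> d'')))) \<cdot> \<aa>\<^sub>\<odot> X Y Z
    = (\<aa>\<^sub>\<odot> X Y Z \<bullet> \<aa>\<^sub>\<odot> X Y Z) \<cdot> (\<zeta> (X \<odot> Y) (X \<odot> Y) Z Z \<cdot> ((\<zeta> X X Y Y \<cdot> (d \<odot> d')) \<odot> d''))" .
  have "(\<mm>\<^sub>J \<cdot> (e \<odot> (\<mm>\<^sub>J \<cdot> (e' \<odot> e'')))) \<cdot> \<aa>\<^sub>\<odot> X Y Z = (\<mm>\<^sub>J \<cdot> (\<J> \<odot> \<mm>\<^sub>J) \<cdot> \<aa>\<^sub>\<odot> \<J> \<J> \<J>) \<cdot> ((e \<odot> e') \<odot> e'')"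
    by (simp add: circ.nats)
  also have "\<dots> = \<mm>\<^sub>J \<cdot> ((\<mm>\<^sub>J \<cdot> (e \<odot> e')) \<odot> e'')"
    unfolding J_monoid_laws(1)[symmetric] by simp
  finally have 2: "(\<mm>\<^sub>J \<cdot> (e \<odot> (\<mm>\<^sub>J \<cdot> (e' \<odot> e'')))) \<cdot> \<aa>\<^sub>\<odot> X Y Z = \<mm>\<^sub>J \<cdot> ((\<mm>\<^sub>J \<cdot> (e \<odot> e')) \<odot> e'')" .
  show ?thesis
    unfolding P Q R circ_comonoid_def prod.case fst_conv
    by (rule comorI) (use 1 2 in simp_all)
qed

lemma comor_lunitor:
  assumes "comonoid P"
  shows "comor (circ_comonoid D (\<I>, \<Delta>\<^sub>I, \<epsilon>\<^sub>I) P) P (\<ll>\<^sub>\<odot> (fst P))"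
proof -
  obtain X d e where P: "P = (X, d, e)" by (cases P)
  note o = comonoidD[OF assms(1)[unfolded P]]
  note [simp] = o(1-7)
  have "(\<ll>\<^sub>\<odot> X \<bullet> \<ll>\<^sub>\<odot> X) \<cdot> (\<zeta> \<I> \<I> X X \<cdot> (\<Delta>\<^sub>I \<odot> d)) = ((\<ll>\<^sub>\<odot> X \<bullet> \<ll>\<^sub>\<odot> X) \<cdot> \<zeta> \<I> \<I> X X \<cdot> (\<Delta>\<^sub>I \<odot> (X \<bullet> X))) \<cdot> (\<I> \<odot> d)"
    by simp
  also have "\<dots> = d \<cdot> \<ll>\<^sub>\<odot> X"
    by (subst zeta_circ_lunit) (simp_all add: circ.lun_nat)
  finally have 1: "d \<cdot> \<ll>\<^sub>\<odot> X = (\<ll>\<^sub>\<odot> X \<bullet> \<ll>\<^sub>\<odot> X) \<cdot> (\<zeta> \<I> \<I> X X \<cdot> (\<Delta>\<^sub>I \<odot> d))" by (rule sym)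
  have "\<mm>\<^sub>J \<cdot> (\<epsilon>\<^sub>I \<odot> e) = (\<mm>\<^sub>J \<cdot> (\<epsilon>\<^sub>I \<odot> \<J>)) \<cdot> (\<I> \<odot> e)"
    by simp
  also have "\<dots> = e \<cdot> \<ll>\<^sub>\<odot> X"
    unfolding J_monoid_laws by (simp add: circ.lun_nat)
  finally have 2: "e \<cdot> \<ll>\<^sub>\<odot> X = \<mm>\<^sub>J \<cdot> (\<epsilon>\<^sub>I \<odot> e)" by (rule sym)
  show ?thesis
    unfolding P circ_comonoid_def prod.case fst_conv
    by (rule comorI) (use 1 2 in simp_all)
qed

lemma comor_inverse:
  assumes "comonoid P" "comonoid Q" "comor P Q f" "iso D f"
  shows "comor Q P (inv f)"
proof -
  obtain X d e where P: "P = (X, d, e)" by (cases P)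
  obtain Y d' e' where Q: "Q = (Y, d', e')" by (cases Q)
  note o = comonoidD[OF assms(1)[unfolded P]] comonoidD[OF assms(2)[unfolded Q]]
  note f = comorD[OF assms(3)[unfolded P Q]]
  note [simp] = o(1-7) o(11-17) f(1-3) assms(4)
  have "d \<cdot> inv f = (inv f \<bullet> inv f) \<cdot> ((f \<bullet> f) \<cdot> d) \<cdot> inv f"
    by simp
  also have "\<dots> = (inv f \<bullet> inv f) \<cdot> d'"
    unfolding f(4)[symmetric] by simp
  finally have 1: "d \<cdot> inv f = (inv f \<bullet> inv f) \<cdot> d'" .
  have 2: "e \<cdot> inv f = e'"
    unfolding f(5)[symmetric] by simp
  show ?thesis
    unfolding P Q by (rule comorI) (use 1 2 in simp_all)
qed

lemma comonoid_circ: "\<lbrakk>comonoid P; comonoid Q\<rbrakk> \<Longrightarrow> comonoid (circ_comonoid D P Q)"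
  using comonoid_circ_triple by (cases P; cases Q) simp

lemma fst_circ_comonoid: "fst (circ_comonoid D P Q) = fst P \<odot> fst Q"
  by (cases P; cases Q) (simp add: circ_comonoid_def)

lemma comonoid_ob: "comonoid P \<Longrightarrow> fst P \<in> Ob"
  by (cases P) (simp add: comonoidD)

lemma comor_assoc_inv:
  assumes "comonoid P" "comonoid Q" "comonoid R"
  shows "comor (circ_comonoid D P (circ_comonoid D Q R)) (circ_comonoid D (circ_comonoid D P Q) R)
    (inv \<aa>\<^sub>\<odot> (fst P) (fst Q) (fst R))"
  by (rule comor_inverse[OF _ _ comor_assoc]) (simp_all add: assms comonoid_circ comonoid_ob)

text \<open>A bimonoid is a monoid in the category of comonoids: its four compatibility equations
  regroup into \<open>m\<close> and \<open>u\<close> being comonoid morphisms. In this form the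
  bimonoid laws of the twisted product follow by composition.\<close>

lemma bimonoidD:
  assumes "bimonoid D (H, m, u, d, e)"
  shows "monoid_object D (circ D) (H, m, u)" "comonoid (H, d, e)"
    "comor (circ_comonoid D (H, d, e) (H, d, e)) (H, d, e) m" "comor (\<I>, \<Delta>\<^sub>I, \<epsilon>\<^sub>I) (H, d, e) u"
proof -
  show M: "monoid_object D (circ D) (H, m, u)" and "comonoid (H, d, e)"
    using assms by (simp_all add: bimonoid_def)
  have "m \<in> Arr" "src m = H \<odot> H" "tgt m = H" "u \<in> Arr" "src u = \<I>" "tgt u = H"
    using M by (simp_all add: monoid_object_def circ.hom_iff)
  then show "comor (circ_comonoid D (H, d, e) (H, d, e)) (H, d, e) m" "comor (\<I>, \<Delta>\<^sub>I, \<epsilon>\<^sub>I) (H, d, e) u"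
    using assms by (auto simp: bimonoid_def circ_comonoid_def intro!: comorI)
qed

lemma bimonoidI:
  assumes "monoid_object D (circ D) (H, m, u)" "comonoid (H, d, e)"
    "comor (circ_comonoid D (H, d, e) (H, d, e)) (H, d, e) m" "comor (\<I>, \<Delta>\<^sub>I, \<epsilon>\<^sub>I) (H, d, e) u"
  shows "bimonoid D (H, m, u, d, e)"
  using assms comorD(4,5)[OF assms(3)[unfolded circ_comonoid_def prod.case]] comorD(4,5)[OF assms(4)]
  by (simp add: bimonoid_def)

lemma distributive_monoids_circ:
  assumes "bimonoid D (H, m\<^sub>H, u\<^sub>H, d\<^sub>H, e\<^sub>H)" "bimonoid D (K, m\<^sub>K, u\<^sub>K, d\<^sub>K, e\<^sub>K)"
    "distributive_law D (H, m\<^sub>H, u\<^sub>H) (K, m\<^sub>K, u\<^sub>K) \<psi>"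
  shows "distributive_monoids D (circ D) H m\<^sub>H u\<^sub>H K m\<^sub>K u\<^sub>K \<psi>"
  using assms circ.monoidal_category_axioms
  by (auto simp: distributive_law_def bimonoid_def intro!: distributive_monoids.intro distributive_monoids_axioms.intro)

text \<open>Every factor of \<open>dm.m_expand\<close> is a comonoid morphism: an associator, an
  inverse associator, \<open>\<psi>\<close> or multiplications, tensored with identities where
  necessary.\<close>

lemma bimonoid_wreath:
  assumes H: "bimonoid D (H, m\<^sub>H, u\<^sub>H, d\<^sub>H, e\<^sub>H)" and K: "bimonoid D (K, m\<^sub>K, u\<^sub>K, d\<^sub>K, e\<^sub>K)"
    and dl: "distributive_law D (H, m\<^sub>H, u\<^sub>H) (K, m\<^sub>K, u\<^sub>K) \<psi>"
    and cm: "comor (circ_comonoid D (H, d\<^sub>H, e\<^sub>H) (K, d\<^sub>K, e\<^sub>K)) (circ_comonoid D (K, d\<^sub>K, e\<^sub>K) (H, d\<^sub>H, e\<^sub>H)) \<psi>"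
  shows "bimonoid D (wreath_bimonoid D (K, m\<^sub>K, u\<^sub>K, d\<^sub>K, e\<^sub>K) \<psi> (H, m\<^sub>H, u\<^sub>H, d\<^sub>H, e\<^sub>H))"
proof -
  interpret dm: distributive_monoids D "circ D" H m\<^sub>H u\<^sub>H K m\<^sub>K u\<^sub>K \<psi>
    by (rule distributive_monoids_circ[OF H K dl])
  note h = bimonoidD[OF H] and k = bimonoidD[OF K]
  define Hc where "Hc = (H, d\<^sub>H, e\<^sub>H)"
  define Kc where "Kc = (K, d\<^sub>K, e\<^sub>K)"
  have fst: "fst Hc = H" "fst Kc = K"
    by (simp_all add: Hc_def Kc_def)
  have Hc: "comonoid Hc" and Kc: "comonoid Kc"
    using h k by (simp_all add: Hc_def Kc_def)
  note objects = comonoid_circ Hc Kc comonoid_I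
  let ?c = "circ_comonoid D"
  let ?A = "?c Kc Hc"
  have idH: "comor Hc Hc H" and idK: "comor Kc Kc K"
    using comor_id[OF Hc] comor_id[OF Kc] by (simp_all add: fst)
  \<comment> \<open>Facts \<open>1\<close> to \<open>6\<close> treat the factors of
    \<open>dm.m_expand\<close> from right to left.\<close>
  have 1: "comor (?c ?A ?A) (?c Kc (?c Hc ?A)) (\<aa>\<^sub>\<odot> K H (K \<odot> H))"
    using comor_assoc[of Kc Hc ?A] objects by (simp add: fst fst_circ_comonoid)
  have 2: "comor (?c Kc (?c Hc ?A)) (?c Kc (?c (?c Hc Kc) Hc)) (K \<odot> inv \<aa>\<^sub>\<odot> H K H)"
    using comor_assoc_inv[of Hc Kc Hc] objects by (intro comor_circ idK) (simp_all add: fst fst_circ_comonoid)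
  have 3: "comor (?c Kc (?c (?c Hc Kc) Hc)) (?c Kc (?c ?A Hc)) (K \<odot> (\<psi> \<odot> H))"
    using cm objects by (intro comor_circ idK idH) (simp_all add: Hc_def Kc_def)
  have 4: "comor (?c Kc (?c ?A Hc)) (?c Kc (?c Kc (?c Hc Hc))) (K \<odot> \<aa>\<^sub>\<odot> K H H)"
    using comor_assoc[of Kc Hc Hc] objects by (intro comor_circ idK) (simp_all add: fst fst_circ_comonoid)
  have 5: "comor (?c Kc (?c Kc (?c Hc Hc))) (?c (?c Kc Kc) (?c Hc Hc)) (inv \<aa>\<^sub>\<odot> K K (H \<odot> H))"
    using comor_assoc_inv[of Kc Kc "?c Hc Hc"] objects by (simp add: fst fst_circ_comonoid)
  have 6: "comor (?c (?c Kc Kc) (?c Hc Hc)) ?A (m\<^sub>K \<odot> m\<^sub>H)"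
    using h(3) k(3) objects by (intro comor_circ) (simp_all add: Hc_def Kc_def)
  have m: "comor (?c ?A ?A) ?A dm.m"
    unfolding dm.m_expand
    by (rule comor_comp[OF _ _ _ comor_comp[OF _ _ _ comor_comp[OF _ _ _ comor_comp[OF _ _ _
      comor_comp[OF _ _ _ 1 2] 3] 4] 5] 6]) (intro objects)+
  have "comor (\<I>, \<Delta>\<^sub>I, \<epsilon>\<^sub>I) (?c (\<I>, \<Delta>\<^sub>I, \<epsilon>\<^sub>I) (\<I>, \<Delta>\<^sub>I, \<epsilon>\<^sub>I)) (inv \<ll>\<^sub>\<odot> \<I>)"
    by (rule comor_inverse) (use comor_lunitor[OF comonoid_I] objects in simp_all)
  then have u: "comor (\<I>, \<Delta>\<^sub>I, \<epsilon>\<^sub>I) ?A dm.u"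
    unfolding dm.u_def
    by (rule comor_comp[rotated 3], intro comor_circ) (use h(4) k(4) objects in \<open>simp_all add: Hc_def Kc_def\<close>)
  have A: "?A = (K \<odot> H, \<zeta> K K H H \<cdot> (d\<^sub>K \<odot> d\<^sub>H), \<mm>\<^sub>J \<cdot> (e\<^sub>K \<odot> e\<^sub>H))"
    by (simp add: circ_comonoid_def Hc_def Kc_def)
  have "bimonoid D (K \<odot> H, dm.m, dm.u, \<zeta> K K H H \<cdot> (d\<^sub>K \<odot> d\<^sub>H), \<mm>\<^sub>J \<cdot> (e\<^sub>K \<odot> e\<^sub>H))"
    using m u objects(1)[OF Kc Hc] dm.monoid_object_m unfolding A by (intro bimonoidI)
  then show ?thesis
    by (simp only: wreath_bimonoid_def prod.case dm.m_expand dm.u_def)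
qed

end

section \<open>Half of a reversion\<close>

text \<open>
  The axioms (R3), (R7), (R16) for \<open>\<delta>\<close>. The corresponding axioms (R1), (R6), (R15) for \<open>\<gamma>\<close> are the same
  axioms in the duoidal category with both tensor products reversed.
\<close>

locale half_reversion = duoidal_category D
  for D :: "('a, 'b) duoidal_scheme" (structure) +
  fixes rv :: "'a \<Rightarrow> 'a" and phi :: "'a \<Rightarrow> 'a \<Rightarrow> 'a" and phi0 :: 'a
    and delta :: "'a \<Rightarrow> 'a \<Rightarrow> 'a \<Rightarrow> 'a \<Rightarrow> 'a"
  assumes rv_in: "f \<in> Hom X Y \<Longrightarrow> rv f \<in> Hom (rv X) (rv Y)"
    and phi_in: "\<lbrakk>X \<in> Ob; Y \<in> Ob\<rbrakk> \<Longrightarrow> phi X Y \<in> Hom (rv X \<odot> rv Y) (rv (Y \<odot> X))"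
    and phi0_in: "phi0 \<in> Hom \<I> (rv \<I>)"
    and delta_in: "\<lbrakk>X \<in> Ob; Y \<in> Ob; Z \<in> Ob; T \<in> Ob\<rbrakk>
      \<Longrightarrow> delta X Y Z T \<in> Hom (X \<bullet> (Y \<odot> (rv Z \<bullet> T))) (((X \<odot> Z) \<bullet> Y) \<odot> T)"
    and delta_nat: "\<lbrakk>f \<in> Hom X X'; g \<in> Hom Y Y'; h \<in> Hom Z Z'; k \<in> Hom T T'\<rbrakk>
      \<Longrightarrow> delta X' Y' Z' T' \<cdot> (f \<bullet> (g \<odot> (rv h \<bullet> k))) = (((f \<odot> h) \<bullet> g) \<odot> k) \<cdot> delta X Y Z T"
    and delta_zeta: "\<lbrakk>X \<in> Ob; Y \<in> Ob; Z \<in> Ob; T \<in> Ob; U \<in> Ob; V \<in> Ob\<rbrakk>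
      \<Longrightarrow> ((\<aa>\<^sub>\<odot> X Z U \<bullet> (Y \<odot> T)) \<odot> V) \<cdot> delta (X \<odot> Z) (Y \<odot> T) U V
          \<cdot> ((X \<odot> Z) \<bullet> inv \<aa>\<^sub>\<odot> Y T (rv U \<bullet> V)) \<cdot> \<zeta> X Y Z (T \<odot> (rv U \<bullet> V))
        = (\<zeta> X Y (Z \<odot> U) T \<odot> V) \<cdot> inv \<aa>\<^sub>\<odot> (X \<bullet> Y) ((Z \<odot> U) \<bullet> T) V \<cdot> ((X \<bullet> Y) \<odot> delta Z T U V)"
    and delta_I: "\<rr>\<^sub>\<odot> (\<I> \<bullet> \<I>) \<cdot> ((\<rr>\<^sub>\<odot> \<I> \<bullet> \<I>) \<odot> \<I>) \<cdot> delta \<I> \<I> \<I> \<I> \<cdot> (\<I> \<bullet> (\<I> \<odot> ((phi0 \<bullet> \<I>) \<cdot> \<Delta>\<^sub>I)))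
        = \<I> \<bullet> \<rr>\<^sub>\<odot> \<I>"
    and delta_delta: "\<lbrakk>X \<in> Ob; Y \<in> Ob; Z \<in> Ob; T \<in> Ob; U \<in> Ob; V \<in> Ob\<rbrakk>
      \<Longrightarrow> \<aa>\<^sub>\<odot> ((X \<odot> (U \<odot> Z)) \<bullet> Y) T V \<cdot> (((\<aa>\<^sub>\<odot> X U Z \<bullet> Y) \<odot> T) \<odot> V)
          \<cdot> (delta (X \<odot> U) Y Z T \<odot> V) \<cdot> delta X (Y \<odot> (rv Z \<bullet> T)) U V
        = delta X Y (U \<odot> Z) (T \<odot> V) \<cdot> (X \<bullet> (Y \<odot> (phi Z U \<bullet> (T \<odot> V))))
          \<cdot> (X \<bullet> (Y \<odot> \<zeta> (rv Z) T (rv U) V)) \<cdot> (X \<bullet> \<aa>\<^sub>\<odot> Y (rv Z \<bullet> T) (rv U \<bullet> V))"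
begin

lemma rv_typing [simp]: "f \<in> Arr \<Longrightarrow> rv f \<in> Arr" "f \<in> Arr \<Longrightarrow> src (rv f) = rv (src f)" "f \<in> Arr \<Longrightarrow> tgt (rv f) = rv (tgt f)"
  using rv_in[of f "src f" "tgt f"] by (simp_all add: circ.hom_iff)

lemma rv_ob [simp]: "X \<in> Ob \<Longrightarrow> rv X \<in> Ob"
  by (rule circ.homD(4)[OF rv_in[of X X X]]) (simp add: circ.hom_iff)

lemma phi_typing [simp]:
  assumes "X \<in> Ob" "Y \<in> Ob"
  shows "phi X Y \<in> Arr" "src (phi X Y) = rv X \<odot> rv Y" "tgt (phi X Y) = rv (Y \<odot> X)"
  using phi_in[OF assms] by (simp_all add: circ.hom_iff)

lemma phi0_typing [simp]: "phi0 \<in> Arr" "src phi0 = \<I>" "tgt phi0 = rv \<I>"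
  using phi0_in by (simp_all add: circ.hom_iff)

lemma delta_typing [simp]:
  assumes "X \<in> Ob" "Y \<in> Ob" "Z \<in> Ob" "T \<in> Ob"
  shows "delta X Y Z T \<in> Arr" "src (delta X Y Z T) = X \<bullet> (Y \<odot> (rv Z \<bullet> T))"
    "tgt (delta X Y Z T) = ((X \<odot> Z) \<bullet> Y) \<odot> T"
  using delta_in[OF assms] by (simp_all add: circ.hom_iff)

lemma delta_natural:
  "\<lbrakk>f \<in> Arr; g \<in> Arr; h \<in> Arr; k \<in> Arr; tgt f = X; tgt g = Y; tgt h = Z; tgt k = T\<rbrakk>
    \<Longrightarrow> delta X Y Z T \<cdot> (f \<bullet> (g \<odot> (rv h \<bullet> k))) = (((f \<odot> h) \<bullet> g) \<odot> k) \<cdot> delta (src f) (src g) (src h) (src k)"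
  by (rule delta_nat) (auto simp: circ.hom_iff)

text \<open>The component \<open>\<Phi>\<^bsub>X,Y\<^esub>\<close> with an object \<open>B\<close> in place of \<open>I\<close>.\<close>

definition phi_at where "phi_at B X Y = delta X B Y \<J> \<cdot> (X \<bullet> (B \<odot> inv \<rr>\<^sub>\<bullet> (rv Y)))"

lemma phi_at_typing [simp]:
  assumes "B \<in> Ob" "X \<in> Ob" "Y \<in> Ob"
  shows "phi_at B X Y \<in> Arr" "src (phi_at B X Y) = X \<bullet> (B \<odot> rv Y)" "tgt (phi_at B X Y) = ((X \<odot> Y) \<bullet> B) \<odot> \<J>"
  using assms by (simp_all add: phi_at_def)

lemma phi_at_natural:
  assumes "f \<in> Arr" "g \<in> Arr" "h \<in> Arr" "tgt f = X" "tgt g = B" "tgt h = Y"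
  shows "phi_at B X Y \<cdot> (f \<bullet> (g \<odot> rv h)) = (((f \<odot> h) \<bullet> g) \<odot> \<J>) \<cdot> phi_at (src g) (src f) (src h)"
proof -
  have "phi_at B X Y \<cdot> (f \<bullet> (g \<odot> rv h)) = (delta X B Y \<J> \<cdot> (f \<bullet> (g \<odot> (rv h \<bullet> \<J>)))) \<cdot> (src f \<bullet> (src g \<odot> inv \<rr>\<^sub>\<bullet> (rv (src h))))"
    using assms by (auto simp: phi_at_def bul.inv_run_nat)
  also have "\<dots> = (((f \<odot> h) \<bullet> g) \<odot> \<J>) \<cdot> phi_at (src g) (src f) (src h)"
    using assms by (auto simp: delta_natural phi_at_def)
  finally show ?thesis .
qed

definition Phi where "Phi X Y = delta X \<I> Y \<J> \<cdot> (X \<bullet> (\<I> \<odot> inv \<rr>\<^sub>\<bullet> (rv Y))) \<cdot> (X \<bullet> inv \<ll>\<^sub>\<odot> (rv Y))"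

lemma Phi_phi_at: "\<lbrakk>X \<in> Ob; Y \<in> Ob\<rbrakk> \<Longrightarrow> Phi X Y = phi_at \<I> X Y \<cdot> (X \<bullet> inv \<ll>\<^sub>\<odot> (rv Y))"
  by (simp add: Phi_def phi_at_def)

lemma Phi_typing [simp]:
  assumes "X \<in> Ob" "Y \<in> Ob"
  shows "Phi X Y \<in> Arr" "src (Phi X Y) = X \<bullet> rv Y" "tgt (Phi X Y) = ((X \<odot> Y) \<bullet> \<I>) \<odot> \<J>"
  using assms by (simp_all add: Phi_phi_at)

lemma Phi_natural:
  assumes "f \<in> Arr" "h \<in> Arr" "tgt f = X" "tgt h = Y"
  shows "Phi X Y \<cdot> (f \<bullet> rv h) = (((f \<odot> h) \<bullet> \<I>) \<odot> \<J>) \<cdot> Phi (src f) (src h)"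
proof -
  have "Phi X Y \<cdot> (f \<bullet> rv h) = (phi_at \<I> X Y \<cdot> (f \<bullet> (\<I> \<odot> rv h))) \<cdot> (src f \<bullet> inv \<ll>\<^sub>\<odot> (rv (src h)))"
    using assms by (auto simp: Phi_phi_at circ.inv_lun_nat)
  also have "\<dots> = (((f \<odot> h) \<bullet> \<I>) \<odot> \<J>) \<cdot> Phi (src f) (src h)"
    using assms by (auto simp: phi_at_natural Phi_phi_at)
  finally show ?thesis .
qed

section \<open>How the components of \<open>delta\<close> decompose\<close>

lemma zeta_inv_runit:
  "\<lbrakk>X \<in> Ob; Y \<in> Ob\<rbrakk> \<Longrightarrow> ((X \<odot> Y) \<bullet> \<mm>\<^sub>J) \<cdot> \<zeta> X \<J> Y \<J> \<cdot> (inv \<rr>\<^sub>\<bullet> X \<odot> inv \<rr>\<^sub>\<bullet> Y) = inv \<rr>\<^sub>\<bullet> (X \<odot> Y)"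
proof -
  assume [simp]: "X \<in> Ob" "Y \<in> Ob"
  have "((X \<odot> Y) \<bullet> \<mm>\<^sub>J) \<cdot> \<zeta> X \<J> Y \<J> \<cdot> (inv \<rr>\<^sub>\<bullet> X \<odot> inv \<rr>\<^sub>\<bullet> Y)
      = inv \<rr>\<^sub>\<bullet> (X \<odot> Y) \<cdot> (\<rr>\<^sub>\<bullet> (X \<odot> Y) \<cdot> ((X \<odot> Y) \<bullet> \<mm>\<^sub>J) \<cdot> \<zeta> X \<J> Y \<J>) \<cdot> (inv \<rr>\<^sub>\<bullet> X \<odot> inv \<rr>\<^sub>\<bullet> Y)"
    by simp
  also have "\<dots> = inv \<rr>\<^sub>\<bullet> (X \<odot> Y)"
    by (subst zeta_bul_runit) simp_all
  finally show ?thesis .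
qed

text \<open>This is \<open>delta_delta\<close> with \<J> as the last argument of both components. It
  leaves two copies of \<J>, which \<open>\<mm>\<^sub>J\<close> multiplies, by naturality of
  \<open>delta\<close> on one side and \<open>zeta_inv_runit\<close> inside.\<close>

lemma phi_at_phi:
  assumes [simp]: "X \<in> Ob" "Y \<in> Ob" "Z \<in> Ob" "U \<in> Ob"
  shows "phi_at Y X (U \<odot> Z) \<cdot> (X \<bullet> (Y \<odot> phi Z U)) \<cdot> (X \<bullet> \<aa>\<^sub>\<odot> Y (rv Z) (rv U))
    = (((X \<odot> (U \<odot> Z)) \<bullet> Y) \<odot> \<mm>\<^sub>J) \<cdot> \<aa>\<^sub>\<odot> ((X \<odot> (U \<odot> Z)) \<bullet> Y) \<J> \<J> \<cdot> (((\<aa>\<^sub>\<odot> X U Z \<bullet> Y) \<odot> \<J>) \<odot> \<J>)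
      \<cdot> (phi_at Y (X \<odot> U) Z \<odot> \<J>) \<cdot> phi_at (Y \<odot> rv Z) X U"
proof -
  have d: "delta X (Y \<odot> (rv Z \<bullet> \<J>)) U \<J> \<cdot> (X \<bullet> ((Y \<odot> inv \<rr>\<^sub>\<bullet> (rv Z)) \<odot> (rv U \<bullet> \<J>)))
     = ((((X \<odot> U) \<bullet> (Y \<odot> inv \<rr>\<^sub>\<bullet> (rv Z))) \<odot> \<J>)) \<cdot> delta X (Y \<odot> rv Z) U \<J>"
    using delta_natural[of X "Y \<odot> inv \<rr>\<^sub>\<bullet> (rv Z)" U \<J>] by simp
  have d2: "delta X Y (U \<odot> Z) \<J> \<cdot> (X \<bullet> (Y \<odot> (rv (U \<odot> Z) \<bullet> \<mm>\<^sub>J))) = (((X \<odot> (U \<odot> Z)) \<bullet> Y) \<odot> \<mm>\<^sub>J) \<cdot> delta X Y (U \<odot> Z) (\<J> \<odot> \<J>)"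
    using delta_natural[of X Y "U \<odot> Z" \<mm>\<^sub>J] by simp
  have "(((X \<odot> (U \<odot> Z)) \<bullet> Y) \<odot> \<mm>\<^sub>J) \<cdot> \<aa>\<^sub>\<odot> ((X \<odot> (U \<odot> Z)) \<bullet> Y) \<J> \<J> \<cdot> (((\<aa>\<^sub>\<odot> X U Z \<bullet> Y) \<odot> \<J>) \<odot> \<J>)
      \<cdot> (phi_at Y (X \<odot> U) Z \<odot> \<J>) \<cdot> phi_at (Y \<odot> rv Z) X U
    = (((X \<odot> (U \<odot> Z)) \<bullet> Y) \<odot> \<mm>\<^sub>J) \<cdot> (\<aa>\<^sub>\<odot> ((X \<odot> (U \<odot> Z)) \<bullet> Y) \<J> \<J> \<cdot> (((\<aa>\<^sub>\<odot> X U Z \<bullet> Y) \<odot> \<J>) \<odot> \<J>)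
      \<cdot> (delta (X \<odot> U) Y Z \<J> \<odot> \<J>)) \<cdot> (((((X \<odot> U) \<bullet> (Y \<odot> inv \<rr>\<^sub>\<bullet> (rv Z))) \<odot> \<J>)) \<cdot> delta X (Y \<odot> rv Z) U \<J>)
      \<cdot> (X \<bullet> ((Y \<odot> rv Z) \<odot> inv \<rr>\<^sub>\<bullet> (rv U)))"
    by (simp add: phi_at_def)
  also have "\<dots> = (((X \<odot> (U \<odot> Z)) \<bullet> Y) \<odot> \<mm>\<^sub>J) \<cdot> (\<aa>\<^sub>\<odot> ((X \<odot> (U \<odot> Z)) \<bullet> Y) \<J> \<J> \<cdot> (((\<aa>\<^sub>\<odot> X U Z \<bullet> Y) \<odot> \<J>) \<odot> \<J>)
      \<cdot> (delta (X \<odot> U) Y Z \<J> \<odot> \<J>) \<cdot> delta X (Y \<odot> (rv Z \<bullet> \<J>)) U \<J>) \<cdot> (X \<bullet> ((Y \<odot> inv \<rr>\<^sub>\<bullet> (rv Z)) \<odot> inv \<rr>\<^sub>\<bullet> (rv U)))"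
    unfolding d[symmetric] by simp
  also have "\<dots> = ((((X \<odot> (U \<odot> Z)) \<bullet> Y) \<odot> \<mm>\<^sub>J) \<cdot> delta X Y (U \<odot> Z) (\<J> \<odot> \<J>)) \<cdot> (X \<bullet> (Y \<odot> (phi Z U \<bullet> (\<J> \<odot> \<J>))))
          \<cdot> (X \<bullet> (Y \<odot> \<zeta> (rv Z) \<J> (rv U) \<J>)) \<cdot> (X \<bullet> \<aa>\<^sub>\<odot> Y (rv Z \<bullet> \<J>) (rv U \<bullet> \<J>)) \<cdot> (X \<bullet> ((Y \<odot> inv \<rr>\<^sub>\<bullet> (rv Z)) \<odot> inv \<rr>\<^sub>\<bullet> (rv U)))"
    by (subst delta_delta) simp_all
  also have "\<dots> = delta X Y (U \<odot> Z) \<J> \<cdot> (X \<bullet> (Y \<odot> ((phi Z U \<bullet> \<J>) \<cdot> (((rv Z \<odot> rv U) \<bullet> \<mm>\<^sub>J) \<cdot> \<zeta> (rv Z) \<J> (rv U) \<J> \<cdot> (inv \<rr>\<^sub>\<bullet> (rv Z) \<odot> inv \<rr>\<^sub>\<bullet> (rv U)))))) \<cdot> (X \<bullet> \<aa>\<^sub>\<odot> Y (rv Z) (rv U))"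
    unfolding d2[symmetric] by (simp add: circ.nats)
  also have "\<dots> = phi_at Y X (U \<odot> Z) \<cdot> (X \<bullet> (Y \<odot> phi Z U)) \<cdot> (X \<bullet> \<aa>\<^sub>\<odot> Y (rv Z) (rv U))"
    by (subst zeta_inv_runit) (simp_all add: phi_at_def bul.inv_run_nat)
  finally show ?thesis by (rule sym)
qed

text \<open>The factor next to \<open>X\<close> is treated first, while \<open>rv Z\<close> waits in
  the slot that \<open>Phi\<close> reserves for \<open>\<I>\<close>. This is why
  \<open>phi_at\<close> admits an arbitrary object there.\<close>

lemma Phi_phi:
  assumes [simp]: "X \<in> Ob" "Z \<in> Ob" "U \<in> Ob"
  shows "Phi X (U \<odot> Z) \<cdot> (X \<bullet> phi Z U)
    = (((X \<odot> (U \<odot> Z)) \<bullet> \<I>) \<odot> \<mm>\<^sub>J) \<cdot> \<aa>\<^sub>\<odot> ((X \<odot> (U \<odot> Z)) \<bullet> \<I>) \<J> \<J> \<cdot> (((\<aa>\<^sub>\<odot> X U Z \<bullet> \<I>) \<odot> \<J>) \<odot> \<J>)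
      \<cdot> (Phi (X \<odot> U) Z \<odot> \<J>) \<cdot> phi_at (rv Z) X U"
proof -
  have n: "phi_at (\<I> \<odot> rv Z) X U \<cdot> (X \<bullet> (inv \<ll>\<^sub>\<odot> (rv Z) \<odot> rv U)) = (((X \<odot> U) \<bullet> inv \<ll>\<^sub>\<odot> (rv Z)) \<odot> \<J>) \<cdot> phi_at (rv Z) X U"
    using phi_at_natural[of X "inv \<ll>\<^sub>\<odot> (rv Z)" U] by simp
  have "Phi X (U \<odot> Z) \<cdot> (X \<bullet> phi Z U) = phi_at \<I> X (U \<odot> Z) \<cdot> (X \<bullet> (\<I> \<odot> phi Z U)) \<cdot> (X \<bullet> inv \<ll>\<^sub>\<odot> (rv Z \<odot> rv U))"
    by (simp add: Phi_phi_at circ.inv_lun_nat)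
  also have "\<dots> = (phi_at \<I> X (U \<odot> Z) \<cdot> (X \<bullet> (\<I> \<odot> phi Z U)) \<cdot> (X \<bullet> \<aa>\<^sub>\<odot> \<I> (rv Z) (rv U))) \<cdot> (X \<bullet> (inv \<ll>\<^sub>\<odot> (rv Z) \<odot> rv U))"
    by (simp flip: circ.inv_lun_tensor)
  also have "\<dots> = (((X \<odot> (U \<odot> Z)) \<bullet> \<I>) \<odot> \<mm>\<^sub>J) \<cdot> \<aa>\<^sub>\<odot> ((X \<odot> (U \<odot> Z)) \<bullet> \<I>) \<J> \<J> \<cdot> (((\<aa>\<^sub>\<odot> X U Z \<bullet> \<I>) \<odot> \<J>) \<odot> \<J>)
      \<cdot> (phi_at \<I> (X \<odot> U) Z \<odot> \<J>) \<cdot> (phi_at (\<I> \<odot> rv Z) X U \<cdot> (X \<bullet> (inv \<ll>\<^sub>\<odot> (rv Z) \<odot> rv U)))"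
    by (subst phi_at_phi) simp_all
  also have "\<dots> = (((X \<odot> (U \<odot> Z)) \<bullet> \<I>) \<odot> \<mm>\<^sub>J) \<cdot> \<aa>\<^sub>\<odot> ((X \<odot> (U \<odot> Z)) \<bullet> \<I>) \<J> \<J> \<cdot> (((\<aa>\<^sub>\<odot> X U Z \<bullet> \<I>) \<odot> \<J>) \<odot> \<J>)
      \<cdot> (Phi (X \<odot> U) Z \<odot> \<J>) \<cdot> phi_at (rv Z) X U"
    unfolding n by (simp add: Phi_phi_at)
  finally show ?thesis .
qed

text \<open>This is \<open>delta_zeta\<close> with \<open>T\<close> the unit, whose constraints are
  then removed. After \<open>\<zeta>\<close>, a component with any \<open>Y\<close> in the slot is
  reduced to one with \<open>\<I>\<close> there, which is where \<open>delta_I\<close> and the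
  antipode equations live.\<close>

lemma delta_zeta_I:
  assumes [simp]: "X \<in> Ob" "Y \<in> Ob" "Z \<in> Ob" "U \<in> Ob" "V \<in> Ob"
  shows "((\<aa>\<^sub>\<odot> X Z U \<bullet> Y) \<odot> V) \<cdot> delta (X \<odot> Z) Y U V \<cdot> \<zeta> X Y Z (rv U \<bullet> V)
    = ((((X \<odot> (Z \<odot> U)) \<bullet> \<rr>\<^sub>\<odot> Y) \<cdot> \<zeta> X Y (Z \<odot> U) \<I>) \<odot> V) \<cdot> inv \<aa>\<^sub>\<odot> (X \<bullet> Y) ((Z \<odot> U) \<bullet> \<I>) V
      \<cdot> ((X \<bullet> Y) \<odot> (delta Z \<I> U V \<cdot> (Z \<bullet> inv \<ll>\<^sub>\<odot> (rv U \<bullet> V))))"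
proof -
  have d: "delta (X \<odot> Z) (Y \<odot> \<I>) U V \<cdot> ((X \<odot> Z) \<bullet> (inv \<rr>\<^sub>\<odot> Y \<odot> (rv U \<bullet> V))) = ((((X \<odot> Z) \<odot> U) \<bullet> inv \<rr>\<^sub>\<odot> Y) \<odot> V) \<cdot> delta (X \<odot> Z) Y U V"
    using delta_natural[of "X \<odot> Z" "inv \<rr>\<^sub>\<odot> Y" U V] by simp
  have "((((X \<odot> (Z \<odot> U)) \<bullet> \<rr>\<^sub>\<odot> Y) \<cdot> \<zeta> X Y (Z \<odot> U) \<I>) \<odot> V) \<cdot> inv \<aa>\<^sub>\<odot> (X \<bullet> Y) ((Z \<odot> U) \<bullet> \<I>) V
      \<cdot> ((X \<bullet> Y) \<odot> (delta Z \<I> U V \<cdot> (Z \<bullet> inv \<ll>\<^sub>\<odot> (rv U \<bullet> V))))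
    = (((X \<odot> (Z \<odot> U)) \<bullet> \<rr>\<^sub>\<odot> Y) \<odot> V) \<cdot> ((\<zeta> X Y (Z \<odot> U) \<I> \<odot> V) \<cdot> inv \<aa>\<^sub>\<odot> (X \<bullet> Y) ((Z \<odot> U) \<bullet> \<I>) V
      \<cdot> ((X \<bullet> Y) \<odot> delta Z \<I> U V)) \<cdot> ((X \<bullet> Y) \<odot> (Z \<bullet> inv \<ll>\<^sub>\<odot> (rv U \<bullet> V)))"
    by simp
  also have "\<dots> = (((X \<odot> (Z \<odot> U)) \<bullet> \<rr>\<^sub>\<odot> Y) \<odot> V) \<cdot> (((\<aa>\<^sub>\<odot> X Z U \<bullet> (Y \<odot> \<I>)) \<odot> V) \<cdot> delta (X \<odot> Z) (Y \<odot> \<I>) U V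
          \<cdot> ((X \<odot> Z) \<bullet> inv \<aa>\<^sub>\<odot> Y \<I> (rv U \<bullet> V)) \<cdot> \<zeta> X Y Z (\<I> \<odot> (rv U \<bullet> V))) \<cdot> ((X \<bullet> Y) \<odot> (Z \<bullet> inv \<ll>\<^sub>\<odot> (rv U \<bullet> V)))"
    by (subst delta_zeta) simp_all
  also have "\<dots> = ((\<aa>\<^sub>\<odot> X Z U \<bullet> \<rr>\<^sub>\<odot> Y) \<odot> V) \<cdot> (delta (X \<odot> Z) (Y \<odot> \<I>) U V
          \<cdot> ((X \<odot> Z) \<bullet> (inv \<aa>\<^sub>\<odot> Y \<I> (rv U \<bullet> V) \<cdot> (Y \<odot> inv \<ll>\<^sub>\<odot> (rv U \<bullet> V))))) \<cdot> \<zeta> X Y Z (rv U \<bullet> V)"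
    by (simp add: zeta_nats)
  also have "\<dots> = ((\<aa>\<^sub>\<odot> X Z U \<bullet> Y) \<odot> V) \<cdot> delta (X \<odot> Z) Y U V \<cdot> \<zeta> X Y Z (rv U \<bullet> V)"
    unfolding circ.triangle_inv[OF assms(2) bul.tensor_ob[OF rv_ob[OF assms(4)] assms(5)]] d
    by simp
  finally show ?thesis by (rule sym)
qed

lemma zeta_inv_circ_runit:
  assumes [simp]: "X \<in> Ob" "Y \<in> Ob"
  shows "\<zeta> X Y \<I> \<I> \<cdot> ((X \<bullet> Y) \<odot> \<Delta>\<^sub>I) = (inv \<rr>\<^sub>\<odot> X \<bullet> inv \<rr>\<^sub>\<odot> Y) \<cdot> \<rr>\<^sub>\<odot> (X \<bullet> Y)"
proof -
  have "\<zeta> X Y \<I> \<I> \<cdot> ((X \<bullet> Y) \<odot> \<Delta>\<^sub>I) = (inv \<rr>\<^sub>\<odot> X \<bullet> inv \<rr>\<^sub>\<odot> Y) \<cdot> ((\<rr>\<^sub>\<odot> X \<bullet> \<rr>\<^sub>\<odot> Y) \<cdot> \<zeta> X Y \<I> \<I> \<cdot> ((X \<bullet> Y) \<odot> \<Delta>\<^sub>I))"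
    by simp
  also have "\<dots> = (inv \<rr>\<^sub>\<odot> X \<bullet> inv \<rr>\<^sub>\<odot> Y) \<cdot> \<rr>\<^sub>\<odot> (X \<bullet> Y)"
    by (subst zeta_circ_runit) simp_all
  finally show ?thesis .
qed

text \<open>\<open>delta_I\<close> concerns units only and is carried to all \<open>X\<close>,
  \<open>Y\<close> by \<open>delta_zeta_I\<close>. The \<zeta> involved occurs only after
  \<open>\<Delta>\<^sub>I\<close>; by \<open>zeta_inv_circ_runit\<close> that composite is
  invertible, so it can be cancelled.\<close>

lemma delta_unit:
  assumes [simp]: "X \<in> Ob" "Y \<in> Ob"
  shows "delta X Y \<I> \<I> \<cdot> (X \<bullet> ((Y \<odot> ((phi0 \<bullet> \<I>) \<cdot> \<Delta>\<^sub>I)) \<cdot> inv \<rr>\<^sub>\<odot> Y)) = ((inv \<rr>\<^sub>\<odot> X \<bullet> Y) \<odot> \<I>) \<cdot> inv \<rr>\<^sub>\<odot> (X \<bullet> Y)"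
proof -
  define t where "t = (phi0 \<bullet> \<I>) \<cdot> \<Delta>\<^sub>I"
  have [simp]: "t \<in> Arr" "src t = \<I>" "tgt t = rv \<I> \<bullet> \<I>"
    by (simp_all add: t_def)
  have d: "delta (X \<odot> \<I>) Y \<I> \<I> \<cdot> (inv \<rr>\<^sub>\<odot> X \<bullet> (Y \<odot> (rv \<I> \<bullet> \<I>))) = ((((inv \<rr>\<^sub>\<odot> X \<odot> \<I>) \<bullet> Y) \<odot> \<I>)) \<cdot> delta X Y \<I> \<I>"
    using delta_natural[of "inv \<rr>\<^sub>\<odot> X" Y \<I> \<I>] by simp
  have r: "(\<rr>\<^sub>\<odot> (X \<bullet> Y) \<odot> \<I>) \<cdot> inv \<rr>\<^sub>\<odot> ((X \<bullet> Y) \<odot> \<I>) = (X \<bullet> Y) \<odot> \<I>"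
    using circ.inv_run_nat[of "\<rr>\<^sub>\<odot> (X \<bullet> Y)" "X \<bullet> Y"] by simp
  have R7: "delta \<I> \<I> \<I> \<I> \<cdot> (\<I> \<bullet> (\<I> \<odot> t)) = ((inv \<rr>\<^sub>\<odot> \<I> \<bullet> \<I>) \<odot> \<I>) \<cdot> inv \<rr>\<^sub>\<odot> (\<I> \<bullet> \<I>) \<cdot> (\<I> \<bullet> \<rr>\<^sub>\<odot> \<I>)"
  proof -
    have "delta \<I> \<I> \<I> \<I> \<cdot> (\<I> \<bullet> (\<I> \<odot> t)) = ((inv \<rr>\<^sub>\<odot> \<I> \<bullet> \<I>) \<odot> \<I>) \<cdot> inv \<rr>\<^sub>\<odot> (\<I> \<bullet> \<I>)
      \<cdot> (\<rr>\<^sub>\<odot> (\<I> \<bullet> \<I>) \<cdot> ((\<rr>\<^sub>\<odot> \<I> \<bullet> \<I>) \<odot> \<I>) \<cdot> delta \<I> \<I> \<I> \<I> \<cdot> (\<I> \<bullet> (\<I> \<odot> ((phi0 \<bullet> \<I>) \<cdot> \<Delta>\<^sub>I))))"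
      by (simp add: t_def)
    then show ?thesis
      by (simp only: delta_I)
  qed
  have inner: "delta \<I> \<I> \<I> \<I> \<cdot> (\<I> \<bullet> inv \<ll>\<^sub>\<odot> (rv \<I> \<bullet> \<I>)) \<cdot> (\<I> \<bullet> t) \<cdot> \<Delta>\<^sub>I
     = ((inv \<rr>\<^sub>\<odot> \<I> \<bullet> \<I>) \<odot> \<I>) \<cdot> (\<Delta>\<^sub>I \<odot> \<I>) \<cdot> inv \<rr>\<^sub>\<odot> \<I>"
  proof -
    have "delta \<I> \<I> \<I> \<I> \<cdot> (\<I> \<bullet> inv \<ll>\<^sub>\<odot> (rv \<I> \<bullet> \<I>)) \<cdot> (\<I> \<bullet> t) \<cdot> \<Delta>\<^sub>I
      = (delta \<I> \<I> \<I> \<I> \<cdot> (\<I> \<bullet> (\<I> \<odot> t))) \<cdot> (\<I> \<bullet> inv \<ll>\<^sub>\<odot> \<I>) \<cdot> \<Delta>\<^sub>I"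
      by (simp add: circ.inv_lun_nat)
    also have "\<dots> = ((inv \<rr>\<^sub>\<odot> \<I> \<bullet> \<I>) \<odot> \<I>) \<cdot> inv \<rr>\<^sub>\<odot> (\<I> \<bullet> \<I>) \<cdot> \<Delta>\<^sub>I"
      unfolding R7 by (simp add: circ.lun_unt)
    finally show ?thesis
      by (simp add: circ.inv_run_nat)
  qed
  have "((\<aa>\<^sub>\<odot> X \<I> \<I> \<bullet> Y) \<odot> \<I>) \<cdot> (delta (X \<odot> \<I>) Y \<I> \<I> \<cdot> (inv \<rr>\<^sub>\<odot> X \<bullet> (Y \<odot> (rv \<I> \<bullet> \<I>)))) \<cdot> (X \<bullet> ((Y \<odot> t) \<cdot> inv \<rr>\<^sub>\<odot> Y)) \<cdot> \<rr>\<^sub>\<odot> (X \<bullet> Y)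
    = ((\<aa>\<^sub>\<odot> X \<I> \<I> \<bullet> Y) \<odot> \<I>) \<cdot> delta (X \<odot> \<I>) Y \<I> \<I> \<cdot> ((X \<odot> \<I>) \<bullet> (Y \<odot> t)) \<cdot> ((inv \<rr>\<^sub>\<odot> X \<bullet> inv \<rr>\<^sub>\<odot> Y) \<cdot> \<rr>\<^sub>\<odot> (X \<bullet> Y))"
    by simp
  \<comment> \<open>The pair of inverse unit constraints is read backwards as \<open>\<zeta>\<close>
    after \<open>\<Delta>\<^sub>I\<close>, which creates the \<open>\<zeta>\<close> that
    \<open>delta_zeta_I\<close> needs.\<close>
  also have "\<dots> = (((\<aa>\<^sub>\<odot> X \<I> \<I> \<bullet> Y) \<odot> \<I>) \<cdot> delta (X \<odot> \<I>) Y \<I> \<I> \<cdot> \<zeta> X Y \<I> (rv \<I> \<bullet> \<I>)) \<cdot> ((X \<bullet> Y) \<odot> ((\<I> \<bullet> t) \<cdot> \<Delta>\<^sub>I))"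
    unfolding zeta_inv_circ_runit[OF assms, symmetric] by (simp add: zeta_nats)
  also have "\<dots> = (((X \<odot> (\<I> \<odot> \<I>)) \<bullet> \<rr>\<^sub>\<odot> Y) \<odot> \<I>) \<cdot> (\<zeta> X Y (\<I> \<odot> \<I>) \<I> \<odot> \<I>) \<cdot> inv \<aa>\<^sub>\<odot> (X \<bullet> Y) ((\<I> \<odot> \<I>) \<bullet> \<I>) \<I>
      \<cdot> ((X \<bullet> Y) \<odot> (delta \<I> \<I> \<I> \<I> \<cdot> (\<I> \<bullet> inv \<ll>\<^sub>\<odot> (rv \<I> \<bullet> \<I>)) \<cdot> (\<I> \<bullet> t) \<cdot> \<Delta>\<^sub>I))"
    by (subst delta_zeta_I) simp_all
  also have "\<dots> = (((X \<odot> inv \<rr>\<^sub>\<odot> \<I>) \<bullet> \<rr>\<^sub>\<odot> Y) \<odot> \<I>) \<cdot> ((\<zeta> X Y \<I> \<I> \<cdot> ((X \<bullet> Y) \<odot> \<Delta>\<^sub>I)) \<odot> \<I>) \<cdot> (inv \<aa>\<^sub>\<odot> (X \<bullet> Y) \<I> \<I> \<cdot> ((X \<bullet> Y) \<odot> inv \<rr>\<^sub>\<odot> \<I>))"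
    unfolding inner by (simp add: circ.nats zeta_nats)
  also have "\<dots> = ((((X \<odot> inv \<rr>\<^sub>\<odot> \<I>) \<cdot> inv \<rr>\<^sub>\<odot> X) \<bullet> Y) \<odot> \<I>) \<cdot> ((\<rr>\<^sub>\<odot> (X \<bullet> Y) \<odot> \<I>) \<cdot> inv \<rr>\<^sub>\<odot> ((X \<bullet> Y) \<odot> \<I>))"
    unfolding zeta_inv_circ_runit[OF assms] circ.inv_run_tensor[OF bul.tensor_ob[OF assms] circ.unt_ob] by simp
  also have "\<dots> = (((X \<odot> inv \<rr>\<^sub>\<odot> \<I>) \<bullet> Y) \<odot> \<I>) \<cdot> (((inv \<rr>\<^sub>\<odot> X \<bullet> Y) \<odot> \<I>) \<cdot> inv \<rr>\<^sub>\<odot> (X \<bullet> Y)) \<cdot> \<rr>\<^sub>\<odot> (X \<bullet> Y)"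
    unfolding r by simp
  finally have *: "((\<aa>\<^sub>\<odot> X \<I> \<I> \<bullet> Y) \<odot> \<I>) \<cdot> (delta (X \<odot> \<I>) Y \<I> \<I> \<cdot> (inv \<rr>\<^sub>\<odot> X \<bullet> (Y \<odot> (rv \<I> \<bullet> \<I>)))) \<cdot> (X \<bullet> ((Y \<odot> t) \<cdot> inv \<rr>\<^sub>\<odot> Y)) \<cdot> \<rr>\<^sub>\<odot> (X \<bullet> Y)
    = (((X \<odot> inv \<rr>\<^sub>\<odot> \<I>) \<bullet> Y) \<odot> \<I>) \<cdot> (((inv \<rr>\<^sub>\<odot> X \<bullet> Y) \<odot> \<I>) \<cdot> inv \<rr>\<^sub>\<odot> (X \<bullet> Y)) \<cdot> \<rr>\<^sub>\<odot> (X \<bullet> Y)" .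
  have a: "\<aa>\<^sub>\<odot> X \<I> \<I> \<cdot> (inv \<rr>\<^sub>\<odot> X \<odot> \<I>) = X \<odot> inv \<rr>\<^sub>\<odot> \<I>"
    by (simp add: circ.lun_unt flip: circ.triangle_inv)
  have "(((\<aa>\<^sub>\<odot> X \<I> \<I> \<cdot> (inv \<rr>\<^sub>\<odot> X \<odot> \<I>)) \<bullet> Y) \<odot> \<I>) \<cdot> (delta X Y \<I> \<I> \<cdot> (X \<bullet> ((Y \<odot> t) \<cdot> inv \<rr>\<^sub>\<odot> Y))) \<cdot> \<rr>\<^sub>\<odot> (X \<bullet> Y)
    = (((X \<odot> inv \<rr>\<^sub>\<odot> \<I>) \<bullet> Y) \<odot> \<I>) \<cdot> (((inv \<rr>\<^sub>\<odot> X \<bullet> Y) \<odot> \<I>) \<cdot> inv \<rr>\<^sub>\<odot> (X \<bullet> Y)) \<cdot> \<rr>\<^sub>\<odot> (X \<bullet> Y)"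
    using * unfolding d by simp
  then have "((((X \<odot> inv \<rr>\<^sub>\<odot> \<I>) \<bullet> Y) \<odot> \<I>) \<cdot> (delta X Y \<I> \<I> \<cdot> (X \<bullet> ((Y \<odot> t) \<cdot> inv \<rr>\<^sub>\<odot> Y)))) \<cdot> \<rr>\<^sub>\<odot> (X \<bullet> Y)
    = ((((X \<odot> inv \<rr>\<^sub>\<odot> \<I>) \<bullet> Y) \<odot> \<I>) \<cdot> (((inv \<rr>\<^sub>\<odot> X \<bullet> Y) \<odot> \<I>) \<cdot> inv \<rr>\<^sub>\<odot> (X \<bullet> Y))) \<cdot> \<rr>\<^sub>\<odot> (X \<bullet> Y)"
    unfolding a by simp
  then have "(((X \<odot> inv \<rr>\<^sub>\<odot> \<I>) \<bullet> Y) \<odot> \<I>) \<cdot> (delta X Y \<I> \<I> \<cdot> (X \<bullet> ((Y \<odot> t) \<cdot> inv \<rr>\<^sub>\<odot> Y)))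
    = (((X \<odot> inv \<rr>\<^sub>\<odot> \<I>) \<bullet> Y) \<odot> \<I>) \<cdot> (((inv \<rr>\<^sub>\<odot> X \<bullet> Y) \<odot> \<I>) \<cdot> inv \<rr>\<^sub>\<odot> (X \<bullet> Y))"
    by (rule circ.iso_cancel_right) simp_all
  then have "delta X Y \<I> \<I> \<cdot> (X \<bullet> ((Y \<odot> t) \<cdot> inv \<rr>\<^sub>\<odot> Y)) = ((inv \<rr>\<^sub>\<odot> X \<bullet> Y) \<odot> \<I>) \<cdot> inv \<rr>\<^sub>\<odot> (X \<bullet> Y)"
    by (rule circ.iso_cancel_left[rotated]) simp_all
  then show ?thesis
    unfolding t_def .
qed

text \<open>The \<Phi> equation of \<open>antipode\<close> together with the typing of the data. In
  the reversed category the same predicate expresses the \<Psi> equation.\<close>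

definition right_antipode :: "'a \<Rightarrow> 'a \<Rightarrow> 'a \<Rightarrow> 'a \<Rightarrow> 'a \<Rightarrow> 'a \<Rightarrow> bool"
  where "right_antipode H m u d e S \<longleftrightarrow>
    H \<in> Ob \<and> m \<in> Hom (H \<odot> H) H \<and> u \<in> Hom \<I> H \<and> d \<in> Hom H (H \<bullet> H) \<and> e \<in> Hom H \<J> \<and> S \<in> Hom H (rv H) \<and>
    ((m \<bullet> \<I>) \<odot> \<J>) \<cdot> Phi H H \<cdot> (H \<bullet> S) \<cdot> d = ((u \<bullet> \<I>) \<odot> \<J>) \<cdot> (\<Delta>\<^sub>I \<odot> \<J>) \<cdot> inv \<ll>\<^sub>\<odot> \<J> \<cdot> e"

lemma right_antipodeD:
  assumes "right_antipode H m u d e S"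
  shows "H \<in> Ob" "m \<in> Arr" "src m = H \<odot> H" "tgt m = H" "u \<in> Arr" "src u = \<I>" "tgt u = H"
    "d \<in> Arr" "src d = H" "tgt d = H \<bullet> H" "e \<in> Arr" "src e = H" "tgt e = \<J>" "S \<in> Arr" "src S = H" "tgt S = rv H"
    "((m \<bullet> \<I>) \<odot> \<J>) \<cdot> Phi H H \<cdot> (H \<bullet> S) \<cdot> d = ((u \<bullet> \<I>) \<odot> \<J>) \<cdot> (\<Delta>\<^sub>I \<odot> \<J>) \<cdot> inv \<ll>\<^sub>\<odot> \<J> \<cdot> e"
  using assms by (simp_all add: right_antipode_def circ.hom_iff)

text \<open>The antipode equation of \<open>H\<close> applied inside a larger expression:
  \<open>delta_zeta_I\<close> exposes \<open>Phi H H\<close>, the equation replaces it by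
  \<open>u\<close>, \<open>\<Delta>\<^sub>I\<close> and \<open>e\<close>, and the surrounding
  \<open>\<zeta>\<close> absorbs \<open>\<Delta>\<^sub>I\<close>.\<close>

lemma phi_at_antipode:
  assumes "right_antipode H m u d e S" and [simp]: "X \<in> Ob" "Y \<in> Ob"
  shows "((((X \<odot> m) \<cdot> \<aa>\<^sub>\<odot> X H H) \<bullet> Y) \<odot> \<J>) \<cdot> phi_at Y (X \<odot> H) H \<cdot> \<zeta> X Y H (rv H) \<cdot> ((X \<bullet> Y) \<odot> ((H \<bullet> S) \<cdot> d))
    = (((X \<odot> u) \<cdot> inv \<rr>\<^sub>\<odot> X) \<bullet> Y) \<odot> e"
proof -
  note H = right_antipodeD[OF assms(1)]
  note [simp] = H(1-16)
  have "((((X \<odot> m) \<cdot> \<aa>\<^sub>\<odot> X H H) \<bullet> Y) \<odot> \<J>) \<cdot> phi_at Y (X \<odot> H) H \<cdot> \<zeta> X Y H (rv H) \<cdot> ((X \<bullet> Y) \<odot> ((H \<bullet> S) \<cdot> d))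
    = (((X \<odot> m) \<bullet> Y) \<odot> \<J>) \<cdot> (((\<aa>\<^sub>\<odot> X H H \<bullet> Y) \<odot> \<J>) \<cdot> delta (X \<odot> H) Y H \<J> \<cdot> \<zeta> X Y H (rv H \<bullet> \<J>))
      \<cdot> ((X \<bullet> Y) \<odot> ((H \<bullet> (inv \<rr>\<^sub>\<bullet> (rv H) \<cdot> S)) \<cdot> d))"
    by (simp add: phi_at_def zeta_nats)
  also have "\<dots> = (((X \<odot> m) \<bullet> Y) \<odot> \<J>) \<cdot> ((((X \<odot> (H \<odot> H)) \<bullet> \<rr>\<^sub>\<odot> Y) \<cdot> \<zeta> X Y (H \<odot> H) \<I>) \<odot> \<J>) \<cdot> inv \<aa>\<^sub>\<odot> (X \<bullet> Y) ((H \<odot> H) \<bullet> \<I>) \<J>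
      \<cdot> ((X \<bullet> Y) \<odot> (Phi H H \<cdot> (H \<bullet> S) \<cdot> d))"
    by (subst delta_zeta_I) (simp_all add: Phi_def circ.inv_lun_nat)
  also have "\<dots> = ((((X \<odot> H) \<bullet> \<rr>\<^sub>\<odot> Y) \<cdot> \<zeta> X Y H \<I>) \<odot> \<J>) \<cdot> inv \<aa>\<^sub>\<odot> (X \<bullet> Y) (H \<bullet> \<I>) \<J>
      \<cdot> ((X \<bullet> Y) \<odot> (((m \<bullet> \<I>) \<odot> \<J>) \<cdot> Phi H H \<cdot> (H \<bullet> S) \<cdot> d))"
    by (simp add: circ.nats zeta_nats)
  also have "\<dots> = ((((X \<odot> u) \<bullet> \<rr>\<^sub>\<odot> Y) \<cdot> (\<zeta> X Y \<I> \<I> \<cdot> ((X \<bullet> Y) \<odot> \<Delta>\<^sub>I))) \<odot> \<J>) \<cdot> (inv \<aa>\<^sub>\<odot> (X \<bullet> Y) \<I> \<J>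
      \<cdot> ((X \<bullet> Y) \<odot> inv \<ll>\<^sub>\<odot> \<J>)) \<cdot> ((X \<bullet> Y) \<odot> e)"
    unfolding H(17) by (simp add: circ.nats zeta_nats)
  also have "\<dots> = (((X \<odot> u) \<cdot> inv \<rr>\<^sub>\<odot> X) \<bullet> Y) \<odot> e"
    unfolding zeta_inv_circ_runit[OF assms(2,3)] by (subst circ.triangle_inv) simp_all
  finally show ?thesis .
qed

text \<open>The product and the action enter only through \<open>m_psi\<close> and
  \<open>q_u\<close>, so that one computation serves twice: with the right action of
  \<open>K\<close> here, and with the left action of \<open>H\<close> in the reversed
  category.\<close>

lemma right_antipode_circ:
  assumes H: "right_antipode H m\<^sub>H u\<^sub>H d\<^sub>H e\<^sub>H S\<^sub>H" and K: "right_antipode K m\<^sub>K u\<^sub>K d\<^sub>K e\<^sub>K S\<^sub>K"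
    and psi: "psi \<in> Hom (H \<odot> K) (K \<odot> H)"
    and m: "m \<in> Hom ((K \<odot> H) \<odot> (K \<odot> H)) (K \<odot> H)" and q: "q \<in> Hom ((K \<odot> H) \<odot> K) (K \<odot> H)"
    and m_psi: "m \<cdot> ((K \<odot> H) \<odot> psi) \<cdot> \<aa>\<^sub>\<odot> (K \<odot> H) H K = q \<cdot> (((K \<odot> m\<^sub>H) \<cdot> \<aa>\<^sub>\<odot> K H H) \<odot> K)"
    and q_u: "q \<cdot> (((K \<odot> u\<^sub>H) \<cdot> inv \<rr>\<^sub>\<odot> K) \<odot> K) = (K \<odot> u\<^sub>H) \<cdot> inv \<rr>\<^sub>\<odot> K \<cdot> m\<^sub>K"
  shows "right_antipode (K \<odot> H) m ((K \<odot> u\<^sub>H) \<cdot> inv \<rr>\<^sub>\<odot> K \<cdot> u\<^sub>K) (\<zeta> K K H H \<cdot> (d\<^sub>K \<odot> d\<^sub>H)) (\<mm>\<^sub>J \<cdot> (e\<^sub>K \<odot> e\<^sub>H))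
    (rv psi \<cdot> phi K H \<cdot> (S\<^sub>K \<odot> S\<^sub>H))"
proof -
  note h = right_antipodeD[OF H] and k = right_antipodeD[OF K]
  note [simp] = h(1-16) k(1-16) circ.homD[OF psi] circ.homD[OF m] circ.homD[OF q]
  define w where "w = (K \<odot> u\<^sub>H) \<cdot> inv \<rr>\<^sub>\<odot> K"
  have [simp]: "w \<in> Arr" "src w = K" "tgt w = K \<odot> H"
    by (simp_all add: w_def)
  define A where "A = K \<odot> H"
  \<comment> \<open>\<open>F\<close> collects everything that concerns \<open>H\<close>. Replacing
    it by the embedding \<open>w\<close> of \<open>K\<close> and the counit is the step h1 S(h2) =
    \<epsilon>(h).\<close>
  define F where "F = ((((K \<odot> m\<^sub>H) \<cdot> \<aa>\<^sub>\<odot> K H H) \<bullet> rv K) \<odot> \<J>) \<cdot> phi_at (rv K) (K \<odot> H) H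
     \<cdot> \<zeta> K (rv K) H (rv H) \<cdot> ((K \<bullet> rv K) \<odot> ((H \<bullet> S\<^sub>H) \<cdot> d\<^sub>H))"
  have F: "F = (w \<bullet> rv K) \<odot> e\<^sub>H"
    unfolding F_def w_def by (rule phi_at_antipode[OF H]) simp_all
  \<comment> \<open>Naturality turns the reversed \<open>psi\<close> in the antipode into
    \<open>psi\<close> itself, standing directly before the product.\<close>
  have P: "Phi A A \<cdot> (A \<bullet> rv psi) = (((A \<odot> psi) \<bullet> \<I>) \<odot> \<J>) \<cdot> Phi A (H \<odot> K)"
    using Phi_natural[of A psi] by (simp add: A_def)
  define f where "f = (K \<odot> m\<^sub>H) \<cdot> \<aa>\<^sub>\<odot> K H H"
  have [simp]: "f \<in> Arr" "src f = A \<odot> H" "tgt f = A"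
    by (simp_all add: f_def A_def)
  have [simp]: "A \<in> Ob" "src m = A \<odot> A" "tgt m = A" "src q = A \<odot> K" "tgt q = A"
    by (simp_all add: A_def)
  have f: "(((f \<odot> K) \<bullet> \<I>) \<odot> \<J>) \<cdot> Phi (A \<odot> H) K = Phi A K \<cdot> (f \<bullet> rv K)"
    using Phi_natural[of f K A K] by simp
  have w: "(((w \<odot> K) \<bullet> \<I>) \<odot> \<J>) \<cdot> Phi K K = Phi A K \<cdot> (w \<bullet> rv K)"
    using Phi_natural[of w K A K] by (simp add: A_def)
  have z: "((K \<odot> H) \<bullet> (S\<^sub>K \<odot> S\<^sub>H)) \<cdot> \<zeta> K K H H = \<zeta> K (rv K) H (rv H) \<cdot> ((K \<bullet> S\<^sub>K) \<odot> (H \<bullet> S\<^sub>H))"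
    by (simp add: zeta_natural)
  have "((m \<bullet> \<I>) \<odot> \<J>) \<cdot> Phi A A \<cdot> (A \<bullet> (rv psi \<cdot> phi K H \<cdot> (S\<^sub>K \<odot> S\<^sub>H))) \<cdot> (\<zeta> K K H H \<cdot> (d\<^sub>K \<odot> d\<^sub>H))
    = ((m \<bullet> \<I>) \<odot> \<J>) \<cdot> (Phi A A \<cdot> (A \<bullet> rv psi)) \<cdot> (A \<bullet> phi K H) \<cdot> (A \<bullet> (S\<^sub>K \<odot> S\<^sub>H)) \<cdot> (\<zeta> K K H H \<cdot> (d\<^sub>K \<odot> d\<^sub>H))"
    by (simp add: A_def)
  also have "\<dots> = (((m \<cdot> (A \<odot> psi)) \<bullet> \<I>) \<odot> \<J>) \<cdot> (Phi A (H \<odot> K) \<cdot> (A \<bullet> phi K H)) \<cdot> (A \<bullet> (S\<^sub>K \<odot> S\<^sub>H)) \<cdot> (\<zeta> K K H H \<cdot> (d\<^sub>K \<odot> d\<^sub>H))"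
    unfolding P by (simp add: A_def)
  also have "\<dots> = (((m \<cdot> (A \<odot> psi) \<cdot> \<aa>\<^sub>\<odot> A H K) \<bullet> \<I>) \<odot> \<mm>\<^sub>J) \<cdot> \<aa>\<^sub>\<odot> (((A \<odot> H) \<odot> K) \<bullet> \<I>) \<J> \<J>
      \<cdot> (Phi (A \<odot> H) K \<odot> \<J>) \<cdot> phi_at (rv K) A H \<cdot> (A \<bullet> (S\<^sub>K \<odot> S\<^sub>H)) \<cdot> (\<zeta> K K H H \<cdot> (d\<^sub>K \<odot> d\<^sub>H))"
    by (subst Phi_phi) (simp_all add: A_def circ.nats)
  \<comment> \<open>By \<open>m_psi\<close> the two copies of \<open>H\<close> are multiplied first.
    Naturality, in the form \<open>f\<close>, then moves this product in front of
    \<open>Phi\<close>, next to the antipode of \<open>H\<close>.\<close>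
  also have "\<dots> = ((q \<bullet> \<I>) \<odot> \<mm>\<^sub>J) \<cdot> \<aa>\<^sub>\<odot> ((A \<odot> K) \<bullet> \<I>) \<J> \<J> \<cdot> (((((f \<odot> K) \<bullet> \<I>) \<odot> \<J>) \<cdot> Phi (A \<odot> H) K) \<odot> \<J>)
      \<cdot> phi_at (rv K) A H \<cdot> (A \<bullet> (S\<^sub>K \<odot> S\<^sub>H)) \<cdot> (\<zeta> K K H H \<cdot> (d\<^sub>K \<odot> d\<^sub>H))"
    using m_psi by (simp add: A_def f_def circ.nats)
  also have "\<dots> = ((q \<bullet> \<I>) \<odot> \<mm>\<^sub>J) \<cdot> \<aa>\<^sub>\<odot> ((A \<odot> K) \<bullet> \<I>) \<J> \<J> \<cdot> (Phi A K \<odot> \<J>) \<cdot> F \<cdot> (((K \<bullet> S\<^sub>K) \<cdot> d\<^sub>K) \<odot> H)"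
    unfolding f using arg_cong[OF z, of "\<lambda>x. x \<cdot> (d\<^sub>K \<odot> d\<^sub>H)"] by (simp add: F_def f_def A_def)
  also have "\<dots> = ((q \<bullet> \<I>) \<odot> \<mm>\<^sub>J) \<cdot> \<aa>\<^sub>\<odot> ((A \<odot> K) \<bullet> \<I>) \<J> \<J> \<cdot> ((Phi A K \<cdot> (w \<bullet> rv K)) \<odot> \<J>) \<cdot> (((K \<bullet> S\<^sub>K) \<cdot> d\<^sub>K) \<odot> e\<^sub>H)"
    unfolding F by (simp add: A_def)
  also have "\<dots> = ((q \<bullet> \<I>) \<odot> \<mm>\<^sub>J) \<cdot> (\<aa>\<^sub>\<odot> ((A \<odot> K) \<bullet> \<I>) \<J> \<J> \<cdot> ((((w \<odot> K) \<bullet> \<I>) \<odot> \<J>) \<odot> \<J>)) \<cdot> ((Phi K K \<cdot> (K \<bullet> S\<^sub>K) \<cdot> d\<^sub>K) \<odot> e\<^sub>H)"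
    unfolding w[symmetric] by (simp add: A_def)
  also have "\<dots> = (((q \<cdot> (w \<odot> K)) \<bullet> \<I>) \<odot> \<mm>\<^sub>J) \<cdot> \<aa>\<^sub>\<odot> ((K \<odot> K) \<bullet> \<I>) \<J> \<J> \<cdot> ((Phi K K \<cdot> (K \<bullet> S\<^sub>K) \<cdot> d\<^sub>K) \<odot> e\<^sub>H)"
    by (subst circ.asc_nat) (simp_all add: A_def)
  \<comment> \<open>By \<open>q_u\<close> the embedding \<open>w\<close> is compatible with
    multiplication by \<open>K\<close>, so what is left is the antipode equation of
    \<open>K\<close>.\<close>
  also have "\<dots> = ((w \<bullet> \<I>) \<odot> \<mm>\<^sub>J) \<cdot> (((m\<^sub>K \<bullet> \<I>) \<odot> (\<J> \<odot> \<J>)) \<cdot> \<aa>\<^sub>\<odot> ((K \<odot> K) \<bullet> \<I>) \<J> \<J>) \<cdot> ((Phi K K \<cdot> (K \<bullet> S\<^sub>K) \<cdot> d\<^sub>K) \<odot> e\<^sub>H)"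
    using q_u by (simp add: A_def w_def)
  also have "((m\<^sub>K \<bullet> \<I>) \<odot> (\<J> \<odot> \<J>)) \<cdot> \<aa>\<^sub>\<odot> ((K \<odot> K) \<bullet> \<I>) \<J> \<J> = \<aa>\<^sub>\<odot> (K \<bullet> \<I>) \<J> \<J> \<cdot> (((m\<^sub>K \<bullet> \<I>) \<odot> \<J>) \<odot> \<J>)"
    by (simp add: circ.asc_nat)
  also have "((w \<bullet> \<I>) \<odot> \<mm>\<^sub>J) \<cdot> (\<aa>\<^sub>\<odot> (K \<bullet> \<I>) \<J> \<J> \<cdot> (((m\<^sub>K \<bullet> \<I>) \<odot> \<J>) \<odot> \<J>)) \<cdot> ((Phi K K \<cdot> (K \<bullet> S\<^sub>K) \<cdot> d\<^sub>K) \<odot> e\<^sub>H)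
      = ((w \<bullet> \<I>) \<odot> \<mm>\<^sub>J) \<cdot> \<aa>\<^sub>\<odot> (K \<bullet> \<I>) \<J> \<J> \<cdot> ((((m\<^sub>K \<bullet> \<I>) \<odot> \<J>) \<cdot> Phi K K \<cdot> (K \<bullet> S\<^sub>K) \<cdot> d\<^sub>K) \<odot> e\<^sub>H)"
    by (simp add: A_def)
  also have "\<dots> = ((w \<bullet> \<I>) \<odot> \<mm>\<^sub>J) \<cdot> (\<aa>\<^sub>\<odot> (K \<bullet> \<I>) \<J> \<J> \<cdot> ((((u\<^sub>K \<bullet> \<I>) \<cdot> \<Delta>\<^sub>I) \<odot> \<J>) \<odot> \<J>)) \<cdot> (inv \<ll>\<^sub>\<odot> \<J> \<odot> \<J>) \<cdot> (e\<^sub>K \<odot> e\<^sub>H)"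
    unfolding k(17) by (simp add: A_def)
  also have "\<dots> = (((w \<cdot> u\<^sub>K) \<bullet> \<I>) \<odot> \<mm>\<^sub>J) \<cdot> (\<Delta>\<^sub>I \<odot> (\<J> \<odot> \<J>)) \<cdot> (\<aa>\<^sub>\<odot> \<I> \<J> \<J> \<cdot> (inv \<ll>\<^sub>\<odot> \<J> \<odot> \<J>)) \<cdot> (e\<^sub>K \<odot> e\<^sub>H)"
    by (subst circ.asc_nat) (simp_all add: A_def)
  also have "\<aa>\<^sub>\<odot> \<I> \<J> \<J> \<cdot> (inv \<ll>\<^sub>\<odot> \<J> \<odot> \<J>) = inv \<ll>\<^sub>\<odot> (\<J> \<odot> \<J>)"
    by (simp flip: circ.inv_lun_tensor)
  also have "(((w \<cdot> u\<^sub>K) \<bullet> \<I>) \<odot> \<mm>\<^sub>J) \<cdot> (\<Delta>\<^sub>I \<odot> (\<J> \<odot> \<J>)) \<cdot> inv \<ll>\<^sub>\<odot> (\<J> \<odot> \<J>) \<cdot> (e\<^sub>K \<odot> e\<^sub>H)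
      = (((w \<cdot> u\<^sub>K) \<bullet> \<I>) \<odot> \<J>) \<cdot> (\<Delta>\<^sub>I \<odot> \<J>) \<cdot> inv \<ll>\<^sub>\<odot> \<J> \<cdot> \<mm>\<^sub>J \<cdot> (e\<^sub>K \<odot> e\<^sub>H)"
    by (simp add: circ.inv_lun_nat A_def)
  finally show ?thesis
    using psi m by (simp add: right_antipode_def circ.hom_iff A_def w_def)
qed

end

section \<open>Reversing both tensor products\<close>

text \<open>When both products are reversed, an interchange with its four arguments read backwards
  again has the required source and target. Arrows and composition stay the same, so homs, inverses
  and isomorphisms do too.\<close>

definition duoidal_rev :: "('a, 'b) duoidal_scheme \<Rightarrow> ('a, 'b) duoidal_scheme"
  where "duoidal_rev D = D\<lparr>circ := rev_tensor D (circ D), bul := rev_tensor D (bul D),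
    interchange := (\<lambda>X Y Z T. interchange D T Z Y X)\<rparr>"

lemma duoidal_rev_hom [simp]: "hom (duoidal_rev D) = hom D"
  by (simp add: fun_eq_iff hom_def duoidal_rev_def)

lemma duoidal_rev_objects [simp]: "objects (duoidal_rev D) = objects D"
  by (simp add: objects_def duoidal_rev_def)

lemma duoidal_rev_inverse_arrows [simp]: "inverse_arrows (duoidal_rev D) = inverse_arrows D"
  by (simp add: fun_eq_iff inverse_arrows_def hom_def duoidal_rev_def)

lemma duoidal_rev_iso [simp]: "iso (duoidal_rev D) = iso D"
  by (simp add: fun_eq_iff iso_def)

lemma duoidal_rev_inverse_arrow [simp]: "inverse_arrow (duoidal_rev D) = inverse_arrow D"
  by (simp add: fun_eq_iff inverse_arrow_def)

lemma duoidal_rev_sel [simp]: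
  "arrows (duoidal_rev D) = arrows D" "source (duoidal_rev D) = source D" "target (duoidal_rev D) = target D"
  "compose (duoidal_rev D) = compose D"
  "tensor (circ (duoidal_rev D)) = (\<lambda>f g. tensor (circ D) g f)" "tunit (circ (duoidal_rev D)) = tunit (circ D)"
  "assoc (circ (duoidal_rev D)) = (\<lambda>X Y Z. inverse_arrow D (assoc (circ D) Z Y X))"
  "lunitor (circ (duoidal_rev D)) = runitor (circ D)" "runitor (circ (duoidal_rev D)) = lunitor (circ D)"
  "tensor (bul (duoidal_rev D)) = (\<lambda>f g. tensor (bul D) g f)" "tunit (bul (duoidal_rev D)) = tunit (bul D)"
  "assoc (bul (duoidal_rev D)) = (\<lambda>X Y Z. inverse_arrow D (assoc (bul D) Z Y X))"
  "lunitor (bul (duoidal_rev D)) = runitor (bul D)" "runitor (bul (duoidal_rev D)) = lunitor (bul D)"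
  "interchange (duoidal_rev D) = (\<lambda>X Y Z T. interchange D T Z Y X)"
  "comult_I (duoidal_rev D) = comult_I D" "mult_J (duoidal_rev D) = mult_J D" "counit_I (duoidal_rev D) = counit_I D"
  by (simp_all add: duoidal_rev_def rev_tensor_def)

lemma monoidal_category_duoidal_rev: "monoidal_category (duoidal_rev D) M = monoidal_category D M"
  by (simp add: monoidal_category_def monoidal_category_axioms_def category_def)

section \<open>The axioms of the reversed duoidal category\<close>

context duoidal_category
begin

text \<open>Reversal replaces associators by their inverses, so here and in the next three lemmas
  the associativity laws are put into the form they take afterwards.\<close>

lemma zeta_circ_assoc_inv:
  assumes [simp]: "X \<in> Ob" "Y \<in> Ob" "Z \<in> Ob" "T \<in> Ob" "U \<in> Ob" "V \<in> Ob"
  shows "\<zeta> (X \<odot> Z) (Y \<odot> T) U V \<cdot> (\<zeta> X Y Z T \<odot> (U \<bullet> V)) \<cdot> inv \<aa>\<^sub>\<odot> (X \<bullet> Y) (Z \<bullet> T) (U \<bullet> V)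
    = (inv \<aa>\<^sub>\<odot> X Z U \<bullet> inv \<aa>\<^sub>\<odot> Y T V) \<cdot> \<zeta> X Y (Z \<odot> U) (T \<odot> V) \<cdot> ((X \<bullet> Y) \<odot> \<zeta> Z T U V)"
proof -
  have "inv (\<aa>\<^sub>\<odot> X Z U \<bullet> \<aa>\<^sub>\<odot> Y T V) \<cdot> (\<zeta> X Y (Z \<odot> U) (T \<odot> V) \<cdot> ((X \<bullet> Y) \<odot> \<zeta> Z T U V))
      = (\<zeta> (X \<odot> Z) (Y \<odot> T) U V \<cdot> (\<zeta> X Y Z T \<odot> (U \<bullet> V))) \<cdot> inv \<aa>\<^sub>\<odot> (X \<bullet> Y) (Z \<bullet> T) (U \<bullet> V)"
    by (rule circ.iso_square) (use zeta_circ_assoc[of X Y Z T U V] in simp_all)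
  then show ?thesis
    by simp
qed

lemma zeta_bul_assoc_inv:
  assumes [simp]: "A \<in> Ob" "B \<in> Ob" "E \<in> Ob" "X \<in> Ob" "Y \<in> Ob" "Z \<in> Ob"
  shows "(\<zeta> A B X Y \<bullet> (E \<odot> Z)) \<cdot> \<zeta> (A \<bullet> B) E (X \<bullet> Y) Z \<cdot> (inv \<aa>\<^sub>\<bullet> A B E \<odot> inv \<aa>\<^sub>\<bullet> X Y Z)
    = inv \<aa>\<^sub>\<bullet> (A \<odot> X) (B \<odot> Y) (E \<odot> Z) \<cdot> ((A \<odot> X) \<bullet> \<zeta> B E Y Z) \<cdot> \<zeta> A (B \<bullet> E) X (Y \<bullet> Z)"
proof -
  have "inv \<aa>\<^sub>\<bullet> (A \<odot> X) (B \<odot> Y) (E \<odot> Z) \<cdot> (((A \<odot> X) \<bullet> \<zeta> B E Y Z) \<cdot> \<zeta> A (B \<bullet> E) X (Y \<bullet> Z))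
      = ((\<zeta> A B X Y \<bullet> (E \<odot> Z)) \<cdot> \<zeta> (A \<bullet> B) E (X \<bullet> Y) Z) \<cdot> inv (\<aa>\<^sub>\<bullet> A B E \<odot> \<aa>\<^sub>\<bullet> X Y Z)"
    by (rule circ.iso_square) (use zeta_bul_assoc[of A B E X Y Z] in simp_all)
  then show ?thesis
    by simp
qed

lemma J_assoc_inv: "\<mm>\<^sub>J \<cdot> (\<mm>\<^sub>J \<odot> \<J>) \<cdot> inv \<aa>\<^sub>\<odot> \<J> \<J> \<J> = \<mm>\<^sub>J \<cdot> (\<J> \<odot> \<mm>\<^sub>J)"
  using arg_cong[OF J_monoid_laws(1), of "\<lambda>f. f \<cdot> inv \<aa>\<^sub>\<odot> \<J> \<J> \<J>"] by simp

lemma I_coassoc_inv: "inv \<aa>\<^sub>\<bullet> \<I> \<I> \<I> \<cdot> (\<I> \<bullet> \<Delta>\<^sub>I) \<cdot> \<Delta>\<^sub>I = (\<Delta>\<^sub>I \<bullet> \<I>) \<cdot> \<Delta>\<^sub>I"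
  using arg_cong[OF I_comonoid_laws(1), of "\<lambda>f. inv \<aa>\<^sub>\<bullet> \<I> \<I> \<I> \<cdot> f"] by simp

lemma duoidal_category_rev: "duoidal_category (duoidal_rev D)"
proof (intro duoidal_category.intro duoidal_category_axioms.intro)
  show "monoidal_category (duoidal_rev D) (circ (duoidal_rev D))" "monoidal_category (duoidal_rev D) (bul (duoidal_rev D))"
    using circ.monoidal_category_rev_tensor bul.monoidal_category_rev_tensor
    unfolding monoidal_category_duoidal_rev by (simp_all add: duoidal_rev_def)
qed (simp_all add: monoid_object_def comonoid_object_def circ.hom_iff J_monoid_laws(2,3) J_assoc_inv
    I_comonoid_laws(2,3) I_coassoc_inv zeta_natural zeta_circ_assoc_inv zeta_bul_assoc_inv
    zeta_circ_lunit zeta_circ_runit zeta_bul_lunit zeta_bul_runit)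

end

section \<open>Transfer from \<open>\<delta>\<close> to \<open>\<gamma>\<close>, and the antipode of
  the twisted product\<close>

context duoidal_category_with_reversion
begin

lemma reversion_in: "f \<in> Hom X Y \<Longrightarrow> f\<^sup>- \<in> Hom (X\<^sup>-) (Y\<^sup>-)"
  using rev_circ_lax by (simp add: lax_monoidal_endofunctor_def endofunctor_def endofunctor_axioms_def)

lemma phi_circ_in: "\<lbrakk>X \<in> Ob; Y \<in> Ob\<rbrakk> \<Longrightarrow> \<phi>\<^sub>\<odot> X Y \<in> Hom (X\<^sup>- \<odot> Y\<^sup>-) ((Y \<odot> X)\<^sup>-)"
  and phi0_circ_in: "\<phi>\<^sub>0\<^sub>\<odot> \<in> Hom \<I> (\<I>\<^sup>-)"
  using rev_circ_lax
  by (simp_all add: lax_monoidal_endofunctor_def lax_monoidal_endofunctor_axioms_def rev_tensor_def)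

lemma half_reversion: "half_reversion D (reversion D) \<phi>\<^sub>\<odot> \<phi>\<^sub>0\<^sub>\<odot> \<delta>"
proof (intro half_reversion.intro half_reversion_axioms.intro)
qed (fact duoidal_category_axioms reversion_in phi_circ_in phi0_circ_in delta_in delta_nat R3 R7 R16)+

sublocale half: half_reversion D "reversion D" "\<phi>\<^sub>\<odot>" "\<phi>\<^sub>0\<^sub>\<odot>" "\<delta>"
  by (rule half_reversion)

lemma gamma_typing [simp]:
  assumes "X \<in> Ob" "Y \<in> Ob" "Z \<in> Ob" "T \<in> Ob"
  shows "\<gamma> X Y Z T \<in> Arr" "src (\<gamma> X Y Z T) = ((X \<bullet> Y\<^sup>-) \<odot> Z) \<bullet> T" "tgt (\<gamma> X Y Z T) = X \<odot> (Z \<bullet> (Y \<odot> T))"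
  using gamma_in[OF assms] by (simp_all add: circ.hom_iff)

lemma gamma_natural:
  "\<lbrakk>f \<in> Arr; g \<in> Arr; h \<in> Arr; k \<in> Arr; tgt f = X; tgt g = Y; tgt h = Z; tgt k = T\<rbrakk>
    \<Longrightarrow> \<gamma> X Y Z T \<cdot> (((f \<bullet> g\<^sup>-) \<odot> h) \<bullet> k) = (f \<odot> (h \<bullet> (g \<odot> k))) \<cdot> \<gamma> (src f) (src g) (src h) (src k)"
  by (rule gamma_nat) (auto simp: circ.hom_iff)

text \<open>\<open>R1\<close> and, in the next lemma, \<open>R15\<close> with associators moved to
  the sides where the reversed \<open>delta_zeta\<close> and \<open>delta_delta\<close> have
  them.\<close>

lemma gamma_zeta_inv:
  assumes [simp]: "X \<in> Ob" "Y \<in> Ob" "Z \<in> Ob" "T \<in> Ob" "U \<in> Ob" "V \<in> Ob"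
  shows "(X \<odot> ((Z \<odot> U) \<bullet> inv \<aa>\<^sub>\<odot> Y T V)) \<cdot> \<gamma> X Y (Z \<odot> U) (T \<odot> V)
      \<cdot> (\<aa>\<^sub>\<odot> (X \<bullet> Y\<^sup>-) Z U \<bullet> (T \<odot> V)) \<cdot> \<zeta> ((X \<bullet> Y\<^sup>-) \<odot> Z) T U V
    = (X \<odot> \<zeta> Z (Y \<odot> T) U V) \<cdot> \<aa>\<^sub>\<odot> X (Z \<bullet> (Y \<odot> T)) (U \<bullet> V) \<cdot> (\<gamma> X Y Z T \<odot> (U \<bullet> V))"
  by (subst R1) simp_all

lemma gamma_gamma_inv:
  assumes [simp]: "X \<in> Ob" "Y \<in> Ob" "Z \<in> Ob" "T \<in> Ob" "U \<in> Ob" "V \<in> Ob"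
  shows "inv \<aa>\<^sub>\<odot> X Z (U \<bullet> ((T \<odot> Y) \<odot> V)) \<cdot> (X \<odot> ((Z \<odot> (U \<bullet> inv \<aa>\<^sub>\<odot> T Y V)) \<cdot> \<gamma> Z T U (Y \<odot> V)))
      \<cdot> \<gamma> X Y ((Z \<bullet> T\<^sup>-) \<odot> U) V
    = \<gamma> (X \<odot> Z) (T \<odot> Y) U V \<cdot> (((((X \<odot> Z) \<bullet> \<phi>\<^sub>\<odot> Y T) \<cdot> \<zeta> X (Y\<^sup>-) Z (T\<^sup>-)) \<odot> U) \<bullet> V)
      \<cdot> (inv \<aa>\<^sub>\<odot> (X \<bullet> Y\<^sup>-) (Z \<bullet> T\<^sup>-) U \<bullet> V)"
proof -
  have "inv \<aa>\<^sub>\<odot> X Z (U \<bullet> ((T \<odot> Y) \<odot> V)) \<cdot> (X \<odot> (Z \<odot> (U \<bullet> inv \<aa>\<^sub>\<odot> T Y V)))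
      \<cdot> ((X \<odot> \<gamma> Z T U (Y \<odot> V)) \<cdot> \<gamma> X Y ((Z \<bullet> T\<^sup>-) \<odot> U) V \<cdot> (\<aa>\<^sub>\<odot> (X \<bullet> Y\<^sup>-) (Z \<bullet> T\<^sup>-) U \<bullet> V))
      \<cdot> (inv \<aa>\<^sub>\<odot> (X \<bullet> Y\<^sup>-) (Z \<bullet> T\<^sup>-) U \<bullet> V)
    = \<gamma> (X \<odot> Z) (T \<odot> Y) U V \<cdot> ((((X \<odot> Z) \<bullet> \<phi>\<^sub>\<odot> Y T) \<odot> U) \<bullet> V) \<cdot> ((\<zeta> X (Y\<^sup>-) Z (T\<^sup>-) \<odot> U) \<bullet> V)
      \<cdot> (inv \<aa>\<^sub>\<odot> (X \<bullet> Y\<^sup>-) (Z \<bullet> T\<^sup>-) U \<bullet> V)"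
    by (subst R15) (simp_all add: circ.nats)
  then show ?thesis
    by simp
qed

text \<open>Read backwards, the arguments of \<open>\<gamma>\<close> give the type of
  \<open>delta\<close> over the reversed category; the two arguments of
  \<open>\<phi>\<^sub>\<odot>\<close> are exchanged for the same reason.\<close>

lemma half_reversion_rev:
  "half_reversion (duoidal_rev D) (reversion D) (\<lambda>X Y. \<phi>\<^sub>\<odot> Y X) \<phi>\<^sub>0\<^sub>\<odot> (\<lambda>X Y Z T. \<gamma> T Z Y X)"
proof (intro half_reversion.intro half_reversion_axioms.intro)
  show "duoidal_category (duoidal_rev D)"
    by (rule duoidal_category_rev)
qed (use R6 in \<open>simp_all add: reversion_in phi_circ_in phi0_circ_in gamma_in gamma_natural circ.hom_iff
    gamma_zeta_inv gamma_gamma_inv\<close>)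

lemma Phi_half: "half.Phi = \<Phi>"
  by (simp add: fun_eq_iff half.Phi_def rev_phi_def)

lemma gamma_unit:
  assumes [simp]: "X \<in> Ob" "Y \<in> Ob"
  shows "\<gamma> \<I> \<I> Y X \<cdot> (((((\<I> \<bullet> \<phi>\<^sub>0\<^sub>\<odot>) \<cdot> \<Delta>\<^sub>I) \<odot> Y) \<cdot> inv \<ll>\<^sub>\<odot> Y) \<bullet> X) = (\<I> \<odot> (Y \<bullet> inv \<ll>\<^sub>\<odot> X)) \<cdot> inv \<ll>\<^sub>\<odot> (Y \<bullet> X)"
proof -
  interpret op: half_reversion "duoidal_rev D" "reversion D" "\<lambda>X Y. \<phi>\<^sub>\<odot> Y X" "\<phi>\<^sub>0\<^sub>\<odot>" "\<lambda>X Y Z T. \<gamma> T Z Y X"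
    by (rule half_reversion_rev)
  show ?thesis
    using op.delta_unit[of X Y] by simp
qed

lemma gamma_zeta_I:
  assumes [simp]: "X \<in> Ob" "Y \<in> Ob" "Z \<in> Ob" "U \<in> Ob" "V \<in> Ob"
  shows "(V \<odot> (Y \<bullet> inv \<aa>\<^sub>\<odot> U Z X)) \<cdot> \<gamma> V U Y (Z \<odot> X) \<cdot> \<zeta> (V \<bullet> U\<^sup>-) Z Y X
    = (V \<odot> ((\<ll>\<^sub>\<odot> Y \<bullet> ((U \<odot> Z) \<odot> X)) \<cdot> \<zeta> \<I> (U \<odot> Z) Y X)) \<cdot> \<aa>\<^sub>\<odot> V (\<I> \<bullet> (U \<odot> Z)) (Y \<bullet> X)
      \<cdot> ((\<gamma> V U \<I> Z \<cdot> (inv \<rr>\<^sub>\<odot> (V \<bullet> U\<^sup>-) \<bullet> Z)) \<odot> (Y \<bullet> X))"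
proof -
  interpret op: half_reversion "duoidal_rev D" "reversion D" "\<lambda>X Y. \<phi>\<^sub>\<odot> Y X" "\<phi>\<^sub>0\<^sub>\<odot>" "\<lambda>X Y Z T. \<gamma> T Z Y X"
    by (rule half_reversion_rev)
  show ?thesis
    using op.delta_zeta_I[of X Y Z U V] by simp
qed

lemma hopf_monoid_wreath:
  assumes H: "hopf_monoid D (H, m\<^sub>H, u\<^sub>H, d\<^sub>H, e\<^sub>H) S\<^sub>H" and K: "hopf_monoid D (K, m\<^sub>K, u\<^sub>K, d\<^sub>K, e\<^sub>K) S\<^sub>K"
    and dl: "distributive_law D (H, m\<^sub>H, u\<^sub>H) (K, m\<^sub>K, u\<^sub>K) \<psi>"
    and cm: "comor (circ_comonoid D (H, d\<^sub>H, e\<^sub>H) (K, d\<^sub>K, e\<^sub>K)) (circ_comonoid D (K, d\<^sub>K, e\<^sub>K) (H, d\<^sub>H, e\<^sub>H)) \<psi>"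
  shows "hopf_monoid D (wreath_bimonoid D (K, m\<^sub>K, u\<^sub>K, d\<^sub>K, e\<^sub>K) \<psi> (H, m\<^sub>H, u\<^sub>H, d\<^sub>H, e\<^sub>H))
    (\<psi>\<^sup>- \<cdot> \<phi>\<^sub>\<odot> K H \<cdot> (S\<^sub>K \<odot> S\<^sub>H))"
proof -
  interpret op: half_reversion "duoidal_rev D" "reversion D" "\<lambda>X Y. \<phi>\<^sub>\<odot> Y X" "\<phi>\<^sub>0\<^sub>\<odot>" "\<lambda>X Y Z T. \<gamma> T Z Y X"
    by (rule half_reversion_rev)
  have bH: "bimonoid D (H, m\<^sub>H, u\<^sub>H, d\<^sub>H, e\<^sub>H)" and bK: "bimonoid D (K, m\<^sub>K, u\<^sub>K, d\<^sub>K, e\<^sub>K)"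
    using H K by (simp_all add: hopf_monoid_def)
  interpret dm: distributive_monoids D "circ D" H m\<^sub>H u\<^sub>H K m\<^sub>K u\<^sub>K \<psi>
    by (rule distributive_monoids_circ[OF bH bK dl])
  \<comment> \<open>Hence \<open>op.right_antipode\<close> is the second antipode equation of the
    original category.\<close>
  have Psi: "op.Phi X Y = \<Psi> Y X" if "X \<in> Ob" "Y \<in> Ob" for X Y
    using that by (simp add: op.Phi_def rev_psi_def)
  note cH = comonoidD[OF bimonoidD(2)[OF bH]] and cK = comonoidD[OF bimonoidD(2)[OF bK]]
  have rH: "half.right_antipode H m\<^sub>H u\<^sub>H d\<^sub>H e\<^sub>H S\<^sub>H" and lH: "op.right_antipode H m\<^sub>H u\<^sub>H d\<^sub>H e\<^sub>H S\<^sub>H"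
    using H cH by (simp_all add: half.right_antipode_def op.right_antipode_def hopf_monoid_def antipode_def Phi_half Psi circ.hom_iff)
  have rK: "half.right_antipode K m\<^sub>K u\<^sub>K d\<^sub>K e\<^sub>K S\<^sub>K" and lK: "op.right_antipode K m\<^sub>K u\<^sub>K d\<^sub>K e\<^sub>K S\<^sub>K"
    using K cK by (simp_all add: half.right_antipode_def op.right_antipode_def hopf_monoid_def antipode_def Phi_half Psi circ.hom_iff)
  have r: "half.right_antipode (K \<odot> H) dm.m dm.u (\<zeta> K K H H \<cdot> (d\<^sub>K \<odot> d\<^sub>H)) (\<mm>\<^sub>J \<cdot> (e\<^sub>K \<odot> e\<^sub>H)) (\<psi>\<^sup>- \<cdot> \<phi>\<^sub>\<odot> K H \<cdot> (S\<^sub>K \<odot> S\<^sub>H))"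
    using half.right_antipode_circ[OF rH rK, of \<psi> dm.m dm.q] dm.m_psi_right dm.q_uH
    by (simp add: circ.hom_iff dm.n_def dm.u_alt)
  \<comment> \<open>Reversal lists the factors of \<open>K \<odot> H\<close> in the opposite order,
    so \<open>lK\<close> and \<open>lH\<close> change places, and \<open>s\<close>, \<open>k\<close>
    take over from \<open>q\<close>, \<open>n\<close>.\<close>
  have l: "op.right_antipode (K \<odot> H) dm.m dm.u (\<zeta> K K H H \<cdot> (d\<^sub>K \<odot> d\<^sub>H)) (\<mm>\<^sub>J \<cdot> (e\<^sub>K \<odot> e\<^sub>H)) (\<psi>\<^sup>- \<cdot> \<phi>\<^sub>\<odot> K H \<cdot> (S\<^sub>K \<odot> S\<^sub>H))"
    using op.right_antipode_circ[OF lK lH, of \<psi> dm.m dm.s] dm.m_psi_left dm.s_uK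
    by (simp add: circ.hom_iff dm.k_def dm.u_alt)
  have "antipode D (K \<odot> H, dm.m, dm.u, \<zeta> K K H H \<cdot> (d\<^sub>K \<odot> d\<^sub>H), \<mm>\<^sub>J \<cdot> (e\<^sub>K \<odot> e\<^sub>H)) (\<psi>\<^sup>- \<cdot> \<phi>\<^sub>\<odot> K H \<cdot> (S\<^sub>K \<odot> S\<^sub>H))"
    using r l by (simp add: antipode_def half.right_antipode_def op.right_antipode_def Phi_half Psi)
  then show ?thesis
    using bimonoid_wreath[OF bH bK dl cm]
    by (simp only: hopf_monoid_def wreath_bimonoid_def prod.case dm.m_expand dm.u_def)
qed

section \<open>The inverse of the right translation\<close>

text \<open>
  The composite of \<open>\<delta>\<^bsub>X,Y,I,-\<^esub>\<close> with \<open>\<phi>\<^sub>0\<^sub>\<odot>\<close> moves \<open>X\<close> into the first factor, so (R5) recovers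
  \<open>\<gamma>\<^bsub>X \<bullet> Y,Z,I,V\<^esub>\<close> from \<open>\<gamma>\<^bsub>Y,Z,I,V\<^esub>\<close>.
\<close>

lemma gamma_decompose:
  assumes [simp]: "X \<in> Ob" "Y \<in> Ob" "Z \<in> Ob" "V \<in> Ob"
  shows "\<gamma> (X \<bullet> Y) Z \<I> V \<cdot> ((inv \<rr>\<^sub>\<odot> ((X \<bullet> Y) \<bullet> Z\<^sup>-) \<cdot> inv \<aa>\<^sub>\<bullet> X Y (Z\<^sup>-)) \<bullet> V)
    = ((\<rr>\<^sub>\<odot> X \<bullet> Y) \<odot> (\<I> \<bullet> (Z \<odot> V))) \<cdot> \<delta> X Y \<I> (\<I> \<bullet> (Z \<odot> V))
      \<cdot> (X \<bullet> (Y \<odot> (\<aa>\<^sub>\<bullet> (\<I>\<^sup>-) \<I> (Z \<odot> V) \<cdot> (((\<phi>\<^sub>0\<^sub>\<odot> \<bullet> \<I>) \<cdot> \<Delta>\<^sub>I) \<bullet> (Z \<odot> V)))))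
      \<cdot> (X \<bullet> (\<gamma> Y Z \<I> V \<cdot> (inv \<rr>\<^sub>\<odot> (Y \<bullet> Z\<^sup>-) \<bullet> V))) \<cdot> \<aa>\<^sub>\<bullet> X (Y \<bullet> Z\<^sup>-) V"
proof -
  define t where "t = (\<phi>\<^sub>0\<^sub>\<odot> \<bullet> \<I>) \<cdot> \<Delta>\<^sub>I"
  have [simp]: "t \<in> Arr" "src t = \<I>" "tgt t = \<I>\<^sup>- \<bullet> \<I>"
    by (simp_all add: t_def)
  have unit: "\<delta> X (Y \<bullet> Z\<^sup>-) \<I> \<I> \<cdot> (X \<bullet> (((Y \<bullet> Z\<^sup>-) \<odot> t) \<cdot> inv \<rr>\<^sub>\<odot> (Y \<bullet> Z\<^sup>-)))
      = ((inv \<rr>\<^sub>\<odot> X \<bullet> (Y \<bullet> Z\<^sup>-)) \<odot> \<I>) \<cdot> inv \<rr>\<^sub>\<odot> (X \<bullet> (Y \<bullet> Z\<^sup>-))"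
    unfolding t_def by (rule half.delta_unit) simp_all
  have nat: "\<gamma> Y Z (\<I>\<^sup>- \<bullet> \<I>) V \<cdot> (((Y \<bullet> Z\<^sup>-) \<odot> t) \<bullet> V) = (Y \<odot> (t \<bullet> (Z \<odot> V))) \<cdot> \<gamma> Y Z \<I> V"
    using gamma_natural[of Y Z t V] by simp
  have nat': "\<gamma> ((X \<odot> \<I>) \<bullet> Y) Z \<I> V \<cdot> ((((inv \<rr>\<^sub>\<odot> X \<bullet> Y) \<bullet> Z\<^sup>-) \<odot> \<I>) \<bullet> V) = ((inv \<rr>\<^sub>\<odot> X \<bullet> Y) \<odot> (\<I> \<bullet> (Z \<odot> V))) \<cdot> \<gamma> (X \<bullet> Y) Z \<I> V"
    using gamma_natural[of "inv \<rr>\<^sub>\<odot> X \<bullet> Y" Z \<I> V] by simp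
  \<comment> \<open>The two sides of \<open>R5\<close>, at \<open>\<I>\<close> in the fourth and
    fifth place, are precomposed with the same morphism built from \<open>t\<close>. Fact
    \<open>1\<close> moves \<open>t\<close> through \<open>\<gamma>\<close> by naturality; fact
    \<open>2\<close> lets it be consumed by \<open>\<delta>\<close> through
    \<open>unit\<close>.\<close>
  have "(\<delta> X Y \<I> (\<I> \<bullet> (Z \<odot> V)) \<cdot> (X \<bullet> (Y \<odot> \<aa>\<^sub>\<bullet> (\<I>\<^sup>-) \<I> (Z \<odot> V))) \<cdot> (X \<bullet> \<gamma> Y Z (\<I>\<^sup>- \<bullet> \<I>) V)
      \<cdot> \<aa>\<^sub>\<bullet> X ((Y \<bullet> Z\<^sup>-) \<odot> (\<I>\<^sup>- \<bullet> \<I>)) V) \<cdot> ((X \<bullet> (((Y \<bullet> Z\<^sup>-) \<odot> t) \<cdot> inv \<rr>\<^sub>\<odot> (Y \<bullet> Z\<^sup>-))) \<bullet> V)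
    = \<delta> X Y \<I> (\<I> \<bullet> (Z \<odot> V)) \<cdot> (X \<bullet> (Y \<odot> \<aa>\<^sub>\<bullet> (\<I>\<^sup>-) \<I> (Z \<odot> V))) \<cdot> (X \<bullet> (\<gamma> Y Z (\<I>\<^sup>- \<bullet> \<I>) V \<cdot> (((Y \<bullet> Z\<^sup>-) \<odot> t) \<bullet> V)))
      \<cdot> (X \<bullet> (inv \<rr>\<^sub>\<odot> (Y \<bullet> Z\<^sup>-) \<bullet> V)) \<cdot> \<aa>\<^sub>\<bullet> X (Y \<bullet> Z\<^sup>-) V"
    by (simp add: bul.nats)
  also have "\<dots> = \<delta> X Y \<I> (\<I> \<bullet> (Z \<odot> V)) \<cdot> (X \<bullet> (Y \<odot> (\<aa>\<^sub>\<bullet> (\<I>\<^sup>-) \<I> (Z \<odot> V) \<cdot> (t \<bullet> (Z \<odot> V)))))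
      \<cdot> (X \<bullet> (\<gamma> Y Z \<I> V \<cdot> (inv \<rr>\<^sub>\<odot> (Y \<bullet> Z\<^sup>-) \<bullet> V))) \<cdot> \<aa>\<^sub>\<bullet> X (Y \<bullet> Z\<^sup>-) V"
    unfolding nat by simp
  finally have 1: "(\<delta> X Y \<I> (\<I> \<bullet> (Z \<odot> V)) \<cdot> (X \<bullet> (Y \<odot> \<aa>\<^sub>\<bullet> (\<I>\<^sup>-) \<I> (Z \<odot> V))) \<cdot> (X \<bullet> \<gamma> Y Z (\<I>\<^sup>- \<bullet> \<I>) V)
      \<cdot> \<aa>\<^sub>\<bullet> X ((Y \<bullet> Z\<^sup>-) \<odot> (\<I>\<^sup>- \<bullet> \<I>)) V) \<cdot> ((X \<bullet> (((Y \<bullet> Z\<^sup>-) \<odot> t) \<cdot> inv \<rr>\<^sub>\<odot> (Y \<bullet> Z\<^sup>-))) \<bullet> V)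
    = \<delta> X Y \<I> (\<I> \<bullet> (Z \<odot> V)) \<cdot> (X \<bullet> (Y \<odot> (\<aa>\<^sub>\<bullet> (\<I>\<^sup>-) \<I> (Z \<odot> V) \<cdot> (t \<bullet> (Z \<odot> V)))))
      \<cdot> (X \<bullet> (\<gamma> Y Z \<I> V \<cdot> (inv \<rr>\<^sub>\<odot> (Y \<bullet> Z\<^sup>-) \<bullet> V))) \<cdot> \<aa>\<^sub>\<bullet> X (Y \<bullet> Z\<^sup>-) V" .
  have "(\<gamma> ((X \<odot> \<I>) \<bullet> Y) Z \<I> V \<cdot> ((inv \<aa>\<^sub>\<bullet> (X \<odot> \<I>) Y (Z\<^sup>-) \<odot> \<I>) \<bullet> V) \<cdot> (\<delta> X (Y \<bullet> Z\<^sup>-) \<I> \<I> \<bullet> V))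
      \<cdot> ((X \<bullet> (((Y \<bullet> Z\<^sup>-) \<odot> t) \<cdot> inv \<rr>\<^sub>\<odot> (Y \<bullet> Z\<^sup>-))) \<bullet> V)
    = \<gamma> ((X \<odot> \<I>) \<bullet> Y) Z \<I> V \<cdot> ((inv \<aa>\<^sub>\<bullet> (X \<odot> \<I>) Y (Z\<^sup>-) \<odot> \<I>) \<bullet> V)
      \<cdot> ((\<delta> X (Y \<bullet> Z\<^sup>-) \<I> \<I> \<cdot> (X \<bullet> (((Y \<bullet> Z\<^sup>-) \<odot> t) \<cdot> inv \<rr>\<^sub>\<odot> (Y \<bullet> Z\<^sup>-)))) \<bullet> V)"
    by simp
  also have "\<dots> = (\<gamma> ((X \<odot> \<I>) \<bullet> Y) Z \<I> V \<cdot> ((((inv \<rr>\<^sub>\<odot> X \<bullet> Y) \<bullet> Z\<^sup>-) \<odot> \<I>) \<bullet> V))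
      \<cdot> ((inv \<rr>\<^sub>\<odot> ((X \<bullet> Y) \<bullet> Z\<^sup>-) \<cdot> inv \<aa>\<^sub>\<bullet> X Y (Z\<^sup>-)) \<bullet> V)"
    unfolding unit by (simp add: bul.nats circ.inv_run_nat)
  also have "\<dots> = ((inv \<rr>\<^sub>\<odot> X \<bullet> Y) \<odot> (\<I> \<bullet> (Z \<odot> V))) \<cdot> \<gamma> (X \<bullet> Y) Z \<I> V
      \<cdot> ((inv \<rr>\<^sub>\<odot> ((X \<bullet> Y) \<bullet> Z\<^sup>-) \<cdot> inv \<aa>\<^sub>\<bullet> X Y (Z\<^sup>-)) \<bullet> V)"
    unfolding nat' by simp
  finally have 2: "(\<gamma> ((X \<odot> \<I>) \<bullet> Y) Z \<I> V \<cdot> ((inv \<aa>\<^sub>\<bullet> (X \<odot> \<I>) Y (Z\<^sup>-) \<odot> \<I>) \<bullet> V) \<cdot> (\<delta> X (Y \<bullet> Z\<^sup>-) \<I> \<I> \<bullet> V))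
      \<cdot> ((X \<bullet> (((Y \<bullet> Z\<^sup>-) \<odot> t) \<cdot> inv \<rr>\<^sub>\<odot> (Y \<bullet> Z\<^sup>-))) \<bullet> V)
    = ((inv \<rr>\<^sub>\<odot> X \<bullet> Y) \<odot> (\<I> \<bullet> (Z \<odot> V))) \<cdot> \<gamma> (X \<bullet> Y) Z \<I> V
      \<cdot> ((inv \<rr>\<^sub>\<odot> ((X \<bullet> Y) \<bullet> Z\<^sup>-) \<cdot> inv \<aa>\<^sub>\<bullet> X Y (Z\<^sup>-)) \<bullet> V)" .
  have 3: "\<delta> X Y \<I> (\<I> \<bullet> (Z \<odot> V)) \<cdot> (X \<bullet> (Y \<odot> (\<aa>\<^sub>\<bullet> (\<I>\<^sup>-) \<I> (Z \<odot> V) \<cdot> (t \<bullet> (Z \<odot> V)))))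
      \<cdot> (X \<bullet> (\<gamma> Y Z \<I> V \<cdot> (inv \<rr>\<^sub>\<odot> (Y \<bullet> Z\<^sup>-) \<bullet> V))) \<cdot> \<aa>\<^sub>\<bullet> X (Y \<bullet> Z\<^sup>-) V
    = ((inv \<rr>\<^sub>\<odot> X \<bullet> Y) \<odot> (\<I> \<bullet> (Z \<odot> V))) \<cdot> \<gamma> (X \<bullet> Y) Z \<I> V
      \<cdot> ((inv \<rr>\<^sub>\<odot> ((X \<bullet> Y) \<bullet> Z\<^sup>-) \<cdot> inv \<aa>\<^sub>\<bullet> X Y (Z\<^sup>-)) \<bullet> V)"
    unfolding 1[symmetric] 2[symmetric] by (subst R5) simp_all
  have "\<gamma> (X \<bullet> Y) Z \<I> V \<cdot> ((inv \<rr>\<^sub>\<odot> ((X \<bullet> Y) \<bullet> Z\<^sup>-) \<cdot> inv \<aa>\<^sub>\<bullet> X Y (Z\<^sup>-)) \<bullet> V)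
     = ((\<rr>\<^sub>\<odot> X \<bullet> Y) \<odot> (\<I> \<bullet> (Z \<odot> V))) \<cdot> (((inv \<rr>\<^sub>\<odot> X \<bullet> Y) \<odot> (\<I> \<bullet> (Z \<odot> V))) \<cdot> \<gamma> (X \<bullet> Y) Z \<I> V
      \<cdot> ((inv \<rr>\<^sub>\<odot> ((X \<bullet> Y) \<bullet> Z\<^sup>-) \<cdot> inv \<aa>\<^sub>\<bullet> X Y (Z\<^sup>-)) \<bullet> V))"
    by simp
  then show ?thesis
    unfolding 3[symmetric] t_def .
qed

lemma counit_I_comult: "(\<epsilon>\<^sub>I \<bullet> \<I>) \<cdot> \<Delta>\<^sub>I = inv \<ll>\<^sub>\<bullet> \<I>"
proof -
  have "(\<epsilon>\<^sub>I \<bullet> \<I>) \<cdot> \<Delta>\<^sub>I = inv \<ll>\<^sub>\<bullet> \<I> \<cdot> (\<ll>\<^sub>\<bullet> \<I> \<cdot> (\<epsilon>\<^sub>I \<bullet> \<I>) \<cdot> \<Delta>\<^sub>I)"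
    by simp
  then show ?thesis
    unfolding I_comonoid_laws by simp
qed

text \<open>\<open>\<epsilon>\<^sub>I\<close> connects \<open>\<I>\<close> to \<open>\<J>\<close>.
  By naturality the component at \<open>\<J>\<close> is therefore determined, on this composite, by
  the one at \<open>\<I>\<close>, which \<open>gamma_unit\<close> evaluates.\<close>

lemma gamma_J_I: "\<gamma> \<J> \<I> \<I> \<I> \<cdot> ((inv \<rr>\<^sub>\<odot> (\<J> \<bullet> \<I>\<^sup>-) \<cdot> inv \<ll>\<^sub>\<bullet> (\<I>\<^sup>-) \<cdot> \<phi>\<^sub>0\<^sub>\<odot>) \<bullet> \<I>) \<cdot> \<Delta>\<^sub>I = (\<epsilon>\<^sub>I \<odot> ((\<I> \<bullet> inv \<ll>\<^sub>\<odot> \<I>) \<cdot> \<Delta>\<^sub>I)) \<cdot> inv \<ll>\<^sub>\<odot> \<I>"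
proof -
  have a: "inv \<ll>\<^sub>\<bullet> (\<I>\<^sup>-) \<cdot> \<phi>\<^sub>0\<^sub>\<odot> = (\<epsilon>\<^sub>I \<bullet> \<phi>\<^sub>0\<^sub>\<odot>) \<cdot> \<Delta>\<^sub>I"
  proof -
    have "(\<epsilon>\<^sub>I \<bullet> \<phi>\<^sub>0\<^sub>\<odot>) \<cdot> \<Delta>\<^sub>I = (\<J> \<bullet> \<phi>\<^sub>0\<^sub>\<odot>) \<cdot> ((\<epsilon>\<^sub>I \<bullet> \<I>) \<cdot> \<Delta>\<^sub>I)"
      by simp
    then show ?thesis
      unfolding counit_I_comult by (simp add: bul.inv_lun_nat)
  qed
  have n: "\<gamma> \<J> \<I> \<I> \<I> \<cdot> (((\<epsilon>\<^sub>I \<bullet> \<I>\<^sup>-) \<odot> \<I>) \<bullet> \<I>) = (\<epsilon>\<^sub>I \<odot> (\<I> \<bullet> (\<I> \<odot> \<I>))) \<cdot> \<gamma> \<I> \<I> \<I> \<I>"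
    using gamma_natural[of \<epsilon>\<^sub>I \<I> \<I> \<I>] by simp
  have "\<gamma> \<J> \<I> \<I> \<I> \<cdot> ((inv \<rr>\<^sub>\<odot> (\<J> \<bullet> \<I>\<^sup>-) \<cdot> inv \<ll>\<^sub>\<bullet> (\<I>\<^sup>-) \<cdot> \<phi>\<^sub>0\<^sub>\<odot>) \<bullet> \<I>) \<cdot> \<Delta>\<^sub>I
     = (\<gamma> \<J> \<I> \<I> \<I> \<cdot> (((\<epsilon>\<^sub>I \<bullet> \<I>\<^sup>-) \<odot> \<I>) \<bullet> \<I>)) \<cdot> (((((\<I> \<bullet> \<phi>\<^sub>0\<^sub>\<odot>) \<cdot> \<Delta>\<^sub>I) \<odot> \<I>) \<cdot> inv \<rr>\<^sub>\<odot> \<I>) \<bullet> \<I>) \<cdot> \<Delta>\<^sub>I"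
    unfolding a by (simp add: circ.inv_run_nat)
  also have "\<dots> = (\<epsilon>\<^sub>I \<odot> (\<I> \<bullet> (\<I> \<odot> \<I>))) \<cdot> (\<gamma> \<I> \<I> \<I> \<I> \<cdot> (((((\<I> \<bullet> \<phi>\<^sub>0\<^sub>\<odot>) \<cdot> \<Delta>\<^sub>I) \<odot> \<I>) \<cdot> inv \<ll>\<^sub>\<odot> \<I>) \<bullet> \<I>)) \<cdot> \<Delta>\<^sub>I"
    unfolding n by (simp add: circ.lun_unt)
  also have "\<dots> = (\<epsilon>\<^sub>I \<odot> ((\<I> \<bullet> inv \<ll>\<^sub>\<odot> \<I>) \<cdot> \<Delta>\<^sub>I)) \<cdot> inv \<ll>\<^sub>\<odot> \<I>"
    by (subst gamma_unit) (simp_all add: circ.inv_lun_nat)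
  finally show ?thesis .
qed

text \<open>For the cofree comodule \<open>X \<bullet> \<I>\<close> this is the identity x S(i1) i2
  = x \<epsilon>(i), with \<open>\<phi>\<^sub>0\<^sub>\<odot>\<close> as S. The case of
  \<open>\<J>\<close> is \<open>gamma_J_I\<close>; coassociativity of
  \<open>\<Delta>\<^sub>I\<close>, in the form \<open>tv\<close>, carries its value through
  \<open>\<delta>\<close>.\<close>

lemma gamma_coaction:
  assumes [simp]: "X \<in> Ob"
  shows "\<gamma> X \<I> \<I> \<I> \<cdot> ((inv \<rr>\<^sub>\<odot> (X \<bullet> \<I>\<^sup>-) \<cdot> (X \<bullet> \<phi>\<^sub>0\<^sub>\<odot>)) \<bullet> \<I>) \<cdot> inv \<aa>\<^sub>\<bullet> X \<I> \<I> \<cdot> (X \<bullet> \<Delta>\<^sub>I)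
    = (X \<odot> ((\<I> \<bullet> inv \<ll>\<^sub>\<odot> \<I>) \<cdot> \<Delta>\<^sub>I)) \<cdot> inv \<rr>\<^sub>\<odot> X \<cdot> \<rr>\<^sub>\<bullet> X \<cdot> (X \<bullet> \<epsilon>\<^sub>I)"
proof -
  define t where "t = (\<phi>\<^sub>0\<^sub>\<odot> \<bullet> \<I>) \<cdot> \<Delta>\<^sub>I"
  have [simp]: "t \<in> Arr" "src t = \<I>" "tgt t = \<I>\<^sup>- \<bullet> \<I>"
    by (simp_all add: t_def)
  define v where "v = (\<I> \<bullet> inv \<ll>\<^sub>\<odot> \<I>) \<cdot> \<Delta>\<^sub>I"
  have [simp]: "v \<in> Arr" "src v = \<I>" "tgt v = \<I> \<bullet> (\<I> \<odot> \<I>)"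
    by (simp_all add: v_def)
  have tv: "\<aa>\<^sub>\<bullet> (\<I>\<^sup>-) \<I> (\<I> \<odot> \<I>) \<cdot> (t \<bullet> (\<I> \<odot> \<I>)) \<cdot> v = (\<I>\<^sup>- \<bullet> v) \<cdot> t"
  proof -
    have "\<aa>\<^sub>\<bullet> (\<I>\<^sup>-) \<I> (\<I> \<odot> \<I>) \<cdot> (t \<bullet> (\<I> \<odot> \<I>)) \<cdot> v = (\<phi>\<^sub>0\<^sub>\<odot> \<bullet> (\<I> \<bullet> inv \<ll>\<^sub>\<odot> \<I>)) \<cdot> (\<aa>\<^sub>\<bullet> \<I> \<I> \<I> \<cdot> (\<Delta>\<^sub>I \<bullet> \<I>) \<cdot> \<Delta>\<^sub>I)"
      by (simp add: t_def v_def bul.nats)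
    also have "\<dots> = (\<I>\<^sup>- \<bullet> v) \<cdot> t"
      unfolding I_comonoid_laws by (simp add: t_def v_def)
    finally show ?thesis .
  qed
  have n: "\<gamma> (X \<bullet> \<J>) \<I> \<I> \<I> \<cdot> (((inv \<rr>\<^sub>\<bullet> X \<bullet> \<I>\<^sup>-) \<odot> \<I>) \<bullet> \<I>) = (inv \<rr>\<^sub>\<bullet> X \<odot> (\<I> \<bullet> (\<I> \<odot> \<I>))) \<cdot> \<gamma> X \<I> \<I> \<I>"
    using gamma_natural[of "inv \<rr>\<^sub>\<bullet> X" \<I> \<I> \<I>] by simp
  have d: "\<delta> X \<J> \<I> (\<I> \<bullet> (\<I> \<odot> \<I>)) \<cdot> (X \<bullet> (\<J> \<odot> (\<I>\<^sup>- \<bullet> v))) = (((X \<odot> \<I>) \<bullet> \<J>) \<odot> v) \<cdot> \<delta> X \<J> \<I> \<I>"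
    using half.delta_natural[of X \<J> \<I> v] by simp
  have tri: "inv \<rr>\<^sub>\<bullet> X \<bullet> \<I>\<^sup>- = inv \<aa>\<^sub>\<bullet> X \<J> (\<I>\<^sup>-) \<cdot> (X \<bullet> inv \<ll>\<^sub>\<bullet> (\<I>\<^sup>-))"
    by (simp add: bul.triangle_inv)
  \<comment> \<open>Composing with \<open>inv \<rr>\<^sub>\<bullet> X\<close> puts
    \<open>X \<bullet> \<J>\<close> in place of \<open>X\<close>, a shape that
    \<open>gamma_decompose\<close> can split. The extra factor is cancelled at the end.\<close>
  have "(inv \<rr>\<^sub>\<bullet> X \<odot> (\<I> \<bullet> (\<I> \<odot> \<I>))) \<cdot> (\<gamma> X \<I> \<I> \<I> \<cdot> ((inv \<rr>\<^sub>\<odot> (X \<bullet> \<I>\<^sup>-) \<cdot> (X \<bullet> \<phi>\<^sub>0\<^sub>\<odot>)) \<bullet> \<I>) \<cdot> inv \<aa>\<^sub>\<bullet> X \<I> \<I> \<cdot> (X \<bullet> \<Delta>\<^sub>I))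
    = ((inv \<rr>\<^sub>\<bullet> X \<odot> (\<I> \<bullet> (\<I> \<odot> \<I>))) \<cdot> \<gamma> X \<I> \<I> \<I>) \<cdot> ((inv \<rr>\<^sub>\<odot> (X \<bullet> \<I>\<^sup>-) \<cdot> (X \<bullet> \<phi>\<^sub>0\<^sub>\<odot>)) \<bullet> \<I>) \<cdot> inv \<aa>\<^sub>\<bullet> X \<I> \<I> \<cdot> (X \<bullet> \<Delta>\<^sub>I)"
    by simp
  also have "\<dots> = \<gamma> (X \<bullet> \<J>) \<I> \<I> \<I> \<cdot> ((inv \<rr>\<^sub>\<odot> ((X \<bullet> \<J>) \<bullet> \<I>\<^sup>-) \<cdot> (inv \<rr>\<^sub>\<bullet> X \<bullet> \<I>\<^sup>-) \<cdot> (X \<bullet> \<phi>\<^sub>0\<^sub>\<odot>)) \<bullet> \<I>) \<cdot> inv \<aa>\<^sub>\<bullet> X \<I> \<I> \<cdot> (X \<bullet> \<Delta>\<^sub>I)"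
    unfolding n[symmetric] by (simp add: circ.inv_run_nat)
  also have "\<dots> = (\<gamma> (X \<bullet> \<J>) \<I> \<I> \<I> \<cdot> ((inv \<rr>\<^sub>\<odot> ((X \<bullet> \<J>) \<bullet> \<I>\<^sup>-) \<cdot> inv \<aa>\<^sub>\<bullet> X \<J> (\<I>\<^sup>-)) \<bullet> \<I>))
      \<cdot> ((X \<bullet> (inv \<ll>\<^sub>\<bullet> (\<I>\<^sup>-) \<cdot> \<phi>\<^sub>0\<^sub>\<odot>)) \<bullet> \<I>) \<cdot> inv \<aa>\<^sub>\<bullet> X \<I> \<I> \<cdot> (X \<bullet> \<Delta>\<^sub>I)"
    unfolding tri by simp
  also have "\<dots> = ((\<rr>\<^sub>\<odot> X \<bullet> \<J>) \<odot> (\<I> \<bullet> (\<I> \<odot> \<I>))) \<cdot> \<delta> X \<J> \<I> (\<I> \<bullet> (\<I> \<odot> \<I>))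
      \<cdot> (X \<bullet> (\<J> \<odot> (\<aa>\<^sub>\<bullet> (\<I>\<^sup>-) \<I> (\<I> \<odot> \<I>) \<cdot> (t \<bullet> (\<I> \<odot> \<I>)))))
      \<cdot> (X \<bullet> (\<gamma> \<J> \<I> \<I> \<I> \<cdot> ((inv \<rr>\<^sub>\<odot> (\<J> \<bullet> \<I>\<^sup>-) \<cdot> inv \<ll>\<^sub>\<bullet> (\<I>\<^sup>-) \<cdot> \<phi>\<^sub>0\<^sub>\<odot>) \<bullet> \<I>) \<cdot> \<Delta>\<^sub>I))"
    by (subst gamma_decompose) (simp_all add: bul.nats t_def)
  also have "\<dots> = ((\<rr>\<^sub>\<odot> X \<bullet> \<J>) \<odot> (\<I> \<bullet> (\<I> \<odot> \<I>))) \<cdot> \<delta> X \<J> \<I> (\<I> \<bullet> (\<I> \<odot> \<I>))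
      \<cdot> (X \<bullet> (\<J> \<odot> (\<aa>\<^sub>\<bullet> (\<I>\<^sup>-) \<I> (\<I> \<odot> \<I>) \<cdot> (t \<bullet> (\<I> \<odot> \<I>)) \<cdot> v))) \<cdot> (X \<bullet> ((\<epsilon>\<^sub>I \<odot> \<I>) \<cdot> inv \<rr>\<^sub>\<odot> \<I>))"
    unfolding gamma_J_I v_def[symmetric] by (simp add: circ.lun_unt)
  also have "\<dots> = ((\<rr>\<^sub>\<odot> X \<bullet> \<J>) \<odot> (\<I> \<bullet> (\<I> \<odot> \<I>))) \<cdot> (\<delta> X \<J> \<I> (\<I> \<bullet> (\<I> \<odot> \<I>)) \<cdot> (X \<bullet> (\<J> \<odot> (\<I>\<^sup>- \<bullet> v))))
      \<cdot> (X \<bullet> (\<J> \<odot> t)) \<cdot> (X \<bullet> (inv \<rr>\<^sub>\<odot> \<J> \<cdot> \<epsilon>\<^sub>I))"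
    unfolding tv by (simp add: circ.inv_run_nat)
  also have "\<dots> = ((\<rr>\<^sub>\<odot> X \<bullet> \<J>) \<odot> v) \<cdot> (\<delta> X \<J> \<I> \<I> \<cdot> (X \<bullet> ((\<J> \<odot> ((\<phi>\<^sub>0\<^sub>\<odot> \<bullet> \<I>) \<cdot> \<Delta>\<^sub>I)) \<cdot> inv \<rr>\<^sub>\<odot> \<J>))) \<cdot> (X \<bullet> \<epsilon>\<^sub>I)"
    unfolding d by (simp add: t_def)
  also have "\<dots> = ((X \<bullet> \<J>) \<odot> v) \<cdot> inv \<rr>\<^sub>\<odot> (X \<bullet> \<J>) \<cdot> (X \<bullet> \<epsilon>\<^sub>I)"
    by (subst half.delta_unit) simp_all
  finally have "(inv \<rr>\<^sub>\<bullet> X \<odot> (\<I> \<bullet> (\<I> \<odot> \<I>))) \<cdot> (\<gamma> X \<I> \<I> \<I> \<cdot> ((inv \<rr>\<^sub>\<odot> (X \<bullet> \<I>\<^sup>-) \<cdot> (X \<bullet> \<phi>\<^sub>0\<^sub>\<odot>)) \<bullet> \<I>) \<cdot> inv \<aa>\<^sub>\<bullet> X \<I> \<I> \<cdot> (X \<bullet> \<Delta>\<^sub>I))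
    = ((X \<bullet> \<J>) \<odot> v) \<cdot> inv \<rr>\<^sub>\<odot> (X \<bullet> \<J>) \<cdot> (X \<bullet> \<epsilon>\<^sub>I)" .
  then have "(\<rr>\<^sub>\<bullet> X \<odot> (\<I> \<bullet> (\<I> \<odot> \<I>))) \<cdot> (inv \<rr>\<^sub>\<bullet> X \<odot> (\<I> \<bullet> (\<I> \<odot> \<I>)))
      \<cdot> (\<gamma> X \<I> \<I> \<I> \<cdot> ((inv \<rr>\<^sub>\<odot> (X \<bullet> \<I>\<^sup>-) \<cdot> (X \<bullet> \<phi>\<^sub>0\<^sub>\<odot>)) \<bullet> \<I>) \<cdot> inv \<aa>\<^sub>\<bullet> X \<I> \<I> \<cdot> (X \<bullet> \<Delta>\<^sub>I))
    = (\<rr>\<^sub>\<bullet> X \<odot> (\<I> \<bullet> (\<I> \<odot> \<I>))) \<cdot> ((X \<bullet> \<J>) \<odot> v) \<cdot> inv \<rr>\<^sub>\<odot> (X \<bullet> \<J>) \<cdot> (X \<bullet> \<epsilon>\<^sub>I)"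
    by (simp only:)
  then have "\<gamma> X \<I> \<I> \<I> \<cdot> ((inv \<rr>\<^sub>\<odot> (X \<bullet> \<I>\<^sup>-) \<cdot> (X \<bullet> \<phi>\<^sub>0\<^sub>\<odot>)) \<bullet> \<I>) \<cdot> inv \<aa>\<^sub>\<bullet> X \<I> \<I> \<cdot> (X \<bullet> \<Delta>\<^sub>I)
    = (\<rr>\<^sub>\<bullet> X \<odot> v) \<cdot> inv \<rr>\<^sub>\<odot> (X \<bullet> \<J>) \<cdot> (X \<bullet> \<epsilon>\<^sub>I)"
    by simp
  also have "\<dots> = (X \<odot> v) \<cdot> inv \<rr>\<^sub>\<odot> X \<cdot> \<rr>\<^sub>\<bullet> X \<cdot> (X \<bullet> \<epsilon>\<^sub>I)"
    by (simp add: circ.inv_run_nat)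
  finally show ?thesis
    unfolding v_def .
qed

end

section \<open>Comonoids over \<open>\<I>\<close> and invertibility of the translation\<close>

locale augmented_comonoid = duoidal_category_with_reversion D
  for D :: "('a, 'b) rev_duoidal_scheme" (structure) +
  fixes C d e e0 H d' e' :: 'a
  assumes C: "comonoid (C, d, e)" and H: "comonoid (H, d', e')"
    and e0: "comor (C, d, e) (\<I>, \<Delta>\<^sub>I, \<epsilon>\<^sub>I) e0"
begin

lemma typing [simp]:
  "C \<in> Ob" "d \<in> Arr" "src d = C" "tgt d = C \<bullet> C" "e \<in> Arr" "src e = C" "tgt e = \<J>"
  "H \<in> Ob" "d' \<in> Arr" "src d' = H" "tgt d' = H \<bullet> H" "e' \<in> Arr" "src e' = H" "tgt e' = \<J>"
  "e0 \<in> Arr" "src e0 = C" "tgt e0 = \<I>"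
  using comonoidD(1-7)[OF C] comonoidD(1-7)[OF H] comorD(1-3)[OF e0] by simp_all

text \<open>The right coaction of the comonoid \<open>\<I>\<close> on \<open>C\<close> induced by
  \<open>e0\<close>; the comodule laws are \<open>c_coassoc\<close> and
  \<open>c_counit\<close>.\<close>

definition c where "c = (C \<bullet> e0) \<cdot> d"

lemma c_typing [simp]: "c \<in> Arr" "src c = C" "tgt c = C \<bullet> \<I>"
  by (simp_all add: c_def)

lemma c_coassoc: "(c \<bullet> \<I>) \<cdot> c = inv \<aa>\<^sub>\<bullet> C \<I> \<I> \<cdot> (C \<bullet> \<Delta>\<^sub>I) \<cdot> c"
proof -
  have "(c \<bullet> \<I>) \<cdot> c = ((C \<bullet> e0) \<bullet> e0) \<cdot> inv \<aa>\<^sub>\<bullet> C C C \<cdot> (\<aa>\<^sub>\<bullet> C C C \<cdot> (d \<bullet> C) \<cdot> d)"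
    by (simp add: c_def)
  also have "\<dots> = inv \<aa>\<^sub>\<bullet> C \<I> \<I> \<cdot> (C \<bullet> ((e0 \<bullet> e0) \<cdot> d)) \<cdot> d"
    unfolding comonoidD(8)[OF C] by (simp add: bul.nats)
  also have "\<dots> = inv \<aa>\<^sub>\<bullet> C \<I> \<I> \<cdot> (C \<bullet> \<Delta>\<^sub>I) \<cdot> c"
    unfolding comorD(4)[OF e0, symmetric] by (simp add: c_def)
  finally show ?thesis .
qed

lemma c_counit: "\<rr>\<^sub>\<bullet> C \<cdot> (C \<bullet> \<epsilon>\<^sub>I) \<cdot> c = C"
  using comonoidD(10)[OF C] comorD(5)[OF e0] by (simp add: c_def)

text \<open>\<open>G\<close> is \<open>(u\<^sub>H e0)\<^sup>r\<close>, rewritten with the counits of \<open>I\<close> and \<open>H\<close>; \<open>N\<close> is its inverse.\<close>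

definition G where "G = ((C \<odot> \<J>) \<bullet> \<ll>\<^sub>\<odot> H) \<cdot> \<zeta> C \<I> \<J> H \<cdot> (c \<odot> inv \<ll>\<^sub>\<bullet> H)"
definition N where "N = (C \<odot> (\<ll>\<^sub>\<odot> H \<cdot> \<ll>\<^sub>\<bullet> (\<I> \<odot> H))) \<cdot> \<gamma> C \<I> \<J> H \<cdot> ((((C \<bullet> \<phi>\<^sub>0\<^sub>\<odot>) \<cdot> c) \<odot> \<J>) \<bullet> H)"

lemma G_typing [simp]: "G \<in> Arr" "src G = C \<odot> H" "tgt G = (C \<odot> \<J>) \<bullet> H"
  by (simp_all add: G_def)

lemma N_typing [simp]: "N \<in> Arr" "src N = (C \<odot> \<J>) \<bullet> H" "tgt N = C \<odot> H"
  by (simp_all add: N_def)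

text \<open>\<open>gamma_zeta_I\<close> leaves \<open>\<gamma> C \<I> \<I> \<I>\<close> applied to
  the iterated coaction. Fact \<open>g\<close> evaluates this as c0 S(c1) c2 = c, using the comodule
  laws and \<open>gamma_coaction\<close>; the factor \<open>H\<close> then collapses by
  \<open>zeta_circ_lunit\<close>.\<close>

lemma N_G: "N \<cdot> G = C \<odot> H"
proof -
  define v where "v = (\<I> \<bullet> inv \<ll>\<^sub>\<odot> \<I>) \<cdot> \<Delta>\<^sub>I"
  have [simp]: "v \<in> Arr" "src v = \<I>" "tgt v = \<I> \<bullet> (\<I> \<odot> \<I>)"
    by (simp_all add: v_def)
  have n: "\<gamma> C \<I> \<J> H \<cdot> (((C \<bullet> \<I>\<^sup>-) \<odot> \<J>) \<bullet> \<ll>\<^sub>\<odot> H) = (C \<odot> (\<J> \<bullet> (\<I> \<odot> \<ll>\<^sub>\<odot> H))) \<cdot> \<gamma> C \<I> \<J> (\<I> \<odot> H)"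
    using gamma_natural[of C \<I> \<J> "\<ll>\<^sub>\<odot> H"] by simp
  have z: "((((C \<bullet> \<phi>\<^sub>0\<^sub>\<odot>) \<cdot> c) \<odot> \<J>) \<bullet> (\<I> \<odot> H)) \<cdot> \<zeta> C \<I> \<J> H = \<zeta> (C \<bullet> \<I>\<^sup>-) \<I> \<J> H \<cdot> ((((C \<bullet> \<phi>\<^sub>0\<^sub>\<odot>) \<cdot> c) \<bullet> \<I>) \<odot> (\<J> \<bullet> H))"
    by (simp add: zeta_natural)
  have zv: "\<zeta> \<I> (\<I> \<odot> \<I>) \<J> H \<cdot> (v \<odot> (\<J> \<bullet> H)) = ((\<I> \<odot> \<J>) \<bullet> (inv \<ll>\<^sub>\<odot> \<I> \<odot> H)) \<cdot> \<zeta> \<I> \<I> \<J> H \<cdot> (\<Delta>\<^sub>I \<odot> (\<J> \<bullet> H))"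
    by (simp add: v_def zeta_nats)
  have l: "\<ll>\<^sub>\<odot> H \<cdot> \<ll>\<^sub>\<bullet> (\<I> \<odot> H) = \<ll>\<^sub>\<bullet> H \<cdot> (\<J> \<bullet> \<ll>\<^sub>\<odot> H)"
    by (simp add: bul.lun_nat)
  have g: "\<gamma> C \<I> \<I> \<I> \<cdot> (inv \<rr>\<^sub>\<odot> (C \<bullet> \<I>\<^sup>-) \<bullet> \<I>) \<cdot> (((C \<bullet> \<phi>\<^sub>0\<^sub>\<odot>) \<cdot> c) \<bullet> \<I>) \<cdot> c = (C \<odot> v) \<cdot> inv \<rr>\<^sub>\<odot> C"
  proof -
    have "\<gamma> C \<I> \<I> \<I> \<cdot> (inv \<rr>\<^sub>\<odot> (C \<bullet> \<I>\<^sup>-) \<bullet> \<I>) \<cdot> (((C \<bullet> \<phi>\<^sub>0\<^sub>\<odot>) \<cdot> c) \<bullet> \<I>) \<cdot> c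
      = \<gamma> C \<I> \<I> \<I> \<cdot> ((inv \<rr>\<^sub>\<odot> (C \<bullet> \<I>\<^sup>-) \<cdot> (C \<bullet> \<phi>\<^sub>0\<^sub>\<odot>)) \<bullet> \<I>) \<cdot> ((c \<bullet> \<I>) \<cdot> c)"
      by simp
    also have "\<dots> = (\<gamma> C \<I> \<I> \<I> \<cdot> ((inv \<rr>\<^sub>\<odot> (C \<bullet> \<I>\<^sup>-) \<cdot> (C \<bullet> \<phi>\<^sub>0\<^sub>\<odot>)) \<bullet> \<I>) \<cdot> inv \<aa>\<^sub>\<bullet> C \<I> \<I> \<cdot> (C \<bullet> \<Delta>\<^sub>I)) \<cdot> c"
      unfolding c_coassoc by simp
    also have "\<dots> = (C \<odot> v) \<cdot> inv \<rr>\<^sub>\<odot> C \<cdot> (\<rr>\<^sub>\<bullet> C \<cdot> (C \<bullet> \<epsilon>\<^sub>I) \<cdot> c)"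
      by (subst gamma_coaction) (simp_all add: v_def)
    finally show ?thesis
      unfolding c_counit by simp
  qed
  have "N \<cdot> G = (C \<odot> (\<ll>\<^sub>\<odot> H \<cdot> \<ll>\<^sub>\<bullet> (\<I> \<odot> H))) \<cdot> (\<gamma> C \<I> \<J> H \<cdot> (((C \<bullet> \<I>\<^sup>-) \<odot> \<J>) \<bullet> \<ll>\<^sub>\<odot> H))
      \<cdot> (((((C \<bullet> \<phi>\<^sub>0\<^sub>\<odot>) \<cdot> c) \<odot> \<J>) \<bullet> (\<I> \<odot> H)) \<cdot> \<zeta> C \<I> \<J> H) \<cdot> (c \<odot> inv \<ll>\<^sub>\<bullet> H)"
    by (simp add: N_def G_def)
  also have "\<dots> = (C \<odot> (\<ll>\<^sub>\<odot> H \<cdot> \<ll>\<^sub>\<bullet> (\<I> \<odot> H) \<cdot> (\<J> \<bullet> ((\<I> \<odot> \<ll>\<^sub>\<odot> H) \<cdot> \<aa>\<^sub>\<odot> \<I> \<I> H))))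
      \<cdot> ((C \<odot> (\<J> \<bullet> inv \<aa>\<^sub>\<odot> \<I> \<I> H)) \<cdot> \<gamma> C \<I> \<J> (\<I> \<odot> H) \<cdot> \<zeta> (C \<bullet> \<I>\<^sup>-) \<I> \<J> H)
      \<cdot> ((((C \<bullet> \<phi>\<^sub>0\<^sub>\<odot>) \<cdot> c) \<bullet> \<I>) \<odot> (\<J> \<bullet> H)) \<cdot> (c \<odot> inv \<ll>\<^sub>\<bullet> H)"
    unfolding n z by simp
  also have "\<dots> = (C \<odot> (\<ll>\<^sub>\<odot> H \<cdot> \<ll>\<^sub>\<bullet> (\<I> \<odot> H) \<cdot> (\<ll>\<^sub>\<odot> \<J> \<bullet> ((\<I> \<odot> \<ll>\<^sub>\<odot> H) \<cdot> \<aa>\<^sub>\<odot> \<I> \<I> H)) \<cdot> \<zeta> \<I> (\<I> \<odot> \<I>) \<J> H))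
      \<cdot> \<aa>\<^sub>\<odot> C (\<I> \<bullet> (\<I> \<odot> \<I>)) (\<J> \<bullet> H)
      \<cdot> ((\<gamma> C \<I> \<I> \<I> \<cdot> (inv \<rr>\<^sub>\<odot> (C \<bullet> \<I>\<^sup>-) \<bullet> \<I>) \<cdot> (((C \<bullet> \<phi>\<^sub>0\<^sub>\<odot>) \<cdot> c) \<bullet> \<I>) \<cdot> c) \<odot> inv \<ll>\<^sub>\<bullet> H)"
    by (subst gamma_zeta_I) simp_all
  also have "\<dots> = (C \<odot> (\<ll>\<^sub>\<odot> H \<cdot> \<ll>\<^sub>\<bullet> (\<I> \<odot> H) \<cdot> (\<ll>\<^sub>\<odot> \<J> \<bullet> ((\<I> \<odot> \<ll>\<^sub>\<odot> H) \<cdot> \<aa>\<^sub>\<odot> \<I> \<I> H)) \<cdot> \<zeta> \<I> (\<I> \<odot> \<I>) \<J> H))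
      \<cdot> (\<aa>\<^sub>\<odot> C (\<I> \<bullet> (\<I> \<odot> \<I>)) (\<J> \<bullet> H) \<cdot> ((C \<odot> v) \<odot> (\<J> \<bullet> H))) \<cdot> (inv \<rr>\<^sub>\<odot> C \<odot> (\<J> \<bullet> H)) \<cdot> (C \<odot> inv \<ll>\<^sub>\<bullet> H)"
    unfolding g by simp
  also have "\<dots> = (C \<odot> (\<ll>\<^sub>\<odot> H \<cdot> \<ll>\<^sub>\<bullet> (\<I> \<odot> H) \<cdot> (\<ll>\<^sub>\<odot> \<J> \<bullet> ((\<I> \<odot> \<ll>\<^sub>\<odot> H) \<cdot> \<aa>\<^sub>\<odot> \<I> \<I> H)) \<cdot> (\<zeta> \<I> (\<I> \<odot> \<I>) \<J> H \<cdot> (v \<odot> (\<J> \<bullet> H)))))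
      \<cdot> (\<aa>\<^sub>\<odot> C \<I> (\<J> \<bullet> H) \<cdot> (inv \<rr>\<^sub>\<odot> C \<odot> (\<J> \<bullet> H))) \<cdot> (C \<odot> inv \<ll>\<^sub>\<bullet> H)"
    by (subst circ.asc_nat) simp_all
  also have "\<dots> = (C \<odot> (\<ll>\<^sub>\<odot> H \<cdot> \<ll>\<^sub>\<bullet> (\<I> \<odot> H) \<cdot> (\<ll>\<^sub>\<odot> \<J> \<bullet> ((\<I> \<odot> \<ll>\<^sub>\<odot> H) \<cdot> \<aa>\<^sub>\<odot> \<I> \<I> H \<cdot> (inv \<ll>\<^sub>\<odot> \<I> \<odot> H))) \<cdot> \<zeta> \<I> \<I> \<J> H \<cdot> (\<Delta>\<^sub>I \<odot> (\<J> \<bullet> H))))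
      \<cdot> (C \<odot> inv \<ll>\<^sub>\<odot> (\<J> \<bullet> H)) \<cdot> (C \<odot> inv \<ll>\<^sub>\<bullet> H)"
    unfolding zv by (simp flip: circ.triangle_inv)
  also have "(\<I> \<odot> \<ll>\<^sub>\<odot> H) \<cdot> \<aa>\<^sub>\<odot> \<I> \<I> H \<cdot> (inv \<ll>\<^sub>\<odot> \<I> \<odot> H) = \<I> \<odot> H"
    by (simp add: circ.comp_ext[OF circ.triangle] circ.lun_unt)
  also have "(C \<odot> (\<ll>\<^sub>\<odot> H \<cdot> \<ll>\<^sub>\<bullet> (\<I> \<odot> H) \<cdot> (\<ll>\<^sub>\<odot> \<J> \<bullet> (\<I> \<odot> H)) \<cdot> \<zeta> \<I> \<I> \<J> H \<cdot> (\<Delta>\<^sub>I \<odot> (\<J> \<bullet> H)))) \<cdot> (C \<odot> inv \<ll>\<^sub>\<odot> (\<J> \<bullet> H)) \<cdot> (C \<odot> inv \<ll>\<^sub>\<bullet> H)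
    = (C \<odot> (\<ll>\<^sub>\<bullet> H \<cdot> ((\<ll>\<^sub>\<odot> \<J> \<bullet> \<ll>\<^sub>\<odot> H) \<cdot> \<zeta> \<I> \<I> \<J> H \<cdot> (\<Delta>\<^sub>I \<odot> (\<J> \<bullet> H))) \<cdot> inv \<ll>\<^sub>\<odot> (\<J> \<bullet> H) \<cdot> inv \<ll>\<^sub>\<bullet> H))"
    using arg_cong[OF l, of "\<lambda>f. C \<odot> (f \<cdot> (\<ll>\<^sub>\<odot> \<J> \<bullet> (\<I> \<odot> H)) \<cdot> \<zeta> \<I> \<I> \<J> H \<cdot> (\<Delta>\<^sub>I \<odot> (\<J> \<bullet> H)) \<cdot> inv \<ll>\<^sub>\<odot> (\<J> \<bullet> H) \<cdot> inv \<ll>\<^sub>\<bullet> H)"]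
    by simp
  also have "\<dots> = C \<odot> H"
    by (subst zeta_circ_lunit) simp_all
  finally show ?thesis .
qed

text \<open>\<open>R2\<close> exchanges \<open>\<zeta>\<close> with \<open>\<gamma>\<close>.
  Coassociativity of \<open>d\<close> then isolates \<open>inner\<close> in the second factor,
  namely \<open>N\<close> followed by the projection to \<open>H\<close> along \<open>e0\<close>. It
  reduces to a counit, which the counit law of \<open>C\<close> absorbs.\<close>

lemma G_N: "G \<cdot> N = (C \<odot> \<J>) \<bullet> H"
proof -
  let ?x = "(C \<bullet> \<phi>\<^sub>0\<^sub>\<odot>) \<cdot> c"
  let ?W = "\<J> \<bullet> (\<I> \<odot> H)"
  \<comment> \<open>\<open>R2\<close> needs tensor products in the first and third argument of
    \<open>\<gamma>\<close>. They are created by naturality along \<open>d\<close> and along the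
    comultiplication \<open>inv \<ll>\<^sub>\<bullet> \<J>\<close> of \<open>\<J>\<close>.\<close>
  have n: "(d \<odot> (inv \<ll>\<^sub>\<bullet> \<J> \<bullet> (\<I> \<odot> H))) \<cdot> \<gamma> C \<I> \<J> H = \<gamma> (C \<bullet> C) \<I> (\<J> \<bullet> \<J>) H \<cdot> (((d \<bullet> \<I>\<^sup>-) \<odot> inv \<ll>\<^sub>\<bullet> \<J>) \<bullet> H)"
    using gamma_natural[of d \<I> "inv \<ll>\<^sub>\<bullet> \<J>" H] by simp
  have n0: "(e0 \<odot> ?W) \<cdot> \<gamma> C \<I> \<J> H = \<gamma> \<I> \<I> \<J> H \<cdot> (((e0 \<bullet> \<I>\<^sup>-) \<odot> \<J>) \<bullet> H)"
    using gamma_natural[of e0 \<I> \<J> H] by simp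
  have zG: "\<zeta> C \<I> \<J> H \<cdot> ((C \<bullet> e0) \<odot> (\<J> \<bullet> H)) = ((C \<odot> \<J>) \<bullet> (e0 \<odot> H)) \<cdot> \<zeta> C C \<J> H"
    using zeta_natural[of C e0 \<J> H] by simp
  have zz: "\<zeta> C C \<J> H \<cdot> ((C \<bullet> C) \<odot> (\<J> \<bullet> (\<ll>\<^sub>\<odot> H \<cdot> \<ll>\<^sub>\<bullet> (\<I> \<odot> H)))) = ((C \<odot> \<J>) \<bullet> (C \<odot> (\<ll>\<^sub>\<odot> H \<cdot> \<ll>\<^sub>\<bullet> (\<I> \<odot> H)))) \<cdot> \<zeta> C C \<J> ?W"
    using zeta_natural[of C C \<J> "\<ll>\<^sub>\<odot> H \<cdot> \<ll>\<^sub>\<bullet> (\<I> \<odot> H)"] by simp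
  have z: "\<zeta> C C \<J> H \<cdot> (d \<odot> ((\<J> \<bullet> (\<ll>\<^sub>\<odot> H \<cdot> \<ll>\<^sub>\<bullet> (\<I> \<odot> H))) \<cdot> \<aa>\<^sub>\<bullet> \<J> \<J> (\<I> \<odot> H) \<cdot> (inv \<ll>\<^sub>\<bullet> \<J> \<bullet> (\<I> \<odot> H))))
     = ((C \<odot> \<J>) \<bullet> (C \<odot> (\<ll>\<^sub>\<odot> H \<cdot> \<ll>\<^sub>\<bullet> (\<I> \<odot> H)))) \<cdot> \<zeta> C C \<J> ?W \<cdot> ((C \<bullet> C) \<odot> \<aa>\<^sub>\<bullet> \<J> \<J> (\<I> \<odot> H)) \<cdot> (d \<odot> (inv \<ll>\<^sub>\<bullet> \<J> \<bullet> (\<I> \<odot> H)))"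
    using arg_cong[OF zz, of "\<lambda>f. f \<cdot> (d \<odot> (\<aa>\<^sub>\<bullet> \<J> \<J> (\<I> \<odot> H) \<cdot> (inv \<ll>\<^sub>\<bullet> \<J> \<bullet> (\<I> \<odot> H))))"] by simp
  have z2: "\<zeta> C (C \<bullet> \<I>\<^sup>-) \<J> \<J> \<cdot> ((C \<bullet> ?x) \<odot> (\<J> \<bullet> \<J>)) = ((C \<odot> \<J>) \<bullet> (?x \<odot> \<J>)) \<cdot> \<zeta> C C \<J> \<J>"
    using zeta_natural[of C ?x \<J> \<J>] by simp
  have inv_lb: "inv \<ll>\<^sub>\<bullet> ?W = \<aa>\<^sub>\<bullet> \<J> \<J> (\<I> \<odot> H) \<cdot> (inv \<ll>\<^sub>\<bullet> \<J> \<bullet> (\<I> \<odot> H))"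
    by (simp flip: bul.inv_lun_tensor)
  have coass: "\<aa>\<^sub>\<bullet> C C (\<I>\<^sup>-) \<cdot> (d \<bullet> \<phi>\<^sub>0\<^sub>\<odot>) \<cdot> c = (C \<bullet> ?x) \<cdot> d"
  proof -
    have "\<aa>\<^sub>\<bullet> C C (\<I>\<^sup>-) \<cdot> (d \<bullet> \<phi>\<^sub>0\<^sub>\<odot>) \<cdot> c = (\<aa>\<^sub>\<bullet> C C (\<I>\<^sup>-) \<cdot> ((C \<bullet> C) \<bullet> (\<phi>\<^sub>0\<^sub>\<odot> \<cdot> e0))) \<cdot> (d \<bullet> C) \<cdot> d"
      by (simp add: c_def)
    also have "\<dots> = (C \<bullet> (C \<bullet> (\<phi>\<^sub>0\<^sub>\<odot> \<cdot> e0))) \<cdot> (\<aa>\<^sub>\<bullet> C C C \<cdot> (d \<bullet> C) \<cdot> d)"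
      by (subst bul.asc_nat) simp_all
    finally show ?thesis
      unfolding comonoidD(8)[OF C] by (simp add: c_def)
  qed
  \<comment> \<open>As \<open>e0\<close> is a comonoid morphism, \<open>n0\<close> and
    \<open>ex\<close> replace \<open>C\<close> by \<open>\<I>\<close> in \<open>inner\<close>, where
    \<open>gamma_unit\<close> computes it.\<close>
  define inner where "inner = \<ll>\<^sub>\<odot> H \<cdot> (e0 \<odot> (\<ll>\<^sub>\<odot> H \<cdot> \<ll>\<^sub>\<bullet> (\<I> \<odot> H))) \<cdot> \<gamma> C \<I> \<J> H \<cdot> ((?x \<odot> \<J>) \<bullet> H)"
  have ex: "(e0 \<bullet> \<I>\<^sup>-) \<cdot> ?x = ((\<I> \<bullet> \<phi>\<^sub>0\<^sub>\<odot>) \<cdot> \<Delta>\<^sub>I) \<cdot> e0"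
    using comorD(4)[OF e0] by (simp add: c_def)
  have "inner = \<ll>\<^sub>\<odot> H \<cdot> (\<I> \<odot> (\<ll>\<^sub>\<odot> H \<cdot> \<ll>\<^sub>\<bullet> (\<I> \<odot> H))) \<cdot> ((e0 \<odot> ?W) \<cdot> \<gamma> C \<I> \<J> H) \<cdot> ((?x \<odot> \<J>) \<bullet> H)"
    by (simp add: inner_def)
  also have "\<dots> = \<ll>\<^sub>\<odot> H \<cdot> (\<I> \<odot> (\<ll>\<^sub>\<odot> H \<cdot> \<ll>\<^sub>\<bullet> (\<I> \<odot> H))) \<cdot> \<gamma> \<I> \<I> \<J> H \<cdot> ((((e0 \<bullet> \<I>\<^sup>-) \<cdot> ?x) \<odot> \<J>) \<bullet> H)"
    unfolding n0 by simp
  also have "\<dots> = \<ll>\<^sub>\<odot> H \<cdot> (\<I> \<odot> (\<ll>\<^sub>\<odot> H \<cdot> \<ll>\<^sub>\<bullet> (\<I> \<odot> H))) \<cdot> (\<gamma> \<I> \<I> \<J> H \<cdot> (((((\<I> \<bullet> \<phi>\<^sub>0\<^sub>\<odot>) \<cdot> \<Delta>\<^sub>I) \<odot> \<J>) \<cdot> inv \<ll>\<^sub>\<odot> \<J>) \<bullet> H)) \<cdot> ((\<ll>\<^sub>\<odot> \<J> \<cdot> (e0 \<odot> \<J>)) \<bullet> H)"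
    unfolding ex by simp
  also have "\<dots> = \<ll>\<^sub>\<odot> H \<cdot> (\<I> \<odot> (\<ll>\<^sub>\<odot> H \<cdot> (\<ll>\<^sub>\<bullet> (\<I> \<odot> H) \<cdot> (\<J> \<bullet> inv \<ll>\<^sub>\<odot> H)))) \<cdot> inv \<ll>\<^sub>\<odot> (\<J> \<bullet> H) \<cdot> ((\<ll>\<^sub>\<odot> \<J> \<cdot> (e0 \<odot> \<J>)) \<bullet> H)"
    by (subst gamma_unit) simp_all
  also have "\<dots> = \<ll>\<^sub>\<bullet> H \<cdot> ((\<ll>\<^sub>\<odot> \<J> \<cdot> (e0 \<odot> \<J>)) \<bullet> H)"
    by (simp add: bul.lun_nat circ.comp_ext[OF circ.lun_nat])
  also have "\<ll>\<^sub>\<odot> \<J> \<cdot> (e0 \<odot> \<J>) = \<mm>\<^sub>J \<cdot> (e \<odot> \<J>)"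
    using comorD(5)[OF e0] by (simp flip: J_monoid_laws)
  finally have inner: "inner = \<ll>\<^sub>\<bullet> H \<cdot> ((\<mm>\<^sub>J \<cdot> (e \<odot> \<J>)) \<bullet> H)" .
  have "G \<cdot> N = ((C \<odot> \<J>) \<bullet> (\<ll>\<^sub>\<odot> H \<cdot> (e0 \<odot> H))) \<cdot> \<zeta> C C \<J> H \<cdot> (d \<odot> (inv \<ll>\<^sub>\<bullet> H \<cdot> \<ll>\<^sub>\<odot> H \<cdot> \<ll>\<^sub>\<bullet> (\<I> \<odot> H))) \<cdot> \<gamma> C \<I> \<J> H \<cdot> ((?x \<odot> \<J>) \<bullet> H)"
    using arg_cong[OF zG, of "\<lambda>f. ((C \<odot> \<J>) \<bullet> \<ll>\<^sub>\<odot> H) \<cdot> f \<cdot> (d \<odot> (inv \<ll>\<^sub>\<bullet> H \<cdot> \<ll>\<^sub>\<odot> H \<cdot> \<ll>\<^sub>\<bullet> (\<I> \<odot> H))) \<cdot> \<gamma> C \<I> \<J> H \<cdot> ((?x \<odot> \<J>) \<bullet> H)"]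
    by (simp add: G_def N_def c_def)
  also have "inv \<ll>\<^sub>\<bullet> H \<cdot> \<ll>\<^sub>\<odot> H \<cdot> \<ll>\<^sub>\<bullet> (\<I> \<odot> H) = (\<J> \<bullet> (\<ll>\<^sub>\<odot> H \<cdot> \<ll>\<^sub>\<bullet> (\<I> \<odot> H))) \<cdot> inv \<ll>\<^sub>\<bullet> ?W"
    by (simp add: bul.inv_lun_nat)
  also have "((C \<odot> \<J>) \<bullet> (\<ll>\<^sub>\<odot> H \<cdot> (e0 \<odot> H))) \<cdot> \<zeta> C C \<J> H \<cdot> (d \<odot> ((\<J> \<bullet> (\<ll>\<^sub>\<odot> H \<cdot> \<ll>\<^sub>\<bullet> (\<I> \<odot> H))) \<cdot> inv \<ll>\<^sub>\<bullet> ?W)) \<cdot> \<gamma> C \<I> \<J> H \<cdot> ((?x \<odot> \<J>) \<bullet> H)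
    = ((C \<odot> \<J>) \<bullet> (\<ll>\<^sub>\<odot> H \<cdot> (e0 \<odot> (\<ll>\<^sub>\<odot> H \<cdot> \<ll>\<^sub>\<bullet> (\<I> \<odot> H))))) \<cdot> \<zeta> C C \<J> ?W \<cdot> ((C \<bullet> C) \<odot> \<aa>\<^sub>\<bullet> \<J> \<J> (\<I> \<odot> H))
      \<cdot> ((d \<odot> (inv \<ll>\<^sub>\<bullet> \<J> \<bullet> (\<I> \<odot> H))) \<cdot> \<gamma> C \<I> \<J> H) \<cdot> ((?x \<odot> \<J>) \<bullet> H)"
    unfolding inv_lb using arg_cong[OF z, of "\<lambda>f. ((C \<odot> \<J>) \<bullet> (\<ll>\<^sub>\<odot> H \<cdot> (e0 \<odot> H))) \<cdot> f \<cdot> \<gamma> C \<I> \<J> H \<cdot> ((?x \<odot> \<J>) \<bullet> H)"] by simp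
  also have "\<dots> = ((C \<odot> \<J>) \<bullet> (\<ll>\<^sub>\<odot> H \<cdot> (e0 \<odot> (\<ll>\<^sub>\<odot> H \<cdot> \<ll>\<^sub>\<bullet> (\<I> \<odot> H))))) \<cdot> (\<zeta> C C \<J> ?W \<cdot> ((C \<bullet> C) \<odot> \<aa>\<^sub>\<bullet> \<J> \<J> (\<I> \<odot> H))
      \<cdot> \<gamma> (C \<bullet> C) \<I> (\<J> \<bullet> \<J>) H) \<cdot> ((((d \<bullet> \<phi>\<^sub>0\<^sub>\<odot>) \<cdot> c) \<odot> inv \<ll>\<^sub>\<bullet> \<J>) \<bullet> H)"
    unfolding n by simp
  also have "\<dots> = ((C \<odot> \<J>) \<bullet> (\<ll>\<^sub>\<odot> H \<cdot> (e0 \<odot> (\<ll>\<^sub>\<odot> H \<cdot> \<ll>\<^sub>\<bullet> (\<I> \<odot> H))) \<cdot> \<gamma> C \<I> \<J> H)) \<cdot> \<aa>\<^sub>\<bullet> (C \<odot> \<J>) ((C \<bullet> \<I>\<^sup>-) \<odot> \<J>) H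
      \<cdot> (\<zeta> C (C \<bullet> \<I>\<^sup>-) \<J> \<J> \<bullet> H) \<cdot> (((\<aa>\<^sub>\<bullet> C C (\<I>\<^sup>-) \<cdot> (d \<bullet> \<phi>\<^sub>0\<^sub>\<odot>) \<cdot> c) \<odot> inv \<ll>\<^sub>\<bullet> \<J>) \<bullet> H)"
    by (subst R2[symmetric]) simp_all
  also have "\<dots> = ((C \<odot> \<J>) \<bullet> (\<ll>\<^sub>\<odot> H \<cdot> (e0 \<odot> (\<ll>\<^sub>\<odot> H \<cdot> \<ll>\<^sub>\<bullet> (\<I> \<odot> H))) \<cdot> \<gamma> C \<I> \<J> H)) \<cdot> \<aa>\<^sub>\<bullet> (C \<odot> \<J>) ((C \<bullet> \<I>\<^sup>-) \<odot> \<J>) H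
      \<cdot> ((\<zeta> C (C \<bullet> \<I>\<^sup>-) \<J> \<J> \<cdot> ((C \<bullet> ?x) \<odot> (\<J> \<bullet> \<J>))) \<bullet> H) \<cdot> ((d \<odot> inv \<ll>\<^sub>\<bullet> \<J>) \<bullet> H)"
    unfolding coass by simp
  also have "\<dots> = ((C \<odot> \<J>) \<bullet> (\<ll>\<^sub>\<odot> H \<cdot> (e0 \<odot> (\<ll>\<^sub>\<odot> H \<cdot> \<ll>\<^sub>\<bullet> (\<I> \<odot> H))) \<cdot> \<gamma> C \<I> \<J> H))
      \<cdot> (\<aa>\<^sub>\<bullet> (C \<odot> \<J>) ((C \<bullet> \<I>\<^sup>-) \<odot> \<J>) H \<cdot> (((C \<odot> \<J>) \<bullet> (?x \<odot> \<J>)) \<bullet> H)) \<cdot> ((\<zeta> C C \<J> \<J> \<cdot> (d \<odot> inv \<ll>\<^sub>\<bullet> \<J>)) \<bullet> H)"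
    unfolding z2 by simp
  also have "\<dots> = ((C \<odot> \<J>) \<bullet> inner) \<cdot> \<aa>\<^sub>\<bullet> (C \<odot> \<J>) (C \<odot> \<J>) H \<cdot> ((\<zeta> C C \<J> \<J> \<cdot> (d \<odot> inv \<ll>\<^sub>\<bullet> \<J>)) \<bullet> H)"
    by (subst bul.asc_nat) (simp_all add: inner_def)
  also have "\<dots> = ((C \<odot> \<J>) \<bullet> \<ll>\<^sub>\<bullet> H) \<cdot> (((C \<odot> \<J>) \<bullet> ((\<mm>\<^sub>J \<cdot> (e \<odot> \<J>)) \<bullet> H)) \<cdot> \<aa>\<^sub>\<bullet> (C \<odot> \<J>) (C \<odot> \<J>) H) \<cdot> ((\<zeta> C C \<J> \<J> \<cdot> (d \<odot> inv \<ll>\<^sub>\<bullet> \<J>)) \<bullet> H)"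
    unfolding inner by simp
  also have "((C \<odot> \<J>) \<bullet> ((\<mm>\<^sub>J \<cdot> (e \<odot> \<J>)) \<bullet> H)) \<cdot> \<aa>\<^sub>\<bullet> (C \<odot> \<J>) (C \<odot> \<J>) H = \<aa>\<^sub>\<bullet> (C \<odot> \<J>) \<J> H \<cdot> (((C \<odot> \<J>) \<bullet> (\<mm>\<^sub>J \<cdot> (e \<odot> \<J>))) \<bullet> H)"
    by (simp add: bul.asc_nat)
  also have "((C \<odot> \<J>) \<bullet> \<ll>\<^sub>\<bullet> H) \<cdot> (\<aa>\<^sub>\<bullet> (C \<odot> \<J>) \<J> H \<cdot> (((C \<odot> \<J>) \<bullet> (\<mm>\<^sub>J \<cdot> (e \<odot> \<J>))) \<bullet> H)) \<cdot> ((\<zeta> C C \<J> \<J> \<cdot> (d \<odot> inv \<ll>\<^sub>\<bullet> \<J>)) \<bullet> H)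
      = (((C \<odot> \<J>) \<bullet> \<ll>\<^sub>\<bullet> H) \<cdot> \<aa>\<^sub>\<bullet> (C \<odot> \<J>) \<J> H) \<cdot> ((((C \<odot> \<J>) \<bullet> (\<mm>\<^sub>J \<cdot> (e \<odot> \<J>))) \<cdot> \<zeta> C C \<J> \<J> \<cdot> (d \<odot> inv \<ll>\<^sub>\<bullet> \<J>)) \<bullet> H)"
    by simp
  also have "\<dots> = ((\<rr>\<^sub>\<bullet> (C \<odot> \<J>) \<cdot> ((C \<odot> \<J>) \<bullet> (\<mm>\<^sub>J \<cdot> (e \<odot> \<J>))) \<cdot> \<zeta> C C \<J> \<J> \<cdot> (d \<odot> inv \<ll>\<^sub>\<bullet> \<J>)) \<bullet> H)"
    by (subst bul.triangle) simp_all
  also have "\<rr>\<^sub>\<bullet> (C \<odot> \<J>) \<cdot> ((C \<odot> \<J>) \<bullet> (\<mm>\<^sub>J \<cdot> (e \<odot> \<J>))) \<cdot> \<zeta> C C \<J> \<J> \<cdot> (d \<odot> inv \<ll>\<^sub>\<bullet> \<J>)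
      = (\<rr>\<^sub>\<bullet> (C \<odot> \<J>) \<cdot> ((C \<odot> \<J>) \<bullet> \<mm>\<^sub>J) \<cdot> \<zeta> C \<J> \<J> \<J>) \<cdot> (((C \<bullet> e) \<cdot> d) \<odot> inv \<ll>\<^sub>\<bullet> \<J>)"
  proof -
    have "\<zeta> C \<J> \<J> \<J> \<cdot> ((C \<bullet> e) \<odot> (\<J> \<bullet> \<J>)) = ((C \<odot> \<J>) \<bullet> (e \<odot> \<J>)) \<cdot> \<zeta> C C \<J> \<J>"
      using zeta_natural[of C e \<J> \<J>] by simp
    then have "((C \<odot> \<J>) \<bullet> \<mm>\<^sub>J) \<cdot> (((C \<odot> \<J>) \<bullet> (e \<odot> \<J>)) \<cdot> \<zeta> C C \<J> \<J>) \<cdot> (d \<odot> inv \<ll>\<^sub>\<bullet> \<J>)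
      = ((C \<odot> \<J>) \<bullet> \<mm>\<^sub>J) \<cdot> (\<zeta> C \<J> \<J> \<J> \<cdot> ((C \<bullet> e) \<odot> (\<J> \<bullet> \<J>))) \<cdot> (d \<odot> inv \<ll>\<^sub>\<bullet> \<J>)"
      by (simp only:)
    then show ?thesis by simp
  qed
  also have "\<dots> = C \<odot> \<J>"
    by (subst zeta_bul_runit) (use comonoidD(10)[OF C] in \<open>simp_all add: bul.lun_unt\<close>)
  finally show ?thesis .
qed

lemma G_expand: "G = ((C \<odot> e') \<bullet> (\<ll>\<^sub>\<odot> H \<cdot> (e0 \<odot> H))) \<cdot> \<zeta> C C H H \<cdot> (d \<odot> d')"
proof -
  have inv_lb: "inv \<ll>\<^sub>\<bullet> H = (e' \<bullet> H) \<cdot> d'"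
  proof -
    have "(e' \<bullet> H) \<cdot> d' = inv \<ll>\<^sub>\<bullet> H \<cdot> (\<ll>\<^sub>\<bullet> H \<cdot> (e' \<bullet> H) \<cdot> d')"
      by simp
    then show ?thesis
      unfolding comonoidD(9)[OF H] by simp
  qed
  have "((C \<odot> e') \<bullet> (e0 \<odot> H)) \<cdot> \<zeta> C C H H = \<zeta> C \<I> \<J> H \<cdot> ((C \<bullet> e0) \<odot> (e' \<bullet> H))"
    by (simp add: zeta_natural)
  then have "((C \<odot> \<J>) \<bullet> \<ll>\<^sub>\<odot> H) \<cdot> (((C \<odot> e') \<bullet> (e0 \<odot> H)) \<cdot> \<zeta> C C H H) \<cdot> (d \<odot> d') = ((C \<odot> \<J>) \<bullet> \<ll>\<^sub>\<odot> H) \<cdot> (\<zeta> C \<I> \<J> H \<cdot> ((C \<bullet> e0) \<odot> (e' \<bullet> H))) \<cdot> (d \<odot> d')"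
    by (simp only:)
  then show ?thesis
    unfolding G_def inv_lb c_def by simp
qed

lemma iso_right_translation_counit: "iso D (((C \<odot> e') \<bullet> (\<ll>\<^sub>\<odot> H \<cdot> (e0 \<odot> H))) \<cdot> \<zeta> C C H H \<cdot> (d \<odot> d'))"
  unfolding G_expand[symmetric] by (rule circ.isoI[of _ "C \<odot> H" "(C \<odot> \<J>) \<bullet> H" N]) (simp_all add: circ.hom_iff N_G G_N)

end

section \<open>The theorem\<close>

text \<open>Each identity for \<open>chi\<close> is a law of \<open>\<psi>\<close> followed by
  \<open>K \<odot> e\<^sub>H\<close>, each one for \<open>act\<close> a law followed by the
  projection to \<open>H\<close> along \<open>e0\<close>. Compatibility of \<open>e\<^sub>H\<close>
  and \<open>e0\<close> with products and units turns the result into the stated form.\<close>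

locale augmented_distributive_law = duoidal_category D + distributive_monoids D "circ D" H m\<^sub>H u\<^sub>H K m\<^sub>K u\<^sub>K \<psi>
  for D :: "('a, 'b) duoidal_scheme" (structure) and H m\<^sub>H u\<^sub>H K m\<^sub>K u\<^sub>K \<psi> +
  fixes e\<^sub>H e0 :: 'a
  assumes counit_H_in: "e\<^sub>H \<in> Hom H \<J>" and e0_in: "e0 \<in> Hom K \<I>"
    and counit_H_mult: "e\<^sub>H \<cdot> m\<^sub>H = \<mm>\<^sub>J \<cdot> (e\<^sub>H \<odot> e\<^sub>H)" and counit_H_unit: "e\<^sub>H \<cdot> u\<^sub>H = \<epsilon>\<^sub>I"
    and e0_mult: "e0 \<cdot> m\<^sub>K = \<ll>\<^sub>\<odot> \<I> \<cdot> (e0 \<odot> e0)" and e0_unit: "e0 \<cdot> u\<^sub>K = \<I>"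
begin

lemma aug_typing [simp]: "e\<^sub>H \<in> Arr" "src e\<^sub>H = H" "tgt e\<^sub>H = \<J>" "e0 \<in> Arr" "src e0 = K" "tgt e0 = \<I>"
  using counit_H_in e0_in by (simp_all add: circ.hom_iff)

definition chi where "chi = (K \<odot> e\<^sub>H) \<cdot> \<psi>"
definition act where "act = \<ll>\<^sub>\<odot> H \<cdot> (e0 \<odot> H) \<cdot> \<psi>"

lemma chi_typing [simp]: "chi \<in> Arr" "src chi = H \<odot> K" "tgt chi = K \<odot> \<J>"
  and act_typing [simp]: "act \<in> Arr" "src act = H \<odot> K" "tgt act = H"
  by (simp_all add: chi_def act_def)

lemma chi_mult_H: "chi \<cdot> (m\<^sub>H \<odot> K) = (K \<odot> \<mm>\<^sub>J) \<cdot> \<aa>\<^sub>\<odot> K \<J> \<J> \<cdot> (chi \<odot> \<J>) \<cdot> inv \<aa>\<^sub>\<odot> H K \<J> \<cdot> (H \<odot> chi) \<cdot> \<aa>\<^sub>\<odot> H H K"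
  by (simp add: chi_def psi_mH counit_H_mult circ.nats)

lemma chi_unit_H: "chi \<cdot> (u\<^sub>H \<odot> K) \<cdot> inv \<ll>\<^sub>\<odot> K = (K \<odot> \<epsilon>\<^sub>I) \<cdot> inv \<rr>\<^sub>\<odot> K"
  by (simp add: chi_def psi_uH counit_H_unit)

lemma chi_mult_K: "chi \<cdot> (H \<odot> m\<^sub>K) = (m\<^sub>K \<odot> \<J>) \<cdot> inv \<aa>\<^sub>\<odot> K K \<J> \<cdot> (K \<odot> chi) \<cdot> \<aa>\<^sub>\<odot> K H K \<cdot> (\<psi> \<odot> K) \<cdot> inv \<aa>\<^sub>\<odot> H K K"
  by (simp add: chi_def psi_mK circ.nats)

lemma chi_unit_K: "chi \<cdot> (H \<odot> u\<^sub>K) \<cdot> inv \<rr>\<^sub>\<odot> H = (u\<^sub>K \<odot> e\<^sub>H) \<cdot> inv \<ll>\<^sub>\<odot> H"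
  by (simp add: chi_def psi_uK)

text \<open>The projection from \<open>K \<odot> H\<close> to \<open>H\<close> along
  \<open>e0\<close> commutes with right multiplication by \<open>H\<close>, a consequence of
  \<open>circ.lun_tensor\<close>.\<close>

lemma act_mult_H: "act \<cdot> (m\<^sub>H \<odot> K) = m\<^sub>H \<cdot> (act \<odot> H) \<cdot> inv \<aa>\<^sub>\<odot> H K H \<cdot> (H \<odot> \<psi>) \<cdot> \<aa>\<^sub>\<odot> H H K"
proof -
  have "\<ll>\<^sub>\<odot> H \<cdot> (e0 \<odot> m\<^sub>H) \<cdot> \<aa>\<^sub>\<odot> K H H = (\<ll>\<^sub>\<odot> H \<cdot> (\<I> \<odot> m\<^sub>H)) \<cdot> ((e0 \<odot> (H \<odot> H)) \<cdot> \<aa>\<^sub>\<odot> K H H)"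
    by simp
  also have "\<dots> = m\<^sub>H \<cdot> (\<ll>\<^sub>\<odot> (H \<odot> H) \<cdot> \<aa>\<^sub>\<odot> \<I> H H) \<cdot> ((e0 \<odot> H) \<odot> H)"
    using circ.asc_nat[of e0 H H \<I> H H] by (simp add: circ.lun_nat)
  also have "\<dots> = m\<^sub>H \<cdot> ((\<ll>\<^sub>\<odot> H \<cdot> (e0 \<odot> H)) \<odot> H)"
    by (subst circ.lun_tensor) simp_all
  finally have "(\<ll>\<^sub>\<odot> H \<cdot> (e0 \<odot> m\<^sub>H) \<cdot> \<aa>\<^sub>\<odot> K H H) \<cdot> (\<psi> \<odot> H) \<cdot> inv \<aa>\<^sub>\<odot> H K H \<cdot> (H \<odot> \<psi>) \<cdot> \<aa>\<^sub>\<odot> H H K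
    = (m\<^sub>H \<cdot> ((\<ll>\<^sub>\<odot> H \<cdot> (e0 \<odot> H)) \<odot> H)) \<cdot> (\<psi> \<odot> H) \<cdot> inv \<aa>\<^sub>\<odot> H K H \<cdot> (H \<odot> \<psi>) \<cdot> \<aa>\<^sub>\<odot> H H K"
    by (simp only:)
  then show ?thesis
    by (simp add: act_def psi_mH)
qed

lemma act_unit_H: "act \<cdot> (u\<^sub>H \<odot> K) \<cdot> inv \<ll>\<^sub>\<odot> K = u\<^sub>H \<cdot> e0"
proof -
  have "act \<cdot> (u\<^sub>H \<odot> K) \<cdot> inv \<ll>\<^sub>\<odot> K = (\<ll>\<^sub>\<odot> H \<cdot> (\<I> \<odot> u\<^sub>H)) \<cdot> ((e0 \<odot> \<I>) \<cdot> inv \<rr>\<^sub>\<odot> K)"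
    by (simp add: act_def psi_uH)
  also have "(e0 \<odot> \<I>) \<cdot> inv \<rr>\<^sub>\<odot> K = inv \<rr>\<^sub>\<odot> \<I> \<cdot> e0"
    by (simp add: circ.inv_run_nat)
  also have "(\<ll>\<^sub>\<odot> H \<cdot> (\<I> \<odot> u\<^sub>H)) \<cdot> (inv \<rr>\<^sub>\<odot> \<I> \<cdot> e0) = u\<^sub>H \<cdot> e0"
    by (simp add: circ.lun_nat circ.lun_unt)
  finally show ?thesis .
qed

lemma act_unit_K: "act \<cdot> (H \<odot> u\<^sub>K) \<cdot> inv \<rr>\<^sub>\<odot> H = H"
  by (simp add: act_def psi_uK e0_unit)

text \<open>Let p be the projection to \<open>H\<close> along \<open>e0\<close>. Fact
  \<open>1\<close> says that multiplying by \<open>K\<close> on the left and then applying p is the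
  same as applying p twice; this is multiplicativity of \<open>e0\<close>.\<close>

lemma act_mult_K: "act \<cdot> (H \<odot> m\<^sub>K) = act \<cdot> (act \<odot> K) \<cdot> inv \<aa>\<^sub>\<odot> H K K"
proof -
  have "\<ll>\<^sub>\<odot> H \<cdot> ((e0 \<cdot> m\<^sub>K) \<odot> H) \<cdot> inv \<aa>\<^sub>\<odot> K K H = \<ll>\<^sub>\<odot> H \<cdot> ((\<ll>\<^sub>\<odot> \<I> \<odot> H) \<cdot> inv \<aa>\<^sub>\<odot> \<I> \<I> H) \<cdot> (e0 \<odot> (e0 \<odot> H))"
    by (simp add: e0_mult circ.inv_asc_nat)
  also have "\<dots> = (\<ll>\<^sub>\<odot> H \<cdot> \<ll>\<^sub>\<odot> (\<I> \<odot> H)) \<cdot> (e0 \<odot> (e0 \<odot> H))"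
    by (subst circ.lun_tensor_inv) simp_all
  also have "\<ll>\<^sub>\<odot> H \<cdot> \<ll>\<^sub>\<odot> (\<I> \<odot> H) = \<ll>\<^sub>\<odot> H \<cdot> (\<I> \<odot> \<ll>\<^sub>\<odot> H)"
    by (simp add: circ.lun_nat)
  finally have 1: "\<ll>\<^sub>\<odot> H \<cdot> ((e0 \<cdot> m\<^sub>K) \<odot> H) \<cdot> inv \<aa>\<^sub>\<odot> K K H = \<ll>\<^sub>\<odot> H \<cdot> (e0 \<odot> (\<ll>\<^sub>\<odot> H \<cdot> (e0 \<odot> H)))"
    by simp
  have "act \<cdot> (H \<odot> m\<^sub>K) = (\<ll>\<^sub>\<odot> H \<cdot> ((e0 \<cdot> m\<^sub>K) \<odot> H) \<cdot> inv \<aa>\<^sub>\<odot> K K H) \<cdot> (K \<odot> \<psi>) \<cdot> \<aa>\<^sub>\<odot> K H K \<cdot> (\<psi> \<odot> K) \<cdot> inv \<aa>\<^sub>\<odot> H K K"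
    by (simp add: act_def psi_mK)
  also have "\<dots> = (\<ll>\<^sub>\<odot> H \<cdot> (\<I> \<odot> act)) \<cdot> ((e0 \<odot> (H \<odot> K)) \<cdot> \<aa>\<^sub>\<odot> K H K) \<cdot> (\<psi> \<odot> K) \<cdot> inv \<aa>\<^sub>\<odot> H K K"
    unfolding 1 by (simp add: act_def)
  also have "\<dots> = act \<cdot> (\<ll>\<^sub>\<odot> (H \<odot> K) \<cdot> \<aa>\<^sub>\<odot> \<I> H K) \<cdot> (((e0 \<odot> H) \<cdot> \<psi>) \<odot> K) \<cdot> inv \<aa>\<^sub>\<odot> H K K"
    by (simp add: circ.lun_nat circ.nats)
  also have "\<dots> = act \<cdot> (act \<odot> K) \<cdot> inv \<aa>\<^sub>\<odot> H K K"
    by (subst circ.lun_tensor) (simp_all add: act_def)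
  finally show ?thesis .
qed

lemma right_module_act: "right_module D (circ D) (K, m\<^sub>K, u\<^sub>K) H act"
proof -
  have "act \<cdot> (H \<odot> m\<^sub>K) \<cdot> \<aa>\<^sub>\<odot> H K K = (act \<cdot> (act \<odot> K) \<cdot> inv \<aa>\<^sub>\<odot> H K K) \<cdot> \<aa>\<^sub>\<odot> H K K"
    unfolding act_mult_K[symmetric] by simp
  moreover have "act \<cdot> (H \<odot> u\<^sub>K) = (act \<cdot> (H \<odot> u\<^sub>K) \<cdot> inv \<rr>\<^sub>\<odot> H) \<cdot> \<rr>\<^sub>\<odot> H"
    by simp
  ultimately show ?thesis
    unfolding act_unit_K by (simp add: right_module_def circ.hom_iff)
qed

end

section \<open>Assembling the theorem\<close>

lemma (in duoidal_category) right_translation_unit: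
  assumes "bimonoid D (H, m\<^sub>H, u\<^sub>H, d\<^sub>H, e\<^sub>H)" "comonoid (K, d\<^sub>K, e\<^sub>K)" "e0 \<in> Hom K \<I>"
  shows "right_translation D (K, d\<^sub>K, e\<^sub>K) (H, m\<^sub>H, u\<^sub>H, d\<^sub>H, e\<^sub>H) (u\<^sub>H \<cdot> e0)
    = ((K \<odot> e\<^sub>H) \<bullet> (\<ll>\<^sub>\<odot> H \<cdot> (e0 \<odot> H))) \<cdot> \<zeta> K K H H \<cdot> (d\<^sub>K \<odot> d\<^sub>H)"
proof -
  note [simp] = comonoidD(1-7)[OF bimonoidD(2)[OF assms(1)]] comonoidD(1-7)[OF assms(2)] circ.homD[OF assms(3)]
  have [simp]: "m\<^sub>H \<in> Arr" "src m\<^sub>H = H \<odot> H" "tgt m\<^sub>H = H" "u\<^sub>H \<in> Arr" "src u\<^sub>H = \<I>" "tgt u\<^sub>H = H" "m\<^sub>H \<cdot> (u\<^sub>H \<odot> H) = \<ll>\<^sub>\<odot> H"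
    using bimonoidD(1)[OF assms(1)] by (simp_all add: monoid_object_def circ.hom_iff)
  have "m\<^sub>H \<cdot> ((u\<^sub>H \<cdot> e0) \<odot> H) = (m\<^sub>H \<cdot> (u\<^sub>H \<odot> H)) \<cdot> (e0 \<odot> H)"
    by (simp del: \<open>m\<^sub>H \<cdot> (u\<^sub>H \<odot> H) = \<ll>\<^sub>\<odot> H\<close>)
  then show ?thesis
    by (simp add: right_translation_def)
qed

lemma (in duoidal_category) comor_factor:
  assumes "comonoid (H, d\<^sub>H, e\<^sub>H)" "comonoid (K, d\<^sub>K, e\<^sub>K)" "e0 \<in> Hom K \<I>"
    and "comor (circ_comonoid D (H, d\<^sub>H, e\<^sub>H) (K, d\<^sub>K, e\<^sub>K)) (circ_comonoid D (K, d\<^sub>K, e\<^sub>K) (H, d\<^sub>H, e\<^sub>H)) \<psi>"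
  shows "(((K \<odot> e\<^sub>H) \<bullet> (\<ll>\<^sub>\<odot> H \<cdot> (e0 \<odot> H))) \<cdot> \<zeta> K K H H \<cdot> (d\<^sub>K \<odot> d\<^sub>H)) \<cdot> \<psi>
    = (((K \<odot> e\<^sub>H) \<cdot> \<psi>) \<bullet> (\<ll>\<^sub>\<odot> H \<cdot> (e0 \<odot> H) \<cdot> \<psi>)) \<cdot> (\<zeta> H H K K \<cdot> (d\<^sub>H \<odot> d\<^sub>K))"
proof -
  note [simp] = comonoidD(1-7)[OF assms(1)] comonoidD(1-7)[OF assms(2)] circ.homD[OF assms(3)]
  note psi = comorD[OF assms(4)[unfolded circ_comonoid_def prod.case]]
  note [simp] = psi(1-3)
  have "(((K \<odot> e\<^sub>H) \<bullet> (\<ll>\<^sub>\<odot> H \<cdot> (e0 \<odot> H))) \<cdot> \<zeta> K K H H \<cdot> (d\<^sub>K \<odot> d\<^sub>H)) \<cdot> \<psi>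
    = ((K \<odot> e\<^sub>H) \<bullet> (\<ll>\<^sub>\<odot> H \<cdot> (e0 \<odot> H))) \<cdot> ((\<zeta> K K H H \<cdot> (d\<^sub>K \<odot> d\<^sub>H)) \<cdot> \<psi>)"
    by simp
  then show ?thesis
    unfolding psi(4) by simp
qed

text \<open>That \<open>\<psi>\<close> is determined by \<open>\<chi>\<close> and \<open>act\<close>
  appears both as a formula and as uniqueness. Since \<open>g_r\<close> is built without
  \<open>\<psi>\<close>, cancelling it gives the uniqueness.\<close>

theorem theorem2p33:
  fixes D :: "('a, 'b) rev_duoidal_scheme" (structure)
  assumes "duoidal_category_with_reversion D"
    and "hopf_monoid D (H, m\<^sub>H, u\<^sub>H, \<Delta>\<^sub>H, \<epsilon>\<^sub>H) \<Sigma>\<^sub>H"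
    and "hopf_monoid D (K, m\<^sub>K, u\<^sub>K, \<Delta>\<^sub>K, \<epsilon>\<^sub>K) \<Sigma>\<^sub>K"
    and "distributive_law D (H, m\<^sub>H, u\<^sub>H) (K, m\<^sub>K, u\<^sub>K) \<psi>"
    and "comonoid_morphism D (bul D)
          (circ_comonoid D (H, \<Delta>\<^sub>H, \<epsilon>\<^sub>H) (K, \<Delta>\<^sub>K, \<epsilon>\<^sub>K))
          (circ_comonoid D (K, \<Delta>\<^sub>K, \<epsilon>\<^sub>K) (H, \<Delta>\<^sub>H, \<epsilon>\<^sub>H)) \<psi>"
  shows
    "hopf_monoid D
       (wreath_bimonoid D (K, m\<^sub>K, u\<^sub>K, \<Delta>\<^sub>K, \<epsilon>\<^sub>K) \<psi> (H, m\<^sub>H, u\<^sub>H, \<Delta>\<^sub>H, \<epsilon>\<^sub>H))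
       (\<psi>\<^sup>- \<cdot> \<phi>\<^sub>\<odot> K H \<cdot> (\<Sigma>\<^sub>K \<odot> \<Sigma>\<^sub>H))
     \<and> (\<forall>\<epsilon>\<^sub>0 \<chi> act.
          comonoid_morphism D (bul D) (K, \<Delta>\<^sub>K, \<epsilon>\<^sub>K) (\<I>, \<Delta>\<^sub>I, \<epsilon>\<^sub>I) \<epsilon>\<^sub>0 \<longrightarrow>
          \<chi> = (K \<odot> \<epsilon>\<^sub>H) \<cdot> \<psi> \<longrightarrow>
          act = \<ll>\<^sub>\<odot> H \<cdot> (\<epsilon>\<^sub>0 \<odot> H) \<cdot> \<psi> \<longrightarrow>
          (let g_r = right_translation D (K, \<Delta>\<^sub>K, \<epsilon>\<^sub>K) (H, m\<^sub>H, u\<^sub>H, \<Delta>\<^sub>H, \<epsilon>\<^sub>H) (u\<^sub>H \<cdot> \<epsilon>\<^sub>0)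
           in iso D g_r \<and> \<psi> = inv g_r \<cdot> (\<chi> \<bullet> act) \<cdot> (\<zeta> H H K K \<cdot> (\<Delta>\<^sub>H \<odot> \<Delta>\<^sub>K)))
          \<and> (\<forall>\<psi>'. distributive_law D (H, m\<^sub>H, u\<^sub>H) (K, m\<^sub>K, u\<^sub>K) \<psi>' \<longrightarrow>
                comonoid_morphism D (bul D)
                  (circ_comonoid D (H, \<Delta>\<^sub>H, \<epsilon>\<^sub>H) (K, \<Delta>\<^sub>K, \<epsilon>\<^sub>K))
                  (circ_comonoid D (K, \<Delta>\<^sub>K, \<epsilon>\<^sub>K) (H, \<Delta>\<^sub>H, \<epsilon>\<^sub>H)) \<psi>' \<longrightarrow>
                (K \<odot> \<epsilon>\<^sub>H) \<cdot> \<psi>' = \<chi> \<longrightarrow> \<ll>\<^sub>\<odot> H \<cdot> (\<epsilon>\<^sub>0 \<odot> H) \<cdot> \<psi>' = act \<longrightarrow> \<psi>' = \<psi>)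
          \<and> (bimonoid_morphism D (K, m\<^sub>K, u\<^sub>K, \<Delta>\<^sub>K, \<epsilon>\<^sub>K) (unit_bimonoid D) \<epsilon>\<^sub>0 \<longrightarrow>
                \<chi> \<cdot> (m\<^sub>H \<odot> K)
                  = (K \<odot> \<mm>\<^sub>J) \<cdot> \<aa>\<^sub>\<odot> K \<J> \<J> \<cdot> (\<chi> \<odot> \<J>) \<cdot> inv \<aa>\<^sub>\<odot> H K \<J> \<cdot> (H \<odot> \<chi>) \<cdot> \<aa>\<^sub>\<odot> H H K
              \<and> \<chi> \<cdot> (u\<^sub>H \<odot> K) \<cdot> inv \<ll>\<^sub>\<odot> K = (K \<odot> \<epsilon>\<^sub>I) \<cdot> inv \<rr>\<^sub>\<odot> K
              \<and> \<chi> \<cdot> (H \<odot> m\<^sub>K)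
                  = (m\<^sub>K \<odot> \<J>) \<cdot> inv \<aa>\<^sub>\<odot> K K \<J> \<cdot> (K \<odot> \<chi>) \<cdot> \<aa>\<^sub>\<odot> K H K \<cdot> (\<psi> \<odot> K) \<cdot> inv \<aa>\<^sub>\<odot> H K K
              \<and> \<chi> \<cdot> (H \<odot> u\<^sub>K) \<cdot> inv \<rr>\<^sub>\<odot> H = (u\<^sub>K \<odot> \<epsilon>\<^sub>H) \<cdot> inv \<ll>\<^sub>\<odot> H
              \<and> act \<cdot> (m\<^sub>H \<odot> K) = m\<^sub>H \<cdot> (act \<odot> H) \<cdot> inv \<aa>\<^sub>\<odot> H K H \<cdot> (H \<odot> \<psi>) \<cdot> \<aa>\<^sub>\<odot> H H K
              \<and> act \<cdot> (u\<^sub>H \<odot> K) \<cdot> inv \<ll>\<^sub>\<odot> K = u\<^sub>H \<cdot> \<epsilon>\<^sub>0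
              \<and> act \<cdot> (H \<odot> m\<^sub>K) = act \<cdot> (act \<odot> K) \<cdot> inv \<aa>\<^sub>\<odot> H K K
              \<and> act \<cdot> (H \<odot> u\<^sub>K) \<cdot> inv \<rr>\<^sub>\<odot> H = H
              \<and> right_module D (circ D) (K, m\<^sub>K, u\<^sub>K) H act))"
proof -
  interpret duoidal_category_with_reversion D by fact
  have bH: "bimonoid D (H, m\<^sub>H, u\<^sub>H, \<Delta>\<^sub>H, \<epsilon>\<^sub>H)" and bK: "bimonoid D (K, m\<^sub>K, u\<^sub>K, \<Delta>\<^sub>K, \<epsilon>\<^sub>K)"
    using assms(2,3) by (simp_all add: hopf_monoid_def)
  note cH = bimonoidD(2)[OF bH] and cK = bimonoidD(2)[OF bK]
  note [simp] = comonoidD(1-7)[OF cH] comonoidD(1-7)[OF cK]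
  have hopf: "hopf_monoid D
       (wreath_bimonoid D (K, m\<^sub>K, u\<^sub>K, \<Delta>\<^sub>K, \<epsilon>\<^sub>K) \<psi> (H, m\<^sub>H, u\<^sub>H, \<Delta>\<^sub>H, \<epsilon>\<^sub>H))
       (\<psi>\<^sup>- \<cdot> \<phi>\<^sub>\<odot> K H \<cdot> (\<Sigma>\<^sub>K \<odot> \<Sigma>\<^sub>H))"
    by (rule hopf_monoid_wreath[OF assms(2-5)])
  show ?thesis
  proof (rule conjI[OF hopf], intro allI impI, goal_cases)
    case (1 \<epsilon>\<^sub>0 \<chi> act)
    note e0 = 1(1) and chi = 1(2) and act = 1(3)
    have e0_hom: "\<epsilon>\<^sub>0 \<in> Hom K \<I>"
      using e0 by (simp add: comonoid_morphism_def)
    note [simp] = circ.homD[OF e0_hom]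
    interpret aug: augmented_comonoid D K \<Delta>\<^sub>K \<epsilon>\<^sub>K \<epsilon>\<^sub>0 H \<Delta>\<^sub>H \<epsilon>\<^sub>H
      by (intro augmented_comonoid.intro augmented_comonoid_axioms.intro) fact+
    define g where "g = right_translation D (K, \<Delta>\<^sub>K, \<epsilon>\<^sub>K) (H, m\<^sub>H, u\<^sub>H, \<Delta>\<^sub>H, \<epsilon>\<^sub>H) (u\<^sub>H \<cdot> \<epsilon>\<^sub>0)"
    have g_eq: "g = ((K \<odot> \<epsilon>\<^sub>H) \<bullet> (\<ll>\<^sub>\<odot> H \<cdot> (\<epsilon>\<^sub>0 \<odot> H))) \<cdot> \<zeta> K K H H \<cdot> (\<Delta>\<^sub>K \<odot> \<Delta>\<^sub>H)"
      unfolding g_def by (rule right_translation_unit[OF bH cK e0_hom])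
    have g_iso: "iso D g"
      unfolding g_eq by (rule aug.iso_right_translation_counit)
    have g_src: "g \<in> Arr" "src g = K \<odot> H"
      by (simp_all add: g_eq)
    \<comment> \<open>Stated for every \<open>\<psi>'\<close>, because it is applied to
      \<open>\<psi>\<close> and also to a competitor in the uniqueness claim.\<close>
    have g_psi: "g \<cdot> \<psi>' = (((K \<odot> \<epsilon>\<^sub>H) \<cdot> \<psi>') \<bullet> (\<ll>\<^sub>\<odot> H \<cdot> (\<epsilon>\<^sub>0 \<odot> H) \<cdot> \<psi>')) \<cdot> (\<zeta> H H K K \<cdot> (\<Delta>\<^sub>H \<odot> \<Delta>\<^sub>K))"
      and psi_hom: "\<psi>' \<in> Arr" "tgt \<psi>' = K \<odot> H"
      if "comonoid_morphism D (bul D)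
          (circ_comonoid D (H, \<Delta>\<^sub>H, \<epsilon>\<^sub>H) (K, \<Delta>\<^sub>K, \<epsilon>\<^sub>K))
          (circ_comonoid D (K, \<Delta>\<^sub>K, \<epsilon>\<^sub>K) (H, \<Delta>\<^sub>H, \<epsilon>\<^sub>H)) \<psi>'" for \<psi>'
      unfolding g_eq using comor_factor[OF cH cK e0_hom that] comorD[OF that[unfolded circ_comonoid_def prod.case]]
      by simp_all
    have "\<psi> = inv g \<cdot> (g \<cdot> \<psi>)"
      using g_iso psi_hom[OF assms(5)] g_src by simp
    then have recover: "\<psi> = inv g \<cdot> (((K \<odot> \<epsilon>\<^sub>H) \<cdot> \<psi>) \<bullet> (\<ll>\<^sub>\<odot> H \<cdot> (\<epsilon>\<^sub>0 \<odot> H) \<cdot> \<psi>)) \<cdot> (\<zeta> H H K K \<cdot> (\<Delta>\<^sub>H \<odot> \<Delta>\<^sub>K))"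
      unfolding g_psi[OF assms(5)] .
    have unique: "\<psi>' = \<psi>"
      if "comonoid_morphism D (bul D)
          (circ_comonoid D (H, \<Delta>\<^sub>H, \<epsilon>\<^sub>H) (K, \<Delta>\<^sub>K, \<epsilon>\<^sub>K))
          (circ_comonoid D (K, \<Delta>\<^sub>K, \<epsilon>\<^sub>K) (H, \<Delta>\<^sub>H, \<epsilon>\<^sub>H)) \<psi>'"
        and "(K \<odot> \<epsilon>\<^sub>H) \<cdot> \<psi>' = (K \<odot> \<epsilon>\<^sub>H) \<cdot> \<psi>" "\<ll>\<^sub>\<odot> H \<cdot> (\<epsilon>\<^sub>0 \<odot> H) \<cdot> \<psi>' = \<ll>\<^sub>\<odot> H \<cdot> (\<epsilon>\<^sub>0 \<odot> H) \<cdot> \<psi>" for \<psi>'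
      by (rule circ.iso_cancel_left[OF g_iso])
        (use g_psi[OF that(1)] g_psi[OF assms(5)] that(2,3) psi_hom[OF that(1)] psi_hom[OF assms(5)] g_src in simp_all)
    have aug: "augmented_distributive_law D H m\<^sub>H u\<^sub>H K m\<^sub>K u\<^sub>K \<psi> \<epsilon>\<^sub>H \<epsilon>\<^sub>0"
      if "bimonoid_morphism D (K, m\<^sub>K, u\<^sub>K, \<Delta>\<^sub>K, \<epsilon>\<^sub>K) (unit_bimonoid D) \<epsilon>\<^sub>0"
    proof (intro augmented_distributive_law.intro augmented_distributive_law_axioms.intro)
      show "distributive_monoids D (circ D) H m\<^sub>H u\<^sub>H K m\<^sub>K u\<^sub>K \<psi>"
        by (rule distributive_monoids_circ[OF bH bK assms(4)])
      show "\<epsilon>\<^sub>0 \<cdot> m\<^sub>K = \<ll>\<^sub>\<odot> \<I> \<cdot> (\<epsilon>\<^sub>0 \<odot> \<epsilon>\<^sub>0)" "\<epsilon>\<^sub>0 \<cdot> u\<^sub>K = \<I>"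
        using that by (simp_all add: bimonoid_morphism_def unit_bimonoid_def monoid_morphism_def)
      show "\<epsilon>\<^sub>H \<cdot> m\<^sub>H = \<mm>\<^sub>J \<cdot> (\<epsilon>\<^sub>H \<odot> \<epsilon>\<^sub>H)" "\<epsilon>\<^sub>H \<cdot> u\<^sub>H = \<epsilon>\<^sub>I"
        using bH by (simp_all add: bimonoid_def)
    qed (simp_all add: circ.hom_iff duoidal_category_axioms)
    show ?case
    proof (intro conjI, goal_cases)
      case 1
      show ?case
        using g_iso recover unfolding Let_def g_def[symmetric] chi act by (rule conjI)
    next
      case 2
      show ?case
        using unique unfolding chi act by blast
    next
      case 3
      show ?case
      proof (rule impI, goal_cases)
        case 1
        interpret L: augmented_distributive_law D H m\<^sub>H u\<^sub>H K m\<^sub>K u\<^sub>K \<psi> \<epsilon>\<^sub>H \<epsilon>\<^sub>0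
          by (rule aug[OF 1])
        have eq: "L.chi = \<chi>" "L.act = act"
          by (simp_all only: L.chi_def L.act_def chi act)
        show ?case
          by (intro conjI L.chi_mult_H[unfolded eq] L.chi_unit_H[unfolded eq] L.chi_mult_K[unfolded eq]
              L.chi_unit_K[unfolded eq] L.act_mult_H[unfolded eq] L.act_unit_H[unfolded eq]
              L.act_mult_K[unfolded eq] L.act_unit_K[unfolded eq] L.right_module_act[unfolded eq])
      qed
    qed
  qed
qed

end
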